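(* Let $w_1,w_2,w_3$ be coprime positive integers, let $f(x_1,x_2,x_3)$ be a polynomial with real coefficients which is weighted homogeneous with respect to $w=(w_1,w_2,w_3)$, and let $X=\{(x_1,x_2,x_3)\in\mathbb{C}^3 : f(x_1,x_2,x_3)=0\}$ be the surface defined by $f$. Suppose that $X$ is irreducible and that the singularity of $X$ at $0\in\mathbb{C}^3$ is isolated. Put $X(\mathbb{R})=\{(x_1,x_2,x_3)\in\mathbb{R}^3 : f(x_1,x_2,x_3)=0\}$, and let $\pi:X\setminus\{0\}\to M$ be the quotient projection onto the orbit space $M=(X\setminus\{0\})/\mathbb{C}^*$ of the weighted $\mathbb{C}^*$-action $t\cdot(x_1,x_2,x_3)=(t^{w_1}x_1,t^{w_2}x_2,t^{w_3}x_3)$. If 1. $w_3<\inf\{w_1,w_2\}$; 2. $\pi(X(\mathbb{R})\setminus\{0\})\subset M$ has more than one connected component; 3. $X(\mathbb{R})\cap\{(x_1,x_2,x_3)\in\mathbb{R}^3 : x_1x_2x_3=0\}=\{0\}$, then the singularity of $X$ at $0\in\mathbb{C}^3$ is not metrically conic.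
   Context: A nonzero polynomial $f$ is weighted homogeneous with respect to $w=(w_1,w_2,w_3)$ if there is a positive integer $d$ such that $f(t^{w_1}x_1,t^{w_2}x_2,t^{w_3}x_3)=t^d f(x_1,x_2,x_3)$ for all $t\in\mathbb{C}^*=\mathbb{C}\setminus\{0\}$ and all $(x_1,x_2,x_3)\in\mathbb{C}^3$; its zero set $X$ is then invariant under the weighted $\mathbb{C}^*$-action. "Coprime" means that the three integers have no common factor greater than $1$. $M$ carries the quotient topology; $(\pi,M)$ is the Seifert fibration of $X\setminus\{0\}$ associated to $w$. Inner metric: for a connected set $Z$ (an algebraic set, its intersection with a ball, or a cone) in a Euclidean space, the inner distance $d(x,y)$ between $x,y\in Z$ is the infimum of the lengths of rectifiable arcs $\gamma:[0,1]\to Z$ with $\gamma(0)=x$, $\gamma(1)=y$. Metrically conic: let $B_\epsilon[x_0]$ be the closed ball of radius $\epsilon$ centered at $x_0$. An isolated singular point $x_0\in X$ is metrically conic if for all sufficiently small $\epsilon>0$ there exist a Nash manifold $N$ (a smooth semialgebraic submanifold of a Euclidean space; for the cone, $N$ is regarded as a subset of a unit sphere $\{x\in\mathbb{R}^m:\|x\|=1\}$) and a homeomorphism $h:c[N]\to X\cap B_\epsilon[x_0]$ which is bi-Lipschitz with respect to the inner metrics, where $c[N]$ is the cone over $N$ (the union of the straight segments joining the origin to the points of $N$). It is not required that $h$ be semialgebraic, nor that $N$ be homeomorphic to the link $X\cap S_\epsilon(x_0)$. *)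

theory Defs
  imports "HOL-Analysis.Analysis" "HOL-Library.Poly_Mapping"
begin

section \<open>Polynomials and their zero sets\<close>

text \<open>A polynomial in variables indexed by \<open>'v\<close> is a finitely supported map from exponent
  vectors to coefficients.\<close>

type_synonym ('v, 'a) mpoly = "('v \<Rightarrow>\<^sub>0 nat) \<Rightarrow>\<^sub>0 'a"

definition mpoly_eval :: "('v, 'a::comm_semiring_1) mpoly \<Rightarrow> ('v \<Rightarrow> 'a) \<Rightarrow> 'a" where
  "mpoly_eval p x =
     (\<Sum>e\<in>Poly_Mapping.keys p. Poly_Mapping.lookup p e *
        (\<Prod>i\<in>Poly_Mapping.keys e. x i ^ Poly_Mapping.lookup e i))"

definition complexify :: "('v, real) mpoly \<Rightarrow> ('v, complex) mpoly" where
  "complexify = Poly_Mapping.map of_real"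

definition complex_zeros :: "(3, real) mpoly \<Rightarrow> (complex^3) set" where
  "complex_zeros f = {z. mpoly_eval (complexify f) (($) z) = 0}"

definition real_zeros :: "(3, real) mpoly \<Rightarrow> (real^3) set" where
  "real_zeros f = {x. mpoly_eval f (($) x) = 0}"

definition complex_point :: "real^3 \<Rightarrow> complex^3" where
  "complex_point x = (\<chi> i. of_real (x $ i))"

definition algebraic_set :: "(complex^3) set \<Rightarrow> bool" where
  "algebraic_set A \<longleftrightarrow> (\<exists>P. A = {z. \<forall>p\<in>P. mpoly_eval p (($) z) = 0})"

definition irreducible_algebraic_set :: "(complex^3) set \<Rightarrow> bool" where
  "irreducible_algebraic_set A \<longleftrightarrow> algebraic_set A \<and> A \<noteq> {} \<and>
     (\<forall>B C. algebraic_set B \<and> algebraic_set C \<and> A = B \<union> C \<longrightarrow> A = B \<or> A = C)"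

text \<open>The tangent space is cut out by the differentials of \<^emph>\<open>all\<close> polynomials vanishing on \<open>X\<close>,
  so it depends only on the reduced variety \<open>X\<close> and not on the chosen equation.\<close>

definition zariski_tangent_space :: "(complex^3) set \<Rightarrow> complex^3 \<Rightarrow> (complex^3) set" where
  "zariski_tangent_space X x =
     {v. \<forall>p. (\<forall>z\<in>X. mpoly_eval p (($) z) = 0) \<longrightarrow>
           (\<Sum>i\<in>UNIV. deriv (\<lambda>t. mpoly_eval p ((($) x)(i := t))) (x $ i) * v $ i) = 0}"

text \<open>Here \<open>X\<close> is assumed to be a surface, i.e. of pure dimension 2.\<close>

definition surface_singular_locus :: "(complex^3) set \<Rightarrow> (complex^3) set" where
  "surface_singular_locus X = {x\<in>X. vec.dim (zariski_tangent_space X x) \<noteq> 2}"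

section \<open>Weighted actions\<close>

definition weighted_action :: "nat^3 \<Rightarrow> complex \<Rightarrow> complex^3 \<Rightarrow> complex^3" where
  "weighted_action w t x = (\<chi> i. t ^ (w $ i) * x $ i)"

definition weighted_homogeneous :: "nat^3 \<Rightarrow> (3, real) mpoly \<Rightarrow> bool" where
  "weighted_homogeneous w f \<longleftrightarrow> f \<noteq> 0 \<and>
     (\<exists>d>0. \<forall>t x. t \<noteq> 0 \<longrightarrow>
        mpoly_eval (complexify f) (($) (weighted_action w t x)) =
        t ^ d * mpoly_eval (complexify f) (($) x))"

definition weighted_orbit :: "nat^3 \<Rightarrow> complex^3 \<Rightarrow> (complex^3) set" where
  "weighted_orbit w x = {weighted_action w t x |t. t \<noteq> 0}"

text \<open>For a set \<open>Y\<close> invariant under the action, the projection of \<open>Y\<close> onto its orbit space is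
  \<^term>\<open>weighted_orbit w\<close>; the orbit space carries the quotient topology.\<close>

definition orbit_space :: "nat^3 \<Rightarrow> (complex^3) set \<Rightarrow> (complex^3) set topology" where
  "orbit_space w Y = topology (\<lambda>U. U \<subseteq> weighted_orbit w ` Y \<and>
     openin (top_of_set Y) {x\<in>Y. weighted_orbit w x \<in> U})"

lemma openin_orbit_space:
  "openin (orbit_space w Y) U \<longleftrightarrow> U \<subseteq> weighted_orbit w ` Y \<and>
     openin (top_of_set Y) {x\<in>Y. weighted_orbit w x \<in> U}"
proof -
  have "istopology (\<lambda>U. U \<subseteq> weighted_orbit w ` Y \<and>
     openin (top_of_set Y) {x\<in>Y. weighted_orbit w x \<in> U})"
    unfolding istopology_def
  proof (intro conjI allI impI)
    fix S T
    assume S: "S \<subseteq> weighted_orbit w ` Y \<and> openin (top_of_set Y) {x\<in>Y. weighted_orbit w x \<in> S}"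
      and T: "T \<subseteq> weighted_orbit w ` Y \<and> openin (top_of_set Y) {x\<in>Y. weighted_orbit w x \<in> T}"
    have "{x\<in>Y. weighted_orbit w x \<in> S \<inter> T} =
        {x\<in>Y. weighted_orbit w x \<in> S} \<inter> {x\<in>Y. weighted_orbit w x \<in> T}" by blast
    then show "openin (top_of_set Y) {x\<in>Y. weighted_orbit w x \<in> S \<inter> T}"
      using S T by (simp add: openin_Int)
    show "S \<inter> T \<subseteq> weighted_orbit w ` Y" using S by blast
  next
    fix K
    assume K: "\<forall>S\<in>K. S \<subseteq> weighted_orbit w ` Y \<and>
      openin (top_of_set Y) {x\<in>Y. weighted_orbit w x \<in> S}"
    have "{x\<in>Y. weighted_orbit w x \<in> \<Union>K} = (\<Union>S\<in>K. {x\<in>Y. weighted_orbit w x \<in> S})" by blast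
    then show "openin (top_of_set Y) {x\<in>Y. weighted_orbit w x \<in> \<Union>K}"
      using K by (metis (no_types, lifting) openin_Union image_iff)
    show "\<Union>K \<subseteq> weighted_orbit w ` Y" using K by blast
  qed
  then show ?thesis by (simp add: orbit_space_def)
qed

lemma quotient_map_orbit_space:
  "quotient_map (top_of_set Y) (orbit_space w Y) (weighted_orbit w)"
proof -
  have "{x\<in>Y. weighted_orbit w x \<in> weighted_orbit w ` Y} = Y" by blast
  then have "openin (orbit_space w Y) (weighted_orbit w ` Y)"
    by (simp add: openin_orbit_space)
  moreover have "topspace (orbit_space w Y) \<subseteq> weighted_orbit w ` Y"
    using openin_orbit_space openin_topspace by blast
  ultimately have "topspace (orbit_space w Y) = weighted_orbit w ` Y"
    using openin_subset by blast
  then show ?thesis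
    by (simp add: quotient_map_def openin_orbit_space)
qed

section \<open>Inner metrics\<close>

text \<open>The length with respect to \<open>d\<close> of a curve parametrised by $[0,1]$: the supremum of
  \<open>\<Sum>i<n. d (\<gamma> (t i)) (\<gamma> (t (Suc i)))\<close> over partitions \<open>0 = t 0 \<le> \<dots> \<le> t n = 1\<close>.\<close>

definition curve_length :: "('a \<Rightarrow> 'a \<Rightarrow> real) \<Rightarrow> (real \<Rightarrow> 'a) \<Rightarrow> ennreal" where
  "curve_length d \<gamma> =
     (SUP (n, t) \<in> {(n, t). t 0 = 0 \<and> t n = 1 \<and> mono_on {..n} t}.
        ennreal (\<Sum>i<n. d (\<gamma> (t i)) (\<gamma> (t (Suc i)))))"

text \<open>The topology of \<open>'a\<close> is meant to induce on \<open>Z\<close> the topology given by \<open>d\<close>.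
  The value is \<open>\<infinity>\<close> when no rectifiable curve in \<open>Z\<close> joins \<open>x\<close> to \<open>y\<close>.\<close>

definition inner_dist ::
  "('a::topological_space \<Rightarrow> 'a \<Rightarrow> real) \<Rightarrow> 'a set \<Rightarrow> 'a \<Rightarrow> 'a \<Rightarrow> ennreal" where
  "inner_dist d Z x y =
     (INF \<gamma> \<in> {\<gamma>. path \<gamma> \<and> path_image \<gamma> \<subseteq> Z \<and> pathstart \<gamma> = x \<and> pathfinish \<gamma> = y \<and>
                 curve_length d \<gamma> < \<infinity>}. curve_length d \<gamma>)"

definition bi_lipschitz_on ::
  "'a set \<Rightarrow> ('a \<Rightarrow> 'a \<Rightarrow> ennreal) \<Rightarrow> ('b \<Rightarrow> 'b \<Rightarrow> ennreal) \<Rightarrow> ('a \<Rightarrow> 'b) \<Rightarrow> bool" where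
  "bi_lipschitz_on A d d' h \<longleftrightarrow>
     (\<exists>L>0. \<forall>x\<in>A. \<forall>y\<in>A. d' (h x) (h y) \<le> ennreal L * d x y \<and>
                         d x y \<le> ennreal L * d' (h x) (h y))"

section \<open>Nash manifolds in $R^m$\<close>

text \<open>Since \<open>m\<close> is quantified inside the notion of a metrically conic point, $R^m$ is taken to be
  the space \<^term>\<open>Euclidean_space m\<close> of sequences vanishing from index \<open>m\<close> on.  Its topology is
  the one induced from \<^typ>\<open>nat \<Rightarrow> real\<close>; the library's metric on
  \<^typ>\<open>nat \<Rightarrow> real\<close> induces it as well but is not the Euclidean one, hence the next definition.\<close>

abbreviation Rn :: "nat \<Rightarrow> (nat \<Rightarrow> real) set" where
  "Rn m \<equiv> topspace (Euclidean_space m)"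

definition euclid_dist :: "nat \<Rightarrow> (nat \<Rightarrow> real) \<Rightarrow> (nat \<Rightarrow> real) \<Rightarrow> real" where
  "euclid_dist m x y = L2_set (\<lambda>i. x i - y i) {..<m}"

lemma Metric_space_euclid_dist: "Metric_space (Rn m) (euclid_dist m)"
proof
  fix x y :: "nat \<Rightarrow> real"
  show "0 \<le> euclid_dist m x y"
    by (simp add: euclid_dist_def)
  show "euclid_dist m x y = euclid_dist m y x"
    by (simp add: euclid_dist_def L2_set_def power2_commute)
next
  fix x y :: "nat \<Rightarrow> real"
  assume x: "x \<in> Rn m" and y: "y \<in> Rn m"
  have "x i = y i" if "i \<ge> m" for i
    using that x y by (simp add: topspace_Euclidean_space)
  then have "x = y \<longleftrightarrow> (\<forall>i<m. x i = y i)"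
    by (metis ext not_le)
  then show "euclid_dist m x y = 0 \<longleftrightarrow> x = y"
    by (simp add: euclid_dist_def L2_set_eq_0_iff Ball_def)
next
  fix x y z :: "nat \<Rightarrow> real"
  show "euclid_dist m x z \<le> euclid_dist m x y + euclid_dist m y z"
    using L2_set_triangle_ineq[of "\<lambda>i. x i - y i" "\<lambda>i. y i - z i" "{..<m}"]
    by (simp add: euclid_dist_def)
qed

lemma Euclidean_space_eq_top_of_set: "Euclidean_space m = top_of_set (Rn m)"
  by (simp add: Euclidean_space_def euclidean_product_topology)

lemma mtopology_euclid_dist: "Metric_space.mtopology (Rn m) (euclid_dist m) = Euclidean_space m"
proof -
  interpret M: Metric_space "Rn m" "euclid_dist m"
    by (rule Metric_space_euclid_dist)
  have coord: "\<bar>x i - y i\<bar> \<le> euclid_dist m x y" if "x \<in> Rn m" "y \<in> Rn m" for x y i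
  proof (cases "i < m")
    case True
    have "\<bar>x i - y i\<bar> = L2_set (\<lambda>i. x i - y i) {i}" by simp
    also have "\<dots> \<le> euclid_dist m x y"
      unfolding euclid_dist_def L2_set_def
      using True by (intro real_sqrt_le_mono sum_mono2) auto
    finally show ?thesis .
  next
    case False
    then show ?thesis using that by (simp add: topspace_Euclidean_space)
  qed
  have "continuous_map M.mtopology euclideanreal (\<lambda>x. x i)" for i
    unfolding continuous_map_def
  proof (intro conjI allI impI)
    fix U :: "real set" assume U: "openin euclideanreal U"
    show "openin M.mtopology {x \<in> topspace M.mtopology. x i \<in> U}"
      unfolding M.openin_mtopology
    proof (intro conjI allI impI)
      fix x assume x: "x \<in> {x \<in> topspace M.mtopology. x i \<in> U}"
      then obtain r where r: "r > 0" "ball (x i) r \<subseteq> U"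
        using U by (auto simp: open_contains_ball)
      have "M.mball x r \<subseteq> {x \<in> topspace M.mtopology. x i \<in> U}"
      proof
        fix y assume "y \<in> M.mball x r"
        then have y: "x \<in> Rn m" "y \<in> Rn m" "euclid_dist m x y < r" by auto
        then have "y i \<in> ball (x i) r" using coord[of x y i] by (simp add: dist_real_def)
        then show "y \<in> {x \<in> topspace M.mtopology. x i \<in> U}" using r y by auto
      qed
      then show "\<exists>r>0. M.mball x r \<subseteq> {x \<in> topspace M.mtopology. x i \<in> U}"
        using r by blast
    qed auto
  qed auto
  moreover have "continuous_map T (Euclidean_space m) (\<lambda>x. x)"
    if "\<And>i. continuous_map T euclideanreal (\<lambda>x. x i)" "topspace T = Rn m" for T
    using that by (simp add: Euclidean_space_def continuous_map_in_subtopology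
        continuous_map_componentwise_UNIV)
  ultimately have id: "continuous_map M.mtopology (Euclidean_space m) (\<lambda>x. x)"
    by (simp only: M.topspace_mtopology)
  have "openin (Euclidean_space m) U" if U: "openin M.mtopology U" for U
  proof -
    have "open {y. euclid_dist m x y < r}" for x r
      unfolding euclid_dist_def L2_set_def
      by (intro open_Collect_less continuous_on_real_sqrt continuous_on_sum continuous_on_power
          continuous_on_diff continuous_on_const continuous_on_product_coordinates)
    moreover have "M.mball x r = Rn m \<inter> {y. euclid_dist m x y < r}" if "x \<in> Rn m" for x r
      using that by (auto simp: M.mball_def)
    ultimately have ball: "openin (Euclidean_space m) (M.mball x r)" if "x \<in> Rn m" for x r
      using that by (subst Euclidean_space_eq_top_of_set) (metis openin_open)
    show ?thesis
    proof (subst openin_subopen, intro ballI)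
      fix x assume "x \<in> U"
      moreover from this obtain r where "r > 0" "M.mball x r \<subseteq> U" "x \<in> Rn m"
        using U unfolding M.openin_mtopology by blast
      ultimately show "\<exists>T. openin (Euclidean_space m) T \<and> x \<in> T \<and> T \<subseteq> U"
        using ball[of x r] by (intro exI[of _ "M.mball x r"]) auto
    qed
  qed
  moreover have "openin M.mtopology U" if U: "openin (Euclidean_space m) U" for U
  proof -
    have "{x \<in> topspace M.mtopology. x \<in> U} = U"
      using openin_subset[OF U] by (simp only: M.topspace_mtopology) blast
    then show ?thesis using openin_continuous_map_preimage[OF id U] by simp
  qed
  ultimately show ?thesis unfolding topology_eq by blast
qed

definition unit_sphere :: "nat \<Rightarrow> (nat \<Rightarrow> real) set" where
  "unit_sphere m = {x\<in>Rn m. euclid_dist m x (\<lambda>i. 0) = 1}"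

text \<open>Polynomials in infinitely many variables are harmless here: on \<^term>\<open>Rn m\<close> the variables
  with index at least \<open>m\<close> are \<open>0\<close>.\<close>

inductive semialgebraic :: "nat \<Rightarrow> (nat \<Rightarrow> real) set \<Rightarrow> bool" for m where
  pos: "semialgebraic m {x\<in>Rn m. 0 < mpoly_eval p x}"
| compl: "semialgebraic m S \<Longrightarrow> semialgebraic m (Rn m - S)"
| union: "semialgebraic m S \<Longrightarrow> semialgebraic m T \<Longrightarrow> semialgebraic m (S \<union> T)"

text \<open>\<open>C_k m k U g\<close>: all partial derivatives of \<open>g\<close> up to order \<open>k\<close> exist and are continuous
  on the open subset \<open>U\<close> of $R^m$.\<close>

primrec C_k :: "nat \<Rightarrow> nat \<Rightarrow> (nat \<Rightarrow> real) set \<Rightarrow> ((nat \<Rightarrow> real) \<Rightarrow> real) \<Rightarrow> bool" where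
  "C_k m 0 U g \<longleftrightarrow> continuous_on U g"
| "C_k m (Suc k) U g \<longleftrightarrow> continuous_on U g \<and>
     (\<forall>i<m. \<exists>g'. (\<forall>x\<in>U. ((\<lambda>t. g (x(i := t))) has_real_derivative g' x) (at (x i))) \<and> C_k m k U g')"

definition smooth_map :: "nat \<Rightarrow> (nat \<Rightarrow> real) set \<Rightarrow> ((nat \<Rightarrow> real) \<Rightarrow> nat \<Rightarrow> real) \<Rightarrow> bool" where
  "smooth_map m U F \<longleftrightarrow> (\<forall>k. \<forall>j<m. C_k m k U (\<lambda>x. F x j))"

text \<open>Being a \<open>k\<close>-dimensional submanifold of $R^m$ is expressed by slice charts: locally a smooth
  diffeomorphism of open sets of $R^m$ straightens \<open>N\<close> to $R^k \subseteq R^m$.\<close>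

definition smooth_submanifold :: "nat \<Rightarrow> nat \<Rightarrow> (nat \<Rightarrow> real) set \<Rightarrow> bool" where
  "smooth_submanifold m k N \<longleftrightarrow> k \<le> m \<and> N \<subseteq> Rn m \<and>
     (\<forall>p\<in>N. \<exists>U V \<phi> \<psi>. openin (Euclidean_space m) U \<and> p \<in> U \<and> openin (Euclidean_space m) V \<and>
        homeomorphism U V \<phi> \<psi> \<and> smooth_map m U \<phi> \<and> smooth_map m V \<psi> \<and>
        \<phi> ` (N \<inter> U) = V \<inter> Rn k)"

definition nash_manifold :: "nat \<Rightarrow> (nat \<Rightarrow> real) set \<Rightarrow> bool" where
  "nash_manifold m N \<longleftrightarrow> (\<exists>k. smooth_submanifold m k N) \<and> semialgebraic m N"

section \<open>Metrically conic points\<close>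

definition cone_over :: "(nat \<Rightarrow> real) set \<Rightarrow> (nat \<Rightarrow> real) set" where
  "cone_over N = {(\<lambda>i. s * y i) |s y. 0 \<le> s \<and> s \<le> 1 \<and> y \<in> N}"

definition metrically_conic :: "(complex^3) set \<Rightarrow> complex^3 \<Rightarrow> bool" where
  "metrically_conic X x0 \<longleftrightarrow>
     (\<exists>\<epsilon>0>0. \<forall>\<epsilon>. 0 < \<epsilon> \<and> \<epsilon> < \<epsilon>0 \<longrightarrow>
        (\<exists>m N h h'. nash_manifold m N \<and> N \<subseteq> unit_sphere m \<and>
           homeomorphism (cone_over N) (X \<inter> cball x0 \<epsilon>) h h' \<and>
           bi_lipschitz_on (cone_over N)
             (inner_dist (euclid_dist m) (cone_over N)) (inner_dist dist (X \<inter> cball x0 \<epsilon>)) h))"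

end

(* The weighted action contracts the real slice K = {f = 0, x3 = c} towards the origin; since
   w3 < w1, w2, a rectifiable component K0 of K becomes at time t a set of inner diameter
   O(t^min(w1,w2)), which is small compared with its distance t^w3 |c| to the origin ("fast loops").
   In a cone over a compact submanifold such a small set contracts to a point inside a set of comparable
   inner diameter, so a metrically conic structure would contract t.K0 in X without leaving the region
   where x3 is close to t^w3 c.  Normalising x3 to c by the action retracts that region to the complex
   slice g = 0, hence K0 would be contractible in this smooth affine curve.  But the closed form
   g_2 dx - g_1 dy on the curve would then have a continuous real primitive on the compact set K0, and
   at a maximum of it the tangent vector (g_2, -g_1) pairs to g_1^2 + g_2^2 > 0, a contradiction. *)

theory Submission
  imports Defs
    "HOL-Computational_Algebra.Polynomial_Factorial"
    "HOL-Computational_Algebra.Fundamental_Theorem_Algebra"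
    "HOL-Computational_Algebra.Field_as_Ring"
    "HOL-Complex_Analysis.Cauchy_Integral_Theorem"
begin

section \<open>Real plane curves and their complex zeros\<close>

text \<open>The given \<open>f\<close> may be a proper power, or acquire repeated factors on the
  slice \<open>x3 = c\<close>. So \<open>g\<close> is a reduced real equation of that slice, and the
  absence of critical zeros has to be earned: \<open>X\<close> is regular near 0 away from 0, the
  action spreads this to the slice, and the Euler relation restricts it. The homotopy obtained
  through \<open>h\<close> is only continuous, so the form cannot be integrated directly along its
  tracks. Increments of local primitives are summed over a partition instead; all tracks start at
  one point, which makes the sum a function on \<open>K0\<close> that is locally a primitive. The
  map \<open>h\<close> need not send the apex of the cone to 0, so the distance of the preimages
  from the apex is bounded below in two cases. Compactness of \<open>K\<close> comes from the third
  hypothesis: real zeros with \<open>x3 = 0\<close> reduce to the origin. Real coefficients make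
  both partials of \<open>g\<close> real at real points, so the sum of their squares is positive
  there. Weights are integers, hence \<open>w3 < w1, w2\<close> leaves a whole spare factor
  \<open>t\<close>, which beats every Lipschitz constant.\<close>

definition eval1 :: "real poly \<Rightarrow> 'a::real_normed_field \<Rightarrow> 'a" where
  "eval1 p x = poly (map_poly of_real p) x"

text \<open>The outer variable is \<open>y\<close> and the coefficients are polynomials in
  \<open>x\<close>. Coefficients stay real while the point may lie in any real normed field, so the
  same polynomial serves the real curve and its complexification.\<close>

definition eval2 :: "real poly poly \<Rightarrow> 'a::real_normed_field \<Rightarrow> 'a \<Rightarrow> 'a" where
  "eval2 P x y = poly (map_poly (\<lambda>a. eval1 a x) P) y"

lemma eval1_0 [simp]: "eval1 0 x = 0"
  by (simp add: eval1_def)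

lemma eval1_pCons [simp]: "eval1 (pCons a p) x = of_real a + x * eval1 p x"
  by (simp add: eval1_def map_poly_pCons)

lemma eval1_add [simp]: "eval1 (p + q) x = eval1 p x + eval1 q x"
  by (induction p q rule: poly_induct2) (simp_all add: algebra_simps)

lemma eval1_smult [simp]: "eval1 (smult a p) x = of_real a * eval1 p x"
  by (induction p) (simp_all add: algebra_simps)

lemma eval1_mult [simp]: "eval1 (p * q) x = eval1 p x * eval1 q x"
  by (induction p) (simp_all add: algebra_simps)

lemma eval1_1 [simp]: "eval1 1 x = 1"
  by (simp add: one_pCons)

lemma eval1_monom [simp]: "eval1 (monom a i) x = of_real a * x ^ i"
  by (induction i) (simp_all add: monom_0 monom_Suc)

lemma eval1_of_real: "eval1 p (of_real x) = of_real (poly p x)"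
  by (induction p) simp_all

lemma eval2_0 [simp]: "eval2 0 x y = 0"
  by (simp add: eval2_def)

lemma eval2_pCons [simp]: "eval2 (pCons a P) x y = eval1 a x + y * eval2 P x y"
  by (simp add: eval2_def map_poly_pCons)

lemma eval2_add [simp]: "eval2 (P + Q) x y = eval2 P x y + eval2 Q x y"
  by (induction P Q rule: poly_induct2) (simp_all add: algebra_simps)

lemma eval2_smult [simp]: "eval2 (smult a P) x y = eval1 a x * eval2 P x y"
  by (induction P) (simp_all add: algebra_simps)

lemma eval2_mult [simp]: "eval2 (P * Q) x y = eval2 P x y * eval2 Q x y"
  by (induction P) (simp_all add: algebra_simps)

lemma eval2_1 [simp]: "eval2 1 x y = 1"
  by (simp add: one_pCons)

lemma eval2_monom: "eval2 (monom (monom a i) j) x y = of_real a * x ^ i * y ^ j"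
  by (induction j) (simp_all add: monom_0 monom_Suc)

lemma eval2_sum: "eval2 (\<Sum>i\<in>A. P i) x y = (\<Sum>i\<in>A. eval2 (P i) x y)"
  by (induction A rule: infinite_finite_induct) simp_all

lemma eval2_of_real: "eval2 P (of_real x) (of_real y) = of_real (eval2 P x y)"
proof (induction P)
  case (pCons a P)
  then show ?case by (simp add: eval1_of_real[where 'a='a] eval1_of_real[where 'a=real, simplified])
qed simp

lemma eval1_has_field_derivative: "(eval1 p has_field_derivative eval1 (pderiv p) x) (at x)"
proof (induction p)
  case (pCons a p)
  then show ?case
    by (auto intro!: derivative_eq_intros simp: pderiv_pCons algebra_simps)
qed simp

text \<open>The partials are polynomials again, so the statement can be applied a second time to
  differentiate them.\<close>

lemma eval2_partial_derivatives:
  "\<exists>P1 P2. \<forall>z::'a::real_normed_field \<times> 'a.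
     ((\<lambda>z. eval2 P (fst z) (snd z)) has_derivative
       (\<lambda>v. eval2 P1 (fst z) (snd z) * fst v + eval2 P2 (fst z) (snd z) * snd v)) (at z)"
proof (induction P)
  case 0
  show ?case by (intro exI[of _ 0]) simp
next
  case (pCons a P)
  then obtain P1 P2 where P: "\<And>z::'a \<times> 'a.
     ((\<lambda>z. eval2 P (fst z) (snd z)) has_derivative
       (\<lambda>v. eval2 P1 (fst z) (snd z) * fst v + eval2 P2 (fst z) (snd z) * snd v)) (at z)"
    by blast
  have a: "((\<lambda>z. eval1 a (fst z)) has_derivative (\<lambda>v. eval1 (pderiv a) (fst z) * fst v)) (at z)"
    for z :: "'a \<times> 'a"
    using has_derivative_compose[OF has_derivative_fst[OF has_derivative_ident[where F="at z"]]
        eval1_has_field_derivative[where x="fst z", unfolded has_field_derivative_def], of a] .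
  show ?case
    \<comment> \<open>The two partials of \<open>a(x) + y P(x, y)\<close>; the product rule in
      \<open>y\<close> gives \<open>P + y P2\<close>.\<close>
    apply (rule exI[of _ "pCons (pderiv a) P1"], rule exI[of _ "P + pCons 0 P2"])
    apply (auto intro!: derivative_eq_intros a P simp: algebra_simps)
    done
qed

section \<open>Elimination and reduced equations of plane curves\<close>

lemma eval2_complex_root_exists:
  fixes x :: complex
  assumes "degree P > 0" and "eval1 (lead_coeff P) x \<noteq> 0"
  shows "\<exists>y. eval2 P x y = 0"
proof -
  have "degree (map_poly (\<lambda>a. eval1 a x) P) = degree P"
    by (intro map_poly_degree_eq) (use assms in auto)
  then have "\<not> constant (poly (map_poly (\<lambda>a. eval1 a x) P))"
    using assms by (simp add: constant_degree)
  then show ?thesis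
    unfolding eval2_def using fundamental_theorem_of_algebra by blast
qed

text \<open>Bezout over the field of rational functions in \<open>x\<close>, with denominators
  cleared. A nonzero combination \<open>D\<close> of least \<open>y\<close>-degree divides
  \<open>P\<close> and \<open>Q\<close> up to factors depending on \<open>x\<close> alone. If
  \<open>D\<close> involved \<open>y\<close>, primality of \<open>P\<close> would force
  \<open>P dvd Q\<close> or make \<open>D\<close> divide a nonzero polynomial in
  \<open>x\<close>.\<close>

lemma prime_elem_poly_bezout:
  fixes P Q :: "real poly poly"
  assumes P: "prime_elem P" "degree P > 0" and "\<not> P dvd Q"
  shows "\<exists>A B r. r \<noteq> 0 \<and> A * P + B * Q = [:r:]"
proof -
  define J where "J = {D. D \<noteq> 0 \<and> (\<exists>A B. D = A * P + B * Q)}"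
  have "P \<noteq> 0" using P by auto
  have "P = 1 * P + 0 * Q" by simp
  then have "P \<in> J" unfolding J_def using \<open>P \<noteq> 0\<close> by blast
  define D where "D = arg_min degree (\<lambda>D. D \<in> J)"
  have D: "D \<in> J" and min: "\<And>E. E \<in> J \<Longrightarrow> degree D \<le> degree E"
    using arg_min_nat_lemma[of "\<lambda>D. D \<in> J" P degree] \<open>P \<in> J\<close> unfolding D_def by auto
  then obtain A B where AB: "D = A * P + B * Q" and "D \<noteq> 0" unfolding J_def by auto
  \<comment> \<open>Coefficients are polynomials in \<open>x\<close>, so pseudo-division replaces
    division; the remainder is again a combination of \<open>P\<close> and \<open>Q\<close> and
    vanishes by minimality.\<close>
  have reduce: "\<exists>a S. a \<noteq> 0 \<and> smult a R = D * S" if "\<exists>A B. R = A * P + B * Q" for R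
  proof -
    from that obtain A' B' where R: "R = A' * P + B' * Q" by blast
    obtain a S where aS: "a \<noteq> 0" "smult a R = D * S + pseudo_mod R D"
      and deg: "pseudo_mod R D = 0 \<or> degree (pseudo_mod R D) < degree D"
      using pseudo_mod[OF \<open>D \<noteq> 0\<close>] by metis
    have "pseudo_mod R D = (smult a A' - S * A) * P + (smult a B' - S * B) * Q"
      using aS(2) R AB by (simp add: algebra_simps smult_add_right)
    then have "pseudo_mod R D = 0"
      using min[of "pseudo_mod R D"] deg unfolding J_def by fastforce
    then show ?thesis using aS by auto
  qed
  have "degree D = 0"
  proof (rule ccontr)
    assume degD: "degree D \<noteq> 0"
    obtain a S where a: "a \<noteq> 0" "smult a P = D * S"
      using reduce[of P] by (metis add.right_neutral mult_1 mult_zero_left)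
    obtain b T where b: "b \<noteq> 0" "smult b Q = D * T"
      using reduce[of Q] by (metis add.left_neutral mult_1 mult_zero_left)
    have const: "\<not> P dvd [:e:]" if "e \<noteq> 0" for e
      using that P(2) by (metis dvd_imp_degree_le degree_pCons_0 not_less pCons_eq_0_iff)
    have "P dvd D * S" using a(2) by (metis dvd_smult dvd_refl)
    then consider "P dvd D" | "P dvd S" using P(1) by (auto simp: prime_elem_dvd_mult_iff)
    then show False
    proof cases
      case 1
      then have "P dvd [:b:] * Q" using b(2) by simp
      then show False using P(1) const[OF b(1)] assms(3) by (auto simp only: prime_elem_dvd_mult_iff)
    next
      case 2
      then obtain U where "S = P * U" by auto
      then have "P * [:a:] = P * (D * U)" using a(2) by (simp add: algebra_simps)
      then have "[:a:] = D * U" using \<open>P \<noteq> 0\<close> mult_cancel_left by blast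
      then show False using degD a(1)
        by (metis degree_mult_eq degree_pCons_0 add_is_0 mult_eq_0_iff pCons_eq_0_iff)
    qed
  qed
  then obtain r where "D = [:r:]" by (rule degree_eq_zeroE)
  then show ?thesis using AB \<open>D \<noteq> 0\<close> by auto
qed

lemma real_poly_eq_0_if_eval1_eq_0:
  assumes "\<And>x::complex. eval1 p x = 0"
  shows "p = 0"
proof -
  have "poly p x = 0" for x using assms[of "of_real x"] by (simp add: eval1_of_real)
  then show ?thesis using poly_all_0_iff_0 by blast
qed

text \<open>A Nullstellensatz for one real prime and its complex zeros. If \<open>P\<close> involves
  \<open>y\<close> and does not divide \<open>Q\<close>, elimination yields a nonzero
  \<open>r(x)\<close> in the ideal of \<open>P\<close> and \<open>Q\<close>; it vanishes wherever
  \<open>P\<close> has a root above \<open>x\<close>, hence off the zeros of the leading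
  coefficient, which is absurd.\<close>

lemma prime_elem_dvd_if_zeros_subset:
  fixes P Q :: "real poly poly"
  assumes P: "prime_elem P"
    and zeros: "\<And>x y::complex. eval2 P x y = 0 \<Longrightarrow> eval2 Q x y = 0"
  shows "P dvd Q"
proof (cases "degree P = 0")
  case False
  show ?thesis
  proof (rule ccontr)
    assume "\<not> P dvd Q"
    then obtain A B r where r: "r \<noteq> 0" "A * P + B * Q = [:r:]"
      using prime_elem_poly_bezout[OF P] False by blast
    have "eval1 (r * lead_coeff P) x = 0" for x :: complex
    proof (cases "eval1 (lead_coeff P) x = 0")
      case False
      then obtain y where y: "eval2 P x y = 0"
        using eval2_complex_root_exists \<open>degree P \<noteq> 0\<close> by blast
      then have "eval2 (A * P + B * Q) x y = 0" using zeros by simp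
      then show ?thesis using r(2) by simp
    qed simp
    then have "r * lead_coeff P = 0" by (rule real_poly_eq_0_if_eval1_eq_0)
    then show False using r(1) P by auto
  qed
next
  \<comment> \<open>Here \<open>P = p(x)\<close>, and the curve contains the whole line above a
    complex root of \<open>p\<close>. Every coefficient of \<open>Q\<close> therefore vanishes at
    that root and cannot be coprime to \<open>p\<close>.\<close>
  case True
  then obtain p where p: "P = [:p:]" by (rule degree_eq_zeroE)
  have pp: "prime_elem p" using P unfolding p by (simp add: prime_elem_const_poly_iff)
  have "degree p > 0"
    using pp by (metis is_unit_iff_degree prime_elem_def not_gr_zero)
  then have "\<not> constant (poly (map_poly of_real p :: complex poly))"
    by (simp add: constant_degree degree_map_poly)
  then obtain x :: complex where x: "eval1 p x = 0"
    unfolding eval1_def using fundamental_theorem_of_algebra by blast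
  have "poly (map_poly (\<lambda>a. eval1 a x) Q) y = 0" for y
    using zeros[of x y] x unfolding p by (simp add: eval2_def[symmetric])
  then have "map_poly (\<lambda>a. eval1 a x) Q = 0" using poly_all_0_iff_0 by blast
  then have coeff: "eval1 (coeff Q n) x = 0" for n
    by (metis coeff_0 coeff_map_poly eval1_0)
  have "p dvd coeff Q n" for n
  proof (rule ccontr)
    assume "\<not> p dvd coeff Q n"
    then have "coprime p (coeff Q n)"
      using pp by (simp add: prime_elem_imp_coprime)
    then obtain a b where "a * p + b * coeff Q n = 1"
      using bezout_coefficients_fst_snd[of p "coeff Q n"] by (auto simp: coprime_iff_gcd_eq_1)
    then have "eval1 (a * p + b * coeff Q n) x = 1" by simp
    then show False using x coeff by simp
  qed
  then show ?thesis unfolding p by (simp add: const_poly_dvd_iff)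
qed

text \<open>\<open>G\<close> is the radical of \<open>F\<close>, the product of its distinct prime
  factors. The divisibility clause is what later carries regularity from an arbitrary equation of
  the curve over to \<open>G\<close>.\<close>

lemma exists_reduced_poly:
  fixes F :: "real poly poly"
  assumes "F \<noteq> 0"
  shows "\<exists>G. (\<forall>x y::complex. eval2 G x y = 0 \<longleftrightarrow> eval2 F x y = 0) \<and>
     (\<forall>Q. (\<forall>x y::complex. eval2 F x y = 0 \<longrightarrow> eval2 Q x y = 0) \<longrightarrow> G dvd Q)"
proof -
  define G where "G = \<Prod>(prime_factors F)"
  have dvd: "P dvd F" if "P \<in> prime_factors F" for P using that by auto
  have prime: "prime P" if "P \<in> prime_factors F" for P using that by auto
  have eval_prod: "eval2 (\<Prod>A) x y = (\<Prod>P\<in>A. eval2 P x y)" if "finite A" for A and x y :: complex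
    using that by (induction A rule: finite_induct) simp_all
  have eval_mset: "eval2 (prod_mset M) x y = (\<Prod>P\<in>#M. eval2 P x y)" for M and x y :: complex
    by (induction M) simp_all
  \<comment> \<open>Units have no zeros, so normalization does not affect the zero set.\<close>
  have unit: "eval2 U x y \<noteq> 0" if "is_unit U" for U and x y :: complex
    using that by (metis dvdE eval2_1 eval2_mult mult_zero_left zero_neq_one)
  have norm: "eval2 R x y = 0 \<longleftrightarrow> eval2 (normalize R) x y = 0" if "R \<noteq> 0" for R and x y :: complex
  proof -
    have "eval2 R x y = eval2 (unit_factor R) x y * eval2 (normalize R) x y"
      by (metis eval2_mult unit_factor_mult_normalize)
    then show ?thesis using unit[of "unit_factor R"] that by auto
  qed
  have zG: "eval2 G x y = 0 \<longleftrightarrow> (\<exists>P\<in>prime_factors F. eval2 P x y = 0)" for x y :: complex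
    unfolding G_def by (simp add: eval_prod)
  have zF: "eval2 F x y = 0 \<longleftrightarrow> (\<exists>P\<in>prime_factors F. eval2 P x y = 0)" for x y :: complex
  proof -
    have "eval2 F x y = 0 \<longleftrightarrow> eval2 (\<Prod>\<^sub># (prime_factorization F)) x y = 0"
      using norm[of F] norm[of "\<Prod>\<^sub># (prime_factorization F)"] assms
      by (simp add: prod_mset_prime_factorization_weak)
    then show ?thesis by (simp add: eval_mset image_iff)
  qed
  have "G dvd Q" if Q: "\<forall>x y::complex. eval2 F x y = 0 \<longrightarrow> eval2 Q x y = 0" for Q
  proof -
    have "\<Prod>A dvd Q" if "finite A" "A \<subseteq> prime_factors F" for A
      using that
    proof (induction A rule: finite_induct)
      case (insert P A)
      have "P dvd Q"
        using prime_elem_dvd_if_zeros_subset[of P Q] Q prime insert.prems zF by blast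
      moreover have "coprime P (\<Prod>A)"
      proof (rule prod_coprime_right)
        fix P' assume "P' \<in> A"
        then have "prime P'" "P' \<noteq> P" using insert prime by auto
        then show "coprime P P'" using insert.prems prime[of P] primes_coprime by blast
      qed
      ultimately show ?case using insert by (simp add: divides_mult)
    qed simp
    then show ?thesis unfolding G_def by simp
  qed
  then show ?thesis using zG zF by (intro exI[of _ G]) simp
qed

section \<open>Complex plane curves and local primitives\<close>

text \<open>Kept general in the field: over the complex numbers it provides holomorphic functions,
  over the reals it describes the restriction to real points.\<close>

definition has_partials :: "('a::real_normed_field \<times> 'a \<Rightarrow> 'a) \<Rightarrow> ('a \<times> 'a \<Rightarrow> 'a) \<Rightarrow> ('a \<times> 'a \<Rightarrow> 'a) \<Rightarrow> bool"
  where "has_partials g a b \<longleftrightarrow>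
    (\<forall>z. (g has_derivative (\<lambda>v. a z * fst v + b z * snd v)) (at z))"

lemma has_partialsD:
  "has_partials g a b \<Longrightarrow> (g has_derivative (\<lambda>v. a z * fst v + b z * snd v)) (at z within S)"
  unfolding has_partials_def using has_derivative_at_withinI by blast

lemma has_partials_imp_continuous_on: "has_partials g a b \<Longrightarrow> continuous_on S g"
  by (rule has_derivative_continuous_on) (erule has_partialsD)

lemma has_partials_swap:
  assumes "has_partials g a b"
  shows "has_partials (g \<circ> prod.swap) (b \<circ> prod.swap) (a \<circ> prod.swap)"
  unfolding has_partials_def
proof
  fix z :: "'a \<times> 'a"
  have "((\<lambda>z::'a \<times> 'a. (snd z, fst z)) has_derivative (\<lambda>v. (snd v, fst v))) (at z)"
    by (auto intro!: derivative_eq_intros)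
  from has_derivative_compose[OF this has_partialsD[OF assms]]
  show "(g \<circ> prod.swap has_derivative
      (\<lambda>v. (b \<circ> prod.swap) z * fst v + (a \<circ> prod.swap) z * snd v)) (at z)"
    by (simp add: o_def prod.swap_def add.commute)
qed

lemma swap_has_derivative:
  "((prod.swap :: 'a::real_normed_vector \<times> 'b::real_normed_vector \<Rightarrow> _) has_derivative prod.swap) (at x within S)"
proof -
  have "(prod.swap :: 'a \<times> 'b \<Rightarrow> _) = (\<lambda>p. (snd p, fst p))" by (simp add: fun_eq_iff prod.swap_def)
  moreover have "((\<lambda>p::'a \<times> 'b. (snd p, fst p)) has_derivative (\<lambda>p. (snd p, fst p))) (at x within S)"
    by (intro has_derivative_Pair has_derivative_snd has_derivative_fst has_derivative_ident)
  ultimately show ?thesis by metis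
qed

lemma continuous_on_prod_swap: "continuous_on A (prod.swap :: 'a::real_normed_vector \<times> 'b::real_normed_vector \<Rightarrow> _)"
  by (rule has_derivative_continuous_on) (rule swap_has_derivative)

text \<open>The inverse function theorem applied to \<open>(x, y) -> (x, g (x, y))\<close>: near
  \<open>z0\<close> the zeros of \<open>g\<close> are the preimages of the points
  \<open>(x, 0)\<close>. The last clause says that the graph exhausts the zeros near
  \<open>z0\<close>.\<close>

lemma implicit_function:
  fixes g a b :: "'a::{real_normed_field,euclidean_space} \<times> 'a \<Rightarrow> 'a"
  assumes part: "has_partials g a b"
    and cont: "continuous_on UNIV a" "continuous_on UNIV b"
    and z0: "g z0 = 0" "b z0 \<noteq> 0"
  obtains e r \<phi> where "e > 0" "r > 0" "\<phi> (fst z0) = snd z0"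
    "\<And>x. x \<in> ball (fst z0) e \<Longrightarrow> g (x, \<phi> x) = 0 \<and> b (x, \<phi> x) \<noteq> 0 \<and>
       (\<phi> has_field_derivative - a (x, \<phi> x) / b (x, \<phi> x)) (at x)"
    "\<And>z. z \<in> ball z0 r \<Longrightarrow> g z = 0 \<Longrightarrow> fst z \<in> ball (fst z0) e \<and> snd z = \<phi> (fst z)"
proof -
  define U where "U = {z. b z \<noteq> 0}"
  define f where "f = (\<lambda>z. (fst z, g z))"
  define f' where "f' = (\<lambda>z. Blinfun (\<lambda>v. (fst v, a z * fst v + b z * snd v)))"
  have der: "(f has_derivative (\<lambda>v. (fst v, a z * fst v + b z * snd v))) (at z)" for z
    unfolding f_def by (intro has_derivative_Pair has_derivative_fst has_derivative_ident has_partialsD[OF part])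
  have app: "blinfun_apply (f' z) = (\<lambda>v. (fst v, a z * fst v + b z * snd v))" for z
    unfolding f'_def by (rule bounded_linear_Blinfun_apply[OF has_derivative_bounded_linear[OF der]])
  \<comment> \<open>Inverse of the triangular derivative at \<open>z0\<close>: the equation
    \<open>a v1 + b v2 = u\<close> is solved for \<open>v2\<close>.\<close>
  define invf where "invf = Blinfun (\<lambda>v. (fst v, (snd v - a z0 * fst v) / b z0))"
  have invf: "blinfun_apply invf = (\<lambda>v. (fst v, (snd v - a z0 * fst v) / b z0))"
    unfolding invf_def
    by (rule bounded_linear_Blinfun_apply)
      (intro bounded_linear_Pair bounded_linear_fst bounded_linear_divide[THEN bounded_linear_compose]
        bounded_linear_sub bounded_linear_snd bounded_linear_const_mult)
  have "open U" unfolding U_def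
    using cont(2) by (intro open_Collect_neq continuous_on_const)
  moreover have "(f has_derivative blinfun_apply (f' z)) (at z)" for z
    unfolding app by (rule der)
  moreover have "continuous_on U f'"
    by (rule continuous_on_blinfun_componentwise)
      (auto simp: app intro!: continuous_intros continuous_on_subset[OF cont(1)] continuous_on_subset[OF cont(2)])
  moreover have "z0 \<in> U" using z0 by (simp add: U_def)
  moreover have "invf o\<^sub>L f' z0 = id_blinfun"
    by (rule blinfun_eqI) (use z0 in \<open>simp add: app invf\<close>)
  ultimately obtain U' V h h' where U': "open U'" "U' \<subseteq> U" "z0 \<in> U'" and V: "open V" "f z0 \<in> V"
    and hom: "homeomorphism U' V f h"
    and dh: "\<And>y. y \<in> V \<Longrightarrow> (h has_derivative (h' y)) (at y)"
    and h': "\<And>y. y \<in> V \<Longrightarrow> h' y = inv (blinfun_apply (f' (h y)))"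
      "\<And>y. y \<in> V \<Longrightarrow> bij (blinfun_apply (f' (h y)))"
    using inverse_function_theorem[of U f f' z0 invf] by metis
  define \<phi> where "\<phi> = (\<lambda>x. snd (h (x, 0)))"
  have "open {x. (x, 0::'a) \<in> V}"
    using open_vimage[OF V(1), of "\<lambda>x. (x, 0)"] by (simp add: vimage_def continuous_on_Pair)
  moreover have "fst z0 \<in> {x. (x, 0::'a) \<in> V}" using V(2) z0 by (simp add: f_def)
  ultimately obtain e where e: "e > 0" "ball (fst z0) e \<subseteq> {x. (x, 0::'a) \<in> V}"
    using open_contains_ball by blast
  obtain r0 where r0: "r0 > 0" "ball z0 r0 \<subseteq> U'" using U' open_contains_ball by blast
  have h: "h (x, 0) = (x, \<phi> x)" "g (x, \<phi> x) = 0" "b (x, \<phi> x) \<noteq> 0" if "(x, 0) \<in> V" for x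
  proof -
    have "f (h (x, 0)) = (x, 0)" "h (x, 0) \<in> U'"
      using hom that unfolding homeomorphism_def by blast+
    note * = this
    show eq: "h (x, 0) = (x, \<phi> x)" using *(1) unfolding f_def \<phi>_def by (simp add: prod_eq_iff)
    show "g (x, \<phi> x) = 0" "b (x, \<phi> x) \<noteq> 0"
      using * U'(2) unfolding eq by (auto simp: f_def U_def)
  qed
  have d\<phi>: "(\<phi> has_field_derivative - a (x, \<phi> x) / b (x, \<phi> x)) (at x)" if "(x, 0) \<in> V" for x
  proof -
    let ?z = "(x, \<phi> x)"
    have "h' (x, 0) (v, 0) = (v, - a ?z / b ?z * v)" for v
    proof -
      \<comment> \<open>The derivative of the inverse is read off from the vector that the
        derivative of \<open>f\<close> sends to \<open>(v, 0)\<close>, the tangent of the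
        graph.\<close>
      have "blinfun_apply (f' ?z) (v, - a ?z / b ?z * v) = (v, 0)"
        using h[OF that] by (simp add: app)
      then show ?thesis using h'[OF that] h[OF that] by (metis bij_inv_eq_iff)
    qed
    moreover have "(\<phi> has_derivative (\<lambda>v. snd (h' (x, 0) (v, 0)))) (at x)"
      unfolding \<phi>_def
      by (intro has_derivative_snd has_derivative_compose[where g=h and f="\<lambda>x. (x, 0)"] dh that
          has_derivative_Pair has_derivative_ident has_derivative_const)
    ultimately have "(\<phi> has_derivative (\<lambda>v. - a ?z / b ?z * v)) (at x)" by simp
    then show ?thesis unfolding has_field_derivative_def .
  qed
  have uniq: "fst z \<in> ball (fst z0) e \<and> snd z = \<phi> (fst z)" if "z \<in> ball z0 (min e r0)" "g z = 0" for z
  proof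
    have "dist (fst z0) (fst z) \<le> dist z0 z" by (rule dist_fst_le)
    then show fz: "fst z \<in> ball (fst z0) e" using that by simp
    have "h (f z) = z" using hom that r0 unfolding homeomorphism_def by auto
    then show "snd z = \<phi> (fst z)" using that by (simp add: f_def \<phi>_def)
  qed
  show ?thesis
  proof (rule that[of e "min e r0" \<phi>])
    show "0 < e" "0 < min e r0" using e r0 by auto
    show "\<phi> (fst z0) = snd z0" using uniq[of z0] e r0 z0 by simp
    show "g (x, \<phi> x) = 0 \<and> b (x, \<phi> x) \<noteq> 0 \<and>
        (\<phi> has_field_derivative - a (x, \<phi> x) / b (x, \<phi> x)) (at x)" if "x \<in> ball (fst z0) e" for x
      using h[of x] d\<phi>[of x] that e(2) by blast
    show "fst z \<in> ball (fst z0) e \<and> snd z = \<phi> (fst z)" if "z \<in> ball z0 (min e r0)" "g z = 0" for z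
      using uniq[OF that] .
  qed
qed

text \<open>The curve \<open>g = 0\<close> carries the closed one-form \<open>b dx - a dy\<close>, which on real points
  pairs to \<open>a\<^sup>2 + b\<^sup>2\<close> with the tangent vector \<open>(b, -a)\<close>.\<close>

definition has_curve_form ::
  "(complex \<times> complex \<Rightarrow> complex) \<Rightarrow> (complex \<times> complex \<Rightarrow> complex) \<Rightarrow> (complex \<times> complex \<Rightarrow> complex) \<Rightarrow>
   (complex \<times> complex \<Rightarrow> complex) \<Rightarrow> (complex \<times> complex) set \<Rightarrow> bool" where
  "has_curve_form g a b \<Phi> W \<longleftrightarrow> open W \<and>
     (\<forall>y\<in>W. g y = 0 \<longrightarrow> (\<Phi> has_derivative (\<lambda>v. b y * fst v - a y * snd v)) (at y within {z. g z = 0}))"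

text \<open>On the curve \<open>a dx + b dy = 0\<close>, so in the coordinate \<open>x\<close> the
  form \<open>b dx - a dy\<close> becomes \<open>(b + a^2 / b) dx\<close>. Its coefficient
  \<open>k\<close> is holomorphic on a disc and has a primitive there.\<close>

lemma exists_curve_form_aux:
  assumes g: "has_partials g a b" and a: "has_partials a a1 a2" and b: "has_partials b b1 b2"
    and z0: "g z0 = 0" "b z0 \<noteq> 0"
  shows "\<exists>W \<Phi>. z0 \<in> W \<and> has_curve_form g a b \<Phi> W"
proof -
  obtain e r \<phi> where er: "e > 0" "r > 0"
    and \<phi>: "\<And>x. x \<in> ball (fst z0) e \<Longrightarrow> g (x, \<phi> x) = 0 \<and> b (x, \<phi> x) \<noteq> 0 \<and>
       (\<phi> has_field_derivative - a (x, \<phi> x) / b (x, \<phi> x)) (at x)"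
    and uniq: "\<And>z. z \<in> ball z0 r \<Longrightarrow> g z = 0 \<Longrightarrow> fst z \<in> ball (fst z0) e \<and> snd z = \<phi> (fst z)"
    using implicit_function[OF g has_partials_imp_continuous_on[OF a] has_partials_imp_continuous_on[OF b] z0]
    by metis
  have bnz: "b (x, \<phi> x) \<noteq> 0" if "x \<in> ball (fst z0) e" for x
    using \<phi>[OF that] by blast
  define k where "k = (\<lambda>x. b (x, \<phi> x) + a (x, \<phi> x) ^ 2 / b (x, \<phi> x))"
  have comp: "(\<lambda>x. p (x, \<phi> x)) field_differentiable at x"
    if p: "has_partials p p1 p2" and x: "x \<in> ball (fst z0) e" for p p1 p2 x
  proof -
    obtain d where d: "(\<phi> has_derivative (\<lambda>v. d * v)) (at x)"
      using \<phi>[OF x] unfolding has_field_derivative_def by blast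
    have "((\<lambda>x. (x, \<phi> x)) has_derivative (\<lambda>v. (v, d * v))) (at x)"
      by (intro has_derivative_Pair has_derivative_ident d)
    from has_derivative_compose[OF this has_partialsD[OF p]]
    have "((\<lambda>x. p (x, \<phi> x)) has_derivative (\<lambda>v. (p1 (x, \<phi> x) + p2 (x, \<phi> x) * d) * v)) (at x)"
      by (simp add: algebra_simps)
    then have "((\<lambda>x. p (x, \<phi> x)) has_field_derivative p1 (x, \<phi> x) + p2 (x, \<phi> x) * d) (at x)"
      unfolding has_field_derivative_def .
    then show ?thesis unfolding field_differentiable_def ..
  qed
  have "k field_differentiable at x" if "x \<in> ball (fst z0) e" for x
  proof -
    note da = comp[OF a that] and db = comp[OF b that]
    show ?thesis
      unfolding k_def
      by (rule field_differentiable_add[OF db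
            field_differentiable_divide[OF field_differentiable_power[OF da] db bnz[OF that]]])
  qed
  then have "k holomorphic_on ball (fst z0) e"
    unfolding holomorphic_on_def using field_differentiable_at_within by blast
  from holomorphic_convex_primitive'[OF convex_ball open_ball this]
  obtain \<Psi> where \<Psi>': "\<And>x. x \<in> ball (fst z0) e \<Longrightarrow>
      (\<Psi> has_field_derivative k x) (at x within ball (fst z0) e)"
    by metis
  have \<Psi>: "(\<Psi> has_derivative (\<lambda>v. k x * v)) (at x)" if "x \<in> ball (fst z0) e" for x
    using \<Psi>'[OF that] unfolding at_within_open[OF that open_ball] has_field_derivative_def .
  have "(\<Psi> \<circ> fst has_derivative (\<lambda>v. b y * fst v - a y * snd v)) (at y within {z. g z = 0})"
    if y: "y \<in> ball z0 r" "g y = 0" for y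
  proof -
    have fy: "fst y \<in> ball (fst z0) e" "y = (fst y, \<phi> (fst y))" using uniq[OF y] by (auto simp: prod_eq_iff)
    then have by0: "b y \<noteq> 0" and ky: "k (fst y) = b y + a y ^ 2 / b y"
      using bnz[of "fst y"] unfolding k_def by auto
    have "(\<Psi> \<circ> fst has_derivative (\<lambda>v. k (fst y) * fst v)) (at y within {z. g z = 0})"
      unfolding o_def
      by (rule has_derivative_compose[where f=fst, OF has_derivative_fst[OF has_derivative_ident] \<Psi>[OF fy(1)]])
    \<comment> \<open>A multiple of \<open>g\<close> is zero on the curve, so subtracting it leaves
      the function there unchanged, while the derivative changes by a multiple of \<open>dg\<close>.
      The factor \<open>a y / b y\<close> turns \<open>k dx\<close> into
      \<open>b dx - a dy\<close>.\<close>
    moreover have "((\<lambda>z. a y / b y * g z) has_derivative (\<lambda>v. a y / b y * (a y * fst v + b y * snd v)))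
        (at y within {z. g z = 0})"
      by (intro has_derivative_mult_right has_partialsD g)
    ultimately have "((\<lambda>z. (\<Psi> \<circ> fst) z - a y / b y * g z) has_derivative
       (\<lambda>v. k (fst y) * fst v - a y / b y * (a y * fst v + b y * snd v))) (at y within {z. g z = 0})"
      by (rule has_derivative_diff)
    then have "(\<Psi> \<circ> fst has_derivative
       (\<lambda>v. k (fst y) * fst v - a y / b y * (a y * fst v + b y * snd v))) (at y within {z. g z = 0})"
      by (rule has_derivative_transform[rotated 2]) (use y in auto)
    moreover have "k (fst y) * fst v - a y / b y * (a y * fst v + b y * snd v) = b y * fst v - a y * snd v" for v
      using by0 unfolding ky by (simp add: algebra_simps power2_eq_square)
    ultimately show ?thesis by simp
  qed
  then have "has_curve_form g a b (\<Psi> \<circ> fst) (ball z0 r)"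
    unfolding has_curve_form_def by simp
  then show ?thesis using er by (intro exI[of _ "ball z0 r"] exI[of _ "\<Psi> \<circ> fst"]) simp
qed

text \<open>Exchanging the coordinates covers points with \<open>b = 0\<close>. The form changes
  sign under the exchange, whence the minus sign in the witness.\<close>

lemma exists_curve_form:
  assumes g: "has_partials g a b" and a: "has_partials a a1 a2" and b: "has_partials b b1 b2"
    and z0: "g z0 = 0" "a z0 \<noteq> 0 \<or> b z0 \<noteq> 0"
  shows "\<exists>W \<Phi>. z0 \<in> W \<and> has_curve_form g a b \<Phi> W"
proof (cases "b z0 = 0")
  case False
  then show ?thesis using exists_curve_form_aux[OF g a b z0(1)] by blast
next
  case True
  let ?s = "prod.swap :: complex \<times> complex \<Rightarrow> _"
  have "(g \<circ> ?s) (?s z0) = 0" "(a \<circ> ?s) (?s z0) \<noteq> 0" using z0 True by auto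
  from exists_curve_form_aux[OF has_partials_swap[OF g] has_partials_swap[OF b] has_partials_swap[OF a] this]
  obtain W \<Phi> where W: "?s z0 \<in> W" "open W"
    and \<Phi>: "\<And>y. y \<in> W \<Longrightarrow> g (?s y) = 0 \<Longrightarrow>
      (\<Phi> has_derivative (\<lambda>v. a (?s y) * fst v - b (?s y) * snd v)) (at y within {z. g (?s z) = 0})"
    unfolding has_curve_form_def by auto
  have "((\<lambda>z. - \<Phi> (?s z)) has_derivative (\<lambda>v. b y * fst v - a y * snd v)) (at y within {z. g z = 0})"
    if y: "?s y \<in> W" "g y = 0" for y
  proof -
    have sw: "(?s has_derivative ?s) (at y within {z. g z = 0})"
      by (rule swap_has_derivative)
    have "?s ` {z. g z = 0} \<subseteq> {z. g (?s z) = 0}" by auto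
    moreover have "(\<Phi> has_derivative (\<lambda>v. a y * fst v - b y * snd v)) (at (?s y) within {z. g (?s z) = 0})"
      using \<Phi>[of "?s y"] y by simp
    ultimately have "(\<Phi> has_derivative (\<lambda>v. a y * fst v - b y * snd v)) (at (?s y) within ?s ` {z. g z = 0})"
      using has_derivative_subset by blast
    from has_derivative_minus[OF has_derivative_in_compose[OF sw this]]
    show ?thesis by (simp add: prod.swap_def)
  qed
  moreover have "open (?s -` W)" using W(2)
    by (intro open_vimage continuous_on_prod_swap)
  ultimately have "has_curve_form g a b (\<lambda>z. - \<Phi> (?s z)) (?s -` W)"
    unfolding has_curve_form_def by simp
  moreover have "z0 \<in> ?s -` W" using W(1) by simp
  ultimately show ?thesis by blast
qed

text \<open>Pulled back to the graph of the implicit function, \<open>\<Theta>\<close> has zero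
  derivative on a disc, and all zeros of \<open>g\<close> near \<open>z0\<close> lie on that
  graph.\<close>

lemma curve_form_locally_unique_aux:
  fixes g :: "complex \<times> complex \<Rightarrow> complex"
  assumes g: "has_partials g a b" and cont: "continuous_on UNIV a" "continuous_on UNIV b"
    and z0: "g z0 = 0" "b z0 \<noteq> 0"
    and W: "open W" "z0 \<in> W"
    and \<Theta>: "\<And>y. y \<in> W \<Longrightarrow> g y = 0 \<Longrightarrow> (\<Theta> has_derivative (\<lambda>v. 0)) (at y within {z. g z = 0})"
  shows "\<exists>r>0. \<forall>z\<in>ball z0 r. g z = 0 \<longrightarrow> \<Theta> z = (\<Theta> z0 :: complex)"
proof -
  obtain e r \<phi> where er: "e > 0" "r > 0" and \<phi>0: "\<phi> (fst z0) = snd z0"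
    and \<phi>: "\<And>x. x \<in> ball (fst z0) e \<Longrightarrow> g (x, \<phi> x) = 0 \<and> b (x, \<phi> x) \<noteq> 0 \<and>
       (\<phi> has_field_derivative - a (x, \<phi> x) / b (x, \<phi> x)) (at x)"
    and uniq: "\<And>z. z \<in> ball z0 r \<Longrightarrow> g z = 0 \<Longrightarrow> fst z \<in> ball (fst z0) e \<and> snd z = \<phi> (fst z)"
    using implicit_function[OF g cont z0] by metis
  have cont\<phi>: "continuous (at x) (\<lambda>x. (x, \<phi> x))" if "x \<in> ball (fst z0) e" for x
    using \<phi>[OF that] by (intro continuous_intros) (blast intro: DERIV_isCont)
  have "eventually (\<lambda>z. z \<in> W) (nhds (fst z0, \<phi> (fst z0)))"
    using W \<phi>0 by (metis eventually_nhds prod.collapse)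
  moreover have "((\<lambda>x. (x, \<phi> x)) \<longlongrightarrow> (fst z0, \<phi> (fst z0))) (nhds (fst z0))"
    using cont\<phi>[of "fst z0"] er by (simp add: continuous_at tendsto_nhds_iff isCont_def)
  ultimately have "eventually (\<lambda>x. (x, \<phi> x) \<in> W) (nhds (fst z0))"
    by (rule eventually_compose_filterlim)
  then obtain d where d: "d > 0" "\<And>x. dist x (fst z0) < d \<Longrightarrow> (x, \<phi> x) \<in> W"
    unfolding eventually_nhds_metric by blast
  define B where "B = ball (fst z0) (min d e)"
  have "((\<lambda>x. \<Theta> (x, \<phi> x)) has_derivative (\<lambda>v. 0)) (at x within B)" if x: "x \<in> B" for x
  proof -
    have xe: "x \<in> ball (fst z0) e" "(x, \<phi> x) \<in> W" using x d unfolding B_def by (auto simp: dist_commute)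
    obtain c where c: "(\<phi> has_derivative (\<lambda>v. c * v)) (at x)"
      using \<phi>[OF xe(1)] unfolding has_field_derivative_def by blast
    have d1: "((\<lambda>x. (x, \<phi> x)) has_derivative (\<lambda>v. (v, c * v))) (at x within B)"
      by (intro has_derivative_Pair has_derivative_ident has_derivative_at_withinI[OF c])
    have "(\<lambda>x. (x, \<phi> x)) ` B \<subseteq> {z. g z = 0}"
      using \<phi> by (metis (mono_tags, lifting) B_def image_subsetI mem_Collect_eq mem_ball min_less_iff_conj)
    then have "(\<Theta> has_derivative (\<lambda>v. 0)) (at (x, \<phi> x) within (\<lambda>x. (x, \<phi> x)) ` B)"
      using \<Theta>[OF xe(2)] \<phi>[OF xe(1)] has_derivative_subset by blast
    from has_derivative_in_compose[OF d1 this] show ?thesis .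
  qed
  then obtain c where c: "\<And>x. x \<in> B \<Longrightarrow> \<Theta> (x, \<phi> x) = c"
    using has_derivative_zero_constant[of B "\<lambda>x. \<Theta> (x, \<phi> x)"] unfolding B_def by auto
  have "\<Theta> z = \<Theta> z0" if z: "z \<in> ball z0 (min r (min d e))" "g z = 0" for z
  proof -
    have eq: "z = (fst z, \<phi> (fst z))" using uniq[of z] z by (auto simp: prod_eq_iff)
    have "dist (fst z0) (fst z) \<le> dist z0 z" by (rule dist_fst_le)
    then have "fst z \<in> B" "fst z0 \<in> B" using z d er unfolding B_def by auto
    then show ?thesis using c[of "fst z"] c[of "fst z0"] eq \<phi>0 by (metis prod.collapse)
  qed
  then show ?thesis using er d by (intro exI[of _ "min r (min d e)"]) simp
qed

text \<open>The difference of two local primitives has zero derivative along the curve. This is what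
  makes increments independent of the chosen primitive.\<close>

lemma curve_form_locally_unique:
  fixes g :: "complex \<times> complex \<Rightarrow> complex"
  assumes g: "has_partials g a b" and cont: "continuous_on UNIV a" "continuous_on UNIV b"
    and z0: "g z0 = 0" "a z0 \<noteq> 0 \<or> b z0 \<noteq> 0"
    and z0W: "z0 \<in> W1" "z0 \<in> W2"
    and \<Phi>: "has_curve_form g a b \<Phi>1 W1" "has_curve_form g a b \<Phi>2 W2"
  shows "\<exists>r>0. \<forall>z\<in>ball z0 r. g z = 0 \<longrightarrow> \<Phi>1 z - \<Phi>2 z = \<Phi>1 z0 - \<Phi>2 z0"
proof -
  define \<Theta> where "\<Theta> = (\<lambda>z. \<Phi>1 z - \<Phi>2 z)"
  define W where "W = W1 \<inter> W2"
  have W: "open W" "z0 \<in> W" using \<Phi> z0W unfolding has_curve_form_def W_def by auto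
  have \<Theta>: "(\<Theta> has_derivative (\<lambda>v. 0)) (at y within {z. g z = 0})" if "y \<in> W" "g y = 0" for y
    using has_derivative_diff[of \<Phi>1 _ "at y within {z. g z = 0}" \<Phi>2] \<Phi> that
    unfolding has_curve_form_def \<Theta>_def W_def by fastforce
  have "\<exists>r>0. \<forall>z\<in>ball z0 r. g z = 0 \<longrightarrow> \<Theta> z = \<Theta> z0"
  proof (cases "b z0 = 0")
    case False
    then show ?thesis using curve_form_locally_unique_aux[OF g cont z0(1) _ W \<Theta>] by blast
  next
    case True
    let ?s = "prod.swap :: complex \<times> complex \<Rightarrow> _"
    have s: "continuous_on A ?s" for A
      by (rule continuous_on_prod_swap)
    have "((\<Theta> \<circ> ?s) has_derivative (\<lambda>v. 0)) (at y within {z. (g \<circ> ?s) z = 0})"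
      if y: "y \<in> ?s -` W" "(g \<circ> ?s) y = 0" for y
    proof -
      have sw: "(?s has_derivative ?s) (at y within {z. (g \<circ> ?s) z = 0})"
        by (rule swap_has_derivative)
      have "?s ` {z. (g \<circ> ?s) z = 0} \<subseteq> {z. g z = 0}" by auto
      moreover have "(\<Theta> has_derivative (\<lambda>v. 0)) (at (?s y) within {z. g z = 0})"
        using \<Theta>[of "?s y"] y by simp
      ultimately have "(\<Theta> has_derivative (\<lambda>v. 0)) (at (?s y) within ?s ` {z. (g \<circ> ?s) z = 0})"
        using has_derivative_subset by blast
      from has_derivative_in_compose[OF sw this] show ?thesis by (simp add: o_def)
    qed
    moreover have "open (?s -` W)" using W(1) s by (intro open_vimage) auto
    moreover have "continuous_on UNIV (b \<circ> ?s)" "continuous_on UNIV (a \<circ> ?s)"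
      unfolding o_def
      by (rule continuous_on_compose2[OF cont(2) s], simp, rule continuous_on_compose2[OF cont(1) s], simp)
    ultimately have "\<exists>r>0. \<forall>z\<in>ball (?s z0) r. (g \<circ> ?s) z = 0 \<longrightarrow> (\<Theta> \<circ> ?s) z = (\<Theta> \<circ> ?s) (?s z0)"
    proof (intro curve_form_locally_unique_aux[OF has_partials_swap[OF g], where W="?s -` W"])
      show "(g \<circ> ?s) (?s z0) = 0" "(a \<circ> ?s) (?s z0) \<noteq> 0" "?s z0 \<in> ?s -` W"
        using W(2) z0 True by auto
    qed
    then obtain r where r: "r > 0" "\<forall>z\<in>ball (?s z0) r. g (?s z) = 0 \<longrightarrow> \<Theta> (?s z) = \<Theta> z0"
      unfolding o_def swap_swap by blast
    have "?s z \<in> ball (?s z0) r" if "z \<in> ball z0 r" for z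
      using that by (simp add: dist_prod_def add.commute)
    then have "\<forall>z\<in>ball z0 r. g z = 0 \<longrightarrow> \<Theta> z = \<Theta> z0" using r(2) by (metis swap_swap)
    then show ?thesis using r(1) by blast
  qed
  then show ?thesis unfolding \<Theta>_def .
qed

section \<open>Real points: tangents and arcs of the real curve\<close>

definition cpair :: "real \<times> real \<Rightarrow> complex \<times> complex" where
  "cpair x = (of_real (fst x), of_real (snd x))"

lemma cpair_has_derivative: "(cpair has_derivative cpair) (at x within S)"
  unfolding cpair_def by (intro has_derivative_Pair has_derivative_of_real has_derivative_fst
      has_derivative_snd has_derivative_ident)

lemma continuous_on_cpair: "continuous_on A cpair"
  by (rule has_derivative_continuous_on) (rule cpair_has_derivative)

text \<open>Taking real parts commutes with multiplication by the real entries of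
  \<open>cpair v\<close>. The real implicit function results thus become available for the real
  locus.\<close>

lemma has_partials_Re_cpair:
  assumes "has_partials g a b"
  shows "has_partials (\<lambda>x. Re (g (cpair x))) (\<lambda>x. Re (a (cpair x))) (\<lambda>x. Re (b (cpair x)))"
  unfolding has_partials_def
proof
  fix z :: "real \<times> real"
  have "((\<lambda>x. g (cpair x)) has_derivative
      (\<lambda>v. a (cpair z) * fst (cpair v) + b (cpair z) * snd (cpair v))) (at z)"
    by (rule has_derivative_compose[OF cpair_has_derivative has_partialsD[OF assms]])
  then have "((\<lambda>x. Re (g (cpair x))) has_derivative
      (\<lambda>v. Re (a (cpair z) * fst (cpair v) + b (cpair z) * snd (cpair v)))) (at z)"
    by (rule bounded_linear.has_derivative[OF bounded_linear_Re])
  moreover have "Re (a (cpair z) * fst (cpair v) + b (cpair z) * snd (cpair v)) =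
      Re (a (cpair z)) * fst v + Re (b (cpair z)) * snd v" for v
    by (simp add: cpair_def)
  ultimately show "((\<lambda>x. Re (g (cpair x))) has_derivative
      (\<lambda>v. Re (a (cpair z)) * fst v + Re (b (cpair z)) * snd v)) (at z)"
    by (simp only:)
qed

text \<open>Parametrised by the first coordinate, the graph has velocity
  \<open>(1, - a / b)\<close>, which is \<open>(b, - a)\<close> scaled by
  \<open>\<kappa> = 1 / b\<close>.\<close>

lemma level_curve_tangent_aux:
  fixes g a b :: "real \<times> real \<Rightarrow> real"
  assumes g: "has_partials g a b" and cont: "continuous_on UNIV a" "continuous_on UNIV b"
    and z0: "g z0 = 0" "b z0 \<noteq> 0"
  shows "\<exists>\<alpha> \<kappa>. \<kappa> \<noteq> 0 \<and> \<alpha> 0 = z0 \<and> (\<forall>\<^sub>F s in nhds 0. g (\<alpha> s) = 0) \<and>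
    (\<alpha> has_derivative (\<lambda>s. (s * (\<kappa> * b z0), - s * (\<kappa> * a z0)))) (at 0)"
proof -
  obtain e r \<phi> where er: "e > 0" "r > 0" and \<phi>0: "\<phi> (fst z0) = snd z0"
    and \<phi>: "\<And>x. x \<in> ball (fst z0) e \<Longrightarrow> g (x, \<phi> x) = 0 \<and> b (x, \<phi> x) \<noteq> 0 \<and>
       (\<phi> has_field_derivative - a (x, \<phi> x) / b (x, \<phi> x)) (at x)"
    and uniq: "\<And>z. z \<in> ball z0 r \<Longrightarrow> g z = 0 \<Longrightarrow> fst z \<in> ball (fst z0) e \<and> snd z = \<phi> (fst z)"
    using implicit_function[OF g cont z0] by metis
  define \<alpha> where "\<alpha> = (\<lambda>s. (fst z0 + s, \<phi> (fst z0 + s)))"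
  have "(\<phi> has_field_derivative - a z0 / b z0) (at (fst z0 + 0))"
    using \<phi>[of "fst z0"] er \<phi>0 by simp
  then have "(\<phi> has_derivative (\<lambda>s. - a z0 / b z0 * s)) (at (fst z0 + 0))"
    unfolding has_field_derivative_def .
  moreover have *: "((\<lambda>s. fst z0 + s) has_derivative (\<lambda>s. s)) (at 0)"
    by (auto intro!: derivative_eq_intros)
  ultimately have "((\<lambda>s. \<phi> (fst z0 + s)) has_derivative (\<lambda>s. - a z0 / b z0 * s)) (at 0)"
    by (rule has_derivative_compose[rotated])
  with * have "(\<alpha> has_derivative (\<lambda>s. (s, - a z0 / b z0 * s))) (at 0)"
    unfolding \<alpha>_def by (rule has_derivative_Pair)
  moreover have "(\<lambda>s. (s, - a z0 / b z0 * s)) = (\<lambda>s. (s * (1 / b z0 * b z0), - s * (1 / b z0 * a z0)))"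
    using z0 by (simp add: fun_eq_iff)
  moreover have "\<forall>\<^sub>F s in nhds 0. g (\<alpha> s) = 0"
    unfolding eventually_nhds_metric
  proof (intro exI conjI allI impI)
    fix s :: real assume "dist s 0 < e"
    then have "fst z0 + s \<in> ball (fst z0) e" by (simp add: dist_norm)
    then show "g (\<alpha> s) = 0" using \<phi> unfolding \<alpha>_def by blast
  qed (rule er)
  moreover have "\<alpha> 0 = z0" using \<phi>0 by (simp add: \<alpha>_def)
  ultimately show ?thesis using z0 by (intro exI[of _ \<alpha>] exI[of _ "1 / b z0"]) simp
qed

lemma level_curve_tangent:
  fixes g a b :: "real \<times> real \<Rightarrow> real"
  assumes g: "has_partials g a b" and cont: "continuous_on UNIV a" "continuous_on UNIV b"
    and z0: "g z0 = 0" "a z0 \<noteq> 0 \<or> b z0 \<noteq> 0"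
  shows "\<exists>\<alpha> \<kappa>. \<kappa> \<noteq> 0 \<and> \<alpha> 0 = z0 \<and> (\<forall>\<^sub>F s in nhds 0. g (\<alpha> s) = 0) \<and>
    (\<alpha> has_derivative (\<lambda>s. (s * (\<kappa> * b z0), - s * (\<kappa> * a z0)))) (at 0)"
proof (cases "b z0 = 0")
  case False
  then show ?thesis using level_curve_tangent_aux[OF g cont z0(1)] by blast
next
  case True
  let ?s = "prod.swap :: real \<times> real \<Rightarrow> _"
  have "(g \<circ> ?s) (?s z0) = 0" "(a \<circ> ?s) (?s z0) \<noteq> 0" using z0 True by auto
  moreover have "continuous_on UNIV (b \<circ> ?s)" "continuous_on UNIV (a \<circ> ?s)"
    unfolding o_def by (rule continuous_on_compose2[OF cont(2) continuous_on_prod_swap], simp,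
        rule continuous_on_compose2[OF cont(1) continuous_on_prod_swap], simp)
  ultimately obtain \<alpha> \<kappa> where \<alpha>: "\<kappa> \<noteq> 0" "\<alpha> 0 = ?s z0" "\<forall>\<^sub>F s in nhds 0. (g \<circ> ?s) (\<alpha> s) = 0"
    "(\<alpha> has_derivative (\<lambda>s. (s * (\<kappa> * a z0), - s * (\<kappa> * b z0)))) (at 0)"
    using level_curve_tangent_aux[OF has_partials_swap[OF g], of "?s z0"] by auto
  from has_derivative_compose[OF \<alpha>(4) swap_has_derivative]
  have "((\<lambda>s. ?s (\<alpha> s)) has_derivative (\<lambda>s. (s * (- \<kappa> * b z0), - s * (- \<kappa> * a z0)))) (at 0)"
    by simp
  then show ?thesis using \<alpha> by (intro exI[of _ "\<lambda>s. ?s (\<alpha> s)"] exI[of _ "- \<kappa>"]) simp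
qed

text \<open>One constant serves all nearby points because the graph is followed over a closed
  interval of half the radius, where compactness bounds the slope by \<open>B\<close>.\<close>

lemma level_curve_lipschitz_arcs_aux:
  fixes g a b :: "real \<times> real \<Rightarrow> real"
  assumes g: "has_partials g a b" and cont: "continuous_on UNIV a" "continuous_on UNIV b"
    and z0: "g z0 = 0" "b z0 \<noteq> 0"
  shows "\<exists>r>0. \<exists>L. \<forall>z\<in>ball z0 r. g z = 0 \<longrightarrow>
    (\<exists>\<gamma>. L-lipschitz_on {0..1::real} \<gamma> \<and> \<gamma> 0 = z0 \<and> \<gamma> 1 = z \<and> \<gamma> ` {0..1} \<subseteq> {z. g z = 0})"
proof -
  obtain e r \<phi> where er: "e > 0" "r > 0" and \<phi>0: "\<phi> (fst z0) = snd z0"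
    and \<phi>: "\<And>x. x \<in> ball (fst z0) e \<Longrightarrow> g (x, \<phi> x) = 0 \<and> b (x, \<phi> x) \<noteq> 0 \<and>
       (\<phi> has_field_derivative - a (x, \<phi> x) / b (x, \<phi> x)) (at x)"
    and uniq: "\<And>z. z \<in> ball z0 r \<Longrightarrow> g z = 0 \<Longrightarrow> fst z \<in> ball (fst z0) e \<and> snd z = \<phi> (fst z)"
    using implicit_function[OF g cont z0] by metis
  define S where "S = cball (fst z0) (e / 2)"
  have S: "x \<in> ball (fst z0) e" if "x \<in> S" for x using that er unfolding S_def by auto
  have c1: "continuous_on S (\<lambda>x. (x, \<phi> x))"
  proof (intro continuous_on_Pair continuous_on_id)
    show "continuous_on S \<phi>"
    proof (rule DERIV_continuous_on)
      show "(\<phi> has_field_derivative - a (x, \<phi> x) / b (x, \<phi> x)) (at x within S)" if "x \<in> S" for x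
        using \<phi>[OF S[OF that]] has_field_derivative_at_within by blast
    qed
  qed
  have "continuous_on S (\<lambda>x. - a (x, \<phi> x) / b (x, \<phi> x))"
  proof (intro continuous_on_divide continuous_on_minus ballI)
    show "continuous_on S (\<lambda>x. a (x, \<phi> x))" "continuous_on S (\<lambda>x. b (x, \<phi> x))"
      by (rule continuous_on_compose2[OF cont(1) c1], simp, rule continuous_on_compose2[OF cont(2) c1], simp)
    show "b (x, \<phi> x) \<noteq> 0" if "x \<in> S" for x using \<phi>[OF S[OF that]] by blast
  qed
  then have "bounded ((\<lambda>x. - a (x, \<phi> x) / b (x, \<phi> x)) ` S)"
    unfolding S_def by (intro compact_imp_bounded compact_continuous_image compact_cball)
  then obtain B where B: "B > 0" "\<And>x. x \<in> S \<Longrightarrow> norm (- a (x, \<phi> x) / b (x, \<phi> x)) \<le> B"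
    unfolding bounded_pos by auto
  have lip: "norm (\<phi> x - \<phi> y) \<le> B * norm (x - y)" if "x \<in> S" "y \<in> S" for x y
  proof (rule field_differentiable_bound[of S \<phi> "\<lambda>x. - a (x, \<phi> x) / b (x, \<phi> x)"])
    show "convex S" unfolding S_def by simp
    show "(\<phi> has_field_derivative - a (x, \<phi> x) / b (x, \<phi> x)) (at x within S)" if "x \<in> S" for x
      using \<phi>[OF S[OF that]] has_field_derivative_at_within by blast
  qed (use B that in auto)
  \<comment> \<open>The first coordinate moves with speed at most \<open>e\<close>; the slope bound
    enlarges this by at most the factor \<open>1 + B\<close>.\<close>
  have "\<exists>\<gamma>. (e * (1 + B))-lipschitz_on {0..1::real} \<gamma> \<and> \<gamma> 0 = z0 \<and> \<gamma> 1 = z \<and> \<gamma> ` {0..1} \<subseteq> {z. g z = 0}"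
    if z: "z \<in> ball z0 (min r (e / 2))" "g z = 0" for z
  proof -
    have zr: "snd z = \<phi> (fst z)" using uniq z by auto
    have "dist (fst z0) (fst z) \<le> dist z0 z" by (rule dist_fst_le)
    then have zS: "fst z \<in> S" "fst z0 \<in> S" using z er unfolding S_def by auto
    define l where "l = (\<lambda>s. fst z0 + s * (fst z - fst z0))"
    have lS: "l s \<in> S" if "s \<in> {0..1}" for s
    proof -
      have "dist (fst z0) (l s) = s * dist (fst z0) (fst z)"
        using that unfolding l_def by (simp add: dist_real_def abs_mult abs_minus_commute)
      also have "\<dots> \<le> 1 * dist (fst z0) (fst z)" using that by (intro mult_right_mono) auto
      finally show ?thesis using zS unfolding S_def by auto
    qed
    have ll: "norm (l s - l t) \<le> e * \<bar>s - t\<bar>" for s t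
    proof -
      have "l s - l t = (s - t) * (fst z - fst z0)" by (simp add: l_def algebra_simps)
      moreover have "\<bar>fst z - fst z0\<bar> \<le> e"
        using zS er unfolding S_def mem_cball dist_real_def by linarith
      ultimately show ?thesis
        using mult_right_mono[of "\<bar>fst z - fst z0\<bar>" e "\<bar>s - t\<bar>"] by (simp add: abs_mult mult.commute)
    qed
    define \<gamma> where "\<gamma> = (\<lambda>s. (l s, \<phi> (l s)))"
    have "(e * (1 + B))-lipschitz_on {0..1::real} \<gamma>"
    proof (rule lipschitz_onI)
      fix s t :: real assume st: "s \<in> {0..1}" "t \<in> {0..1}"
      have "dist (\<gamma> s) (\<gamma> t) \<le> norm (l s - l t) + norm (\<phi> (l s) - \<phi> (l t))"
        unfolding \<gamma>_def by (simp add: dist_norm norm_Pair sqrt_sum_squares_le_sum_abs order_trans[OF sqrt_sum_squares_le_sum_abs])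
      also have "\<dots> \<le> norm (l s - l t) + B * norm (l s - l t)"
        using lip[OF lS lS, OF st] by simp
      also have "\<dots> = (1 + B) * norm (l s - l t)" by (simp add: algebra_simps)
      also have "\<dots> \<le> (1 + B) * (e * \<bar>s - t\<bar>)" using B ll by (intro mult_left_mono) auto
      finally show "dist (\<gamma> s) (\<gamma> t) \<le> e * (1 + B) * dist s t"
        by (simp add: dist_real_def algebra_simps)
    qed (use er B in simp)
    moreover have "\<gamma> 0 = z0" "\<gamma> 1 = z" using zr \<phi>0 by (auto simp: \<gamma>_def l_def prod_eq_iff)
    moreover have "\<gamma> ` {0..1} \<subseteq> {z. g z = 0}"
      using \<phi>[OF S[OF lS]] unfolding \<gamma>_def by blast
    ultimately show ?thesis by blast
  qed
  moreover have "min r (e / 2) > 0" using er by simp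
  ultimately show ?thesis by blast
qed

lemma level_curve_lipschitz_arcs:
  fixes g a b :: "real \<times> real \<Rightarrow> real"
  assumes g: "has_partials g a b" and cont: "continuous_on UNIV a" "continuous_on UNIV b"
    and z0: "g z0 = 0" "a z0 \<noteq> 0 \<or> b z0 \<noteq> 0"
  shows "\<exists>r>0. \<exists>L. \<forall>z\<in>ball z0 r. g z = 0 \<longrightarrow>
    (\<exists>\<gamma>. L-lipschitz_on {0..1::real} \<gamma> \<and> \<gamma> 0 = z0 \<and> \<gamma> 1 = z \<and> \<gamma> ` {0..1} \<subseteq> {z. g z = 0})"
proof (cases "b z0 = 0")
  case False
  then show ?thesis using level_curve_lipschitz_arcs_aux[OF g cont z0(1)] by blast
next
  case True
  let ?s = "prod.swap :: real \<times> real \<Rightarrow> _"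
  have sd: "dist (?s x) (?s y) = dist x y" for x y by (simp add: dist_prod_def add.commute)
  have "(g \<circ> ?s) (?s z0) = 0" "(a \<circ> ?s) (?s z0) \<noteq> 0" using z0 True by auto
  moreover have "continuous_on UNIV (b \<circ> ?s)" "continuous_on UNIV (a \<circ> ?s)"
    unfolding o_def by (rule continuous_on_compose2[OF cont(2) continuous_on_prod_swap], simp,
        rule continuous_on_compose2[OF cont(1) continuous_on_prod_swap], simp)
  ultimately obtain r L where r: "r > 0" and *: "\<forall>z\<in>ball (?s z0) r. (g \<circ> ?s) z = 0 \<longrightarrow>
    (\<exists>\<gamma>. L-lipschitz_on {0..1::real} \<gamma> \<and> \<gamma> 0 = ?s z0 \<and> \<gamma> 1 = z \<and> \<gamma> ` {0..1} \<subseteq> {z. (g \<circ> ?s) z = 0})"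
    using level_curve_lipschitz_arcs_aux[OF has_partials_swap[OF g], of "?s z0"] by blast
  have "\<exists>\<gamma>. L-lipschitz_on {0..1::real} \<gamma> \<and> \<gamma> 0 = z0 \<and> \<gamma> 1 = z \<and> \<gamma> ` {0..1} \<subseteq> {z. g z = 0}"
    if z: "z \<in> ball z0 r" "g z = 0" for z
  proof -
    have "?s z \<in> ball (?s z0) r" "(g \<circ> ?s) (?s z) = 0" using z sd[of z0 z] by auto
    with * obtain \<gamma> where \<gamma>: "L-lipschitz_on {0..1::real} \<gamma>" "\<gamma> 0 = ?s z0" "\<gamma> 1 = ?s z"
      "\<gamma> ` {0..1} \<subseteq> {z. (g \<circ> ?s) z = 0}" by blast
    have "L-lipschitz_on {0..1::real} (\<lambda>s. ?s (\<gamma> s))"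
      using \<gamma>(1) unfolding lipschitz_on_def sd .
    then show ?thesis using \<gamma>(2-4) by (intro exI[of _ "\<lambda>s. ?s (\<gamma> s)"]) auto
  qed
  then show ?thesis using r by blast
qed

section \<open>The obstruction to contracting the real locus\<close>

text \<open>Let \<open>H x\<close> be the integral of \<open>b dx - a dy\<close> along the track
  \<open>t -> U (x, t)\<close>. It is locally the pull-back of a primitive, hence continuous with a
  maximum on \<open>K\<close>. A curve tangent to \<open>(b, - a)\<close> stays in \<open>K\<close>
  because \<open>K\<close> is open in the real locus, and along it the derivative of
  \<open>Re H\<close> is a nonzero multiple of \<open>a^2 + b^2\<close>.\<close>

lemma level_curve_real_locus_not_contractible:
  fixes g a b a1 a2 b1 b2 :: "complex \<times> complex \<Rightarrow> complex"
    and U :: "(real \<times> real) \<times> real \<Rightarrow> complex \<times> complex"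
  assumes g: "has_partials g a b" and a: "has_partials a a1 a2" and b: "has_partials b b1 b2"
    and smooth: "\<And>z. g z = 0 \<Longrightarrow> a z \<noteq> 0 \<or> b z \<noteq> 0"
    and real: "\<And>x. g (cpair x) \<in> \<real>" "\<And>x. a (cpair x) \<in> \<real>" "\<And>x. b (cpair x) \<in> \<real>"
    and K: "compact K" "K \<noteq> {}" "\<And>x. x \<in> K \<Longrightarrow> g (cpair x) = 0"
    and Kopen: "\<And>x. x \<in> K \<Longrightarrow> \<exists>r>0. \<forall>y\<in>ball x r. g (cpair y) = 0 \<longrightarrow> y \<in> K"
    and U: "continuous_on (K \<times> {0..1}) U" "\<And>x t. x \<in> K \<Longrightarrow> t \<in> {0..1} \<Longrightarrow> g (U (x, t)) = 0"
      "\<And>x. x \<in> K \<Longrightarrow> U (x, 1) = cpair x" "\<And>x. x \<in> K \<Longrightarrow> U (x, 0) = p"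
  shows False
proof -
  note ca = has_partials_imp_continuous_on[OF a, of UNIV]
  note cb = has_partials_imp_continuous_on[OF b, of UNIV]
  define I where "I = U ` (K \<times> {0..1})"
  have "compact (K \<times> {0..1::real})" using K by (intro compact_Times) auto
  then have "compact I" "uniformly_continuous_on (K \<times> {0..1}) U"
    unfolding I_def using U(1) compact_continuous_image compact_uniformly_continuous by blast+
  \<comment> \<open>Domains of local primitives cover the image of the homotopy; \<open>e\<close> is
    a Lebesgue number of this cover.\<close>
  define \<G> where "\<G> = {W. \<exists>\<Phi>. has_curve_form g a b \<Phi> W}"
  have "I \<subseteq> \<Union>\<G>"
  proof
    fix z assume "z \<in> I"
    then have "g z = 0" unfolding I_def using U(2) by auto
    then show "z \<in> \<Union>\<G>" using exists_curve_form[OF g a b _ smooth] unfolding \<G>_def by blast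
  qed
  moreover have "open W" if "W \<in> \<G>" for W using that unfolding \<G>_def has_curve_form_def by auto
  ultimately obtain e where e: "e > 0" "\<And>z. z \<in> I \<Longrightarrow> \<exists>W\<in>\<G>. ball z e \<subseteq> W"
    using Heine_Borel_lemma[OF \<open>compact I\<close>] by metis
  obtain d where d: "d > 0" "\<And>q q'. q \<in> K \<times> {0..1} \<Longrightarrow> q' \<in> K \<times> {0..1} \<Longrightarrow> dist q' q < d \<Longrightarrow> dist (U q') (U q) < e"
    using \<open>uniformly_continuous_on _ U\<close> e(1) unfolding uniformly_continuous_on_def by metis
  \<comment> \<open>One half of \<open>d\<close> is reserved for the change of \<open>x\<close>, the
    other for the change of \<open>t\<close>.\<close>
  obtain n where n: "1 / real (Suc n) < d / 2" using nat_approx_posE[of "d / 2"] d by auto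
  define \<tau> where "\<tau> = (\<lambda>i::nat. real i / real (Suc n))"
  have \<tau>01: "\<tau> i \<in> {0..1}" if "i \<le> Suc n" for i using that unfolding \<tau>_def by (simp add: divide_simps)
  have \<tau>_Suc: "\<tau> (Suc i) = \<tau> i + 1 / real (Suc n)" for i unfolding \<tau>_def by (simp add: add_divide_distrib)
  have \<tau>_le: "\<tau> i \<le> \<tau> (Suc i)" for i unfolding \<tau>_Suc by simp
  have "\<exists>\<Phi>. has_curve_form g a b \<Phi> (ball (U (x, \<tau> i)) e)" if "x \<in> K" "i \<le> n" for x i
  proof -
    have "U (x, \<tau> i) \<in> I" unfolding I_def using that \<tau>01[of i] by auto
    then obtain W \<Phi> where "has_curve_form g a b \<Phi> W" "ball (U (x, \<tau> i)) e \<subseteq> W"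
      using e(2) unfolding \<G>_def by blast
    then have "has_curve_form g a b \<Phi> (ball (U (x, \<tau> i)) e)"
      unfolding has_curve_form_def by (meson open_ball subsetD)
    then show ?thesis by blast
  qed
  \<comment> \<open>A separate choice for every node \<open>(x, i)\<close>: neighbouring primitives
    agree only up to local constants.\<close>
  then obtain \<Phi> where \<Phi>: "\<And>x i. x \<in> K \<Longrightarrow> i \<le> n \<Longrightarrow> has_curve_form g a b (\<Phi> x i) (ball (U (x, \<tau> i)) e)"
    by metis
  have inball: "U (x', t) \<in> ball (U (x, \<tau> i)) e"
    if "x \<in> K" "x' \<in> K" "dist x' x < d / 2" "i \<le> n" "t \<in> {\<tau> i..\<tau> (Suc i)}" for x x' i t
  proof -
    have t: "t \<in> {0..1}" using that(5) \<tau>01[of i] \<tau>01[of "Suc i"] that(4) by auto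
    have "\<bar>t - \<tau> i\<bar> < d / 2" using that(5) n unfolding \<tau>_Suc by auto
    then have "dist (x', t) (x, \<tau> i) < d"
      using that(3) sqrt_sum_squares_le_sum[of "dist x' x" "dist t (\<tau> i)"]
      unfolding dist_Pair_Pair by (simp add: dist_real_def)
    then have "dist (U (x', t)) (U (x, \<tau> i)) < e"
      using d(2)[of "(x, \<tau> i)" "(x', t)"] that t \<tau>01[of i] by auto
    then show ?thesis by (simp add: dist_commute)
  qed
  \<comment> \<open>The track of \<open>x'\<close> may be integrated with the primitives of a
    neighbouring \<open>x\<close>: both are defined along this piece, and their difference is
    locally constant on it.\<close>
  have same_increment: "\<Phi> x' i (U (x', \<tau> (Suc i))) - \<Phi> x' i (U (x', \<tau> i)) =
      \<Phi> x i (U (x', \<tau> (Suc i))) - \<Phi> x i (U (x', \<tau> i))"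
    if xx: "x \<in> K" "x' \<in> K" "dist x' x < d / 2" "i \<le> n" for x x' i
  proof -
    define J where "J = {\<tau> i..\<tau> (Suc i)}"
    have J01: "J \<subseteq> {0..1}" using \<tau>01[of i] \<tau>01[of "Suc i"] xx(4) unfolding J_def by auto
    define q where "q = (\<lambda>t. \<Phi> x' i (U (x', t)) - \<Phi> x i (U (x', t)))"
    have contU: "continuous_on J (\<lambda>t. U (x', t))"
      by (rule continuous_on_compose2[OF U(1)]) (use J01 xx in \<open>auto intro!: continuous_intros\<close>)
    have "(q has_derivative (\<lambda>_. 0)) (at t within J)" if t: "t \<in> J" for t
    proof -
      have "g (U (x', t)) = 0" using U(2) xx J01 t by blast
      moreover have "U (x', t) \<in> ball (U (x', \<tau> i)) e" "U (x', t) \<in> ball (U (x, \<tau> i)) e"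
        using inball[of x' x' i t] inball[of x x' i t] xx t d(1) unfolding J_def by auto
      ultimately obtain r where r: "r > 0" "\<And>z. z \<in> ball (U (x', t)) r \<Longrightarrow> g z = 0 \<Longrightarrow>
          \<Phi> x' i z - \<Phi> x i z = \<Phi> x' i (U (x', t)) - \<Phi> x i (U (x', t))"
        using curve_form_locally_unique[OF g ca cb _ smooth _ _ \<Phi>[OF xx(2,4)] \<Phi>[OF xx(1,4)]] by blast
      obtain \<delta> where \<delta>: "\<delta> > 0" "\<And>t'. t' \<in> J \<Longrightarrow> dist t' t < \<delta> \<Longrightarrow> dist (U (x', t')) (U (x', t)) < r"
        using contU t r(1) unfolding continuous_on_iff by metis
      show ?thesis
      proof (rule has_derivative_transform_within[OF has_derivative_const \<delta>(1) t])
        fix t' assume t': "t' \<in> J" "dist t' t < \<delta>"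
        then have "g (U (x', t')) = 0" using U(2) xx J01 by blast
        with \<delta>(2)[OF t'] show "q t = q t'"
          unfolding q_def using r(2)[of "U (x', t')"] by (simp add: dist_commute)
      qed
    qed
    then obtain c where "\<And>t. t \<in> J \<Longrightarrow> q t = c"
      using has_derivative_zero_constant[of J q] unfolding J_def by auto
    then have "q (\<tau> i) = q (\<tau> (Suc i))" using \<tau>_le[of i] unfolding J_def by auto
    then show ?thesis unfolding q_def by (simp add: algebra_simps)
  qed
  \<comment> \<open>Sums of increments replace the integral of the form along a merely continuous
    track.\<close>
  define H where "H = (\<lambda>x. \<Sum>i\<le>n. \<Phi> x i (U (x, \<tau> (Suc i))) - \<Phi> x i (U (x, \<tau> i)))"
  have contx: "((\<lambda>x'. U (x', \<tau> i)) \<longlongrightarrow> U (x, \<tau> i)) (at x within K)" if "x \<in> K" "i \<le> Suc n" for x i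
  proof -
    have "continuous_on K (\<lambda>x'. U (x', \<tau> i))"
      by (rule continuous_on_compose2[OF U(1)]) (use \<tau>01 that in \<open>auto intro!: continuous_intros\<close>)
    then show ?thesis using that continuous_on by blast
  qed
  have H_local: "\<exists>r>0. \<forall>x'\<in>K. dist x' x < r \<longrightarrow> H x' - H x = \<Phi> x n (cpair x') - \<Phi> x n (cpair x)"
    if x: "x \<in> K" for x
  proof -
    have "\<forall>\<^sub>F x' in at x within K. x' \<in> K \<and> dist x' x < d / 2"
      using d(1) unfolding eventually_at by (intro exI[of _ "d / 2"]) auto
    \<comment> \<open>Two consecutive primitives of \<open>x\<close> differ by a constant near the
      node \<open>U (x, \<tau> (Suc i))\<close>, so their jump is the same on the track of
      \<open>x'\<close>.\<close>
    moreover have "\<forall>\<^sub>F x' in at x within K. \<forall>i\<in>{..<n}.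
        \<Phi> x (Suc i) (U (x', \<tau> (Suc i))) - \<Phi> x i (U (x', \<tau> (Suc i))) =
        \<Phi> x (Suc i) (U (x, \<tau> (Suc i))) - \<Phi> x i (U (x, \<tau> (Suc i)))"
    proof (intro eventually_ball_finite ballI)
      fix i assume "i \<in> {..<n}"
      then have i: "i \<le> n" "Suc i \<le> n" "Suc i \<le> Suc n" by auto
      let ?z = "U (x, \<tau> (Suc i))"
      have "g ?z = 0" using U(2)[OF x \<tau>01[OF i(3)]] .
      moreover have "?z \<in> ball (U (x, \<tau> (Suc i))) e" "?z \<in> ball (U (x, \<tau> i)) e"
        using inball[of x x i "\<tau> (Suc i)"] x i(1) d(1) e(1) \<tau>_le[of i] by auto
      ultimately obtain r where r: "r > 0" "\<And>z. z \<in> ball ?z r \<Longrightarrow> g z = 0 \<Longrightarrow>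
          \<Phi> x (Suc i) z - \<Phi> x i z = \<Phi> x (Suc i) ?z - \<Phi> x i ?z"
        using curve_form_locally_unique[OF g ca cb _ smooth _ _ \<Phi>[OF x i(2)] \<Phi>[OF x i(1)]] by blast
      have "\<forall>\<^sub>F x' in at x within K. dist (U (x', \<tau> (Suc i))) ?z < r"
        using contx[OF x i(3)] r(1) by (rule tendstoD)
      moreover have "\<forall>\<^sub>F x' in at x within K. x' \<in> K"
        unfolding eventually_at by (intro exI[of _ 1]) auto
      ultimately show "\<forall>\<^sub>F x' in at x within K.
          \<Phi> x (Suc i) (U (x', \<tau> (Suc i))) - \<Phi> x i (U (x', \<tau> (Suc i))) = \<Phi> x (Suc i) ?z - \<Phi> x i ?z"
      proof eventually_elim
        case (elim x')
        then show ?case using r(2)[of "U (x', \<tau> (Suc i))"] U(2)[OF _ \<tau>01[OF i(3)]] by (simp add: dist_commute)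
      qed
    qed simp
    ultimately have "\<forall>\<^sub>F x' in at x within K. H x' - H x = \<Phi> x n (cpair x') - \<Phi> x n (cpair x)"
    proof eventually_elim
      case (elim x')
      \<comment> \<open>Equal jumps make the sum telescope. The lower end is zero because both
        tracks start at \<open>p\<close>; only the increment of the last primitive at time 1
        survives.\<close>
      let ?T = "\<lambda>k j. \<Phi> x k (U (x', \<tau> j)) - \<Phi> x k (U (x, \<tau> j))"
      have "(\<Sum>i\<le>k. ?T i (Suc i) - ?T i i) = ?T k (Suc k)" if "k \<le> n" for k
        using that
      proof (induction k)
        case 0
        have "\<tau> 0 = 0" by (simp add: \<tau>_def)
        then show ?case using U(4) x elim(1) by simp
      next
        case (Suc k)
        then have "?T (Suc k) (Suc k) = ?T k (Suc k)" using elim(2) by (simp add: algebra_simps)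
        then show ?case using Suc by simp
      qed
      from this[of n] have "(\<Sum>i\<le>n. ?T i (Suc i) - ?T i i) = ?T n (Suc n)" by simp
      moreover have "\<tau> (Suc n) = 1" by (simp add: \<tau>_def)
      ultimately have "(\<Sum>i\<le>n. ?T i (Suc i) - ?T i i) = \<Phi> x n (cpair x') - \<Phi> x n (cpair x)"
        using U(3) x elim(1) by simp
      moreover have "H x' = (\<Sum>i\<le>n. \<Phi> x i (U (x', \<tau> (Suc i))) - \<Phi> x i (U (x', \<tau> i)))"
        unfolding H_def using same_increment[OF x] elim(1) by (intro sum.cong) auto
      then have "H x' - H x = (\<Sum>i\<le>n. ?T i (Suc i) - ?T i i)"
        unfolding H_def by (simp add: sum_subtractf)
      ultimately show ?case by simp
    qed
    then show ?thesis unfolding eventually_at by (metis diff_self)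
  qed
  have cpair_K: "cpair ` K \<subseteq> {z. g z = 0}" using K(3) by auto
  have \<Phi>_deriv: "(\<Phi> x n has_derivative (\<lambda>v. b (cpair x) * fst v - a (cpair x) * snd v))
      (at (cpair x) within {z. g z = 0})" if x: "x \<in> K" for x
  proof -
    have "cpair x \<in> ball (U (x, \<tau> n)) e"
      using inball[of x x n "\<tau> (Suc n)"] x d(1) \<tau>_le[of n] U(3)[OF x] by (simp add: \<tau>_def)
    then show ?thesis using \<Phi>[OF x, of n] K(3)[OF x] unfolding has_curve_form_def by blast
  qed
  have "continuous_on K (\<lambda>x. Re (H x))"
    unfolding continuous_on_def
  proof
    fix x assume x: "x \<in> K"
    obtain r where r: "r > 0" "\<And>x'. x' \<in> K \<Longrightarrow> dist x' x < r \<Longrightarrow> H x' - H x = \<Phi> x n (cpair x') - \<Phi> x n (cpair x)"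
      using H_local[OF x] by blast
    have "((\<lambda>x'. \<Phi> x n (cpair x')) has_derivative (\<lambda>v. b (cpair x) * fst (cpair v) - a (cpair x) * snd (cpair v)))
        (at x within K)"
      by (rule has_derivative_in_compose[OF cpair_has_derivative has_derivative_subset[OF \<Phi>_deriv[OF x] cpair_K]])
    then have "((\<lambda>x'. \<Phi> x n (cpair x')) \<longlongrightarrow> \<Phi> x n (cpair x)) (at x within K)"
      using has_derivative_continuous continuous_within by blast
    then have "((\<lambda>x'. \<Phi> x n (cpair x') - \<Phi> x n (cpair x) + H x) \<longlongrightarrow> \<Phi> x n (cpair x) - \<Phi> x n (cpair x) + H x) (at x within K)"
      by (intro tendsto_intros)
    then have "(H \<longlongrightarrow> \<Phi> x n (cpair x) - \<Phi> x n (cpair x) + H x) (at x within K)"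
    proof (rule Lim_transform_eventually)
      show "\<forall>\<^sub>F x' in at x within K. \<Phi> x n (cpair x') - \<Phi> x n (cpair x) + H x = H x'"
        unfolding eventually_at using r by (metis add.commute diff_add_cancel)
    qed
    then show "((\<lambda>x. Re (H x)) \<longlongrightarrow> Re (H x)) (at x within K)" by (intro tendsto_intros) simp
  qed
  then obtain x where x: "x \<in> K" and max: "\<And>y. y \<in> K \<Longrightarrow> Re (H y) \<le> Re (H x)"
    using continuous_attains_sup[OF K(1,2)] by blast
  obtain r where r: "r > 0" "\<And>x'. x' \<in> K \<Longrightarrow> dist x' x < r \<Longrightarrow> H x' - H x = \<Phi> x n (cpair x') - \<Phi> x n (cpair x)"
    using H_local[OF x] by blast
  let ?A = "Re (a (cpair x))" and ?B = "Re (b (cpair x))"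
  have AB: "a (cpair x) = of_real ?A" "b (cpair x) = of_real ?B" using real by simp_all
  have "?A \<noteq> 0 \<or> ?B \<noteq> 0" using smooth[OF K(3)[OF x]] AB by force
  then have pos: "?A\<^sup>2 + ?B\<^sup>2 > 0" by (simp add: sum_power2_gt_zero_iff)
  have c: "continuous_on UNIV (\<lambda>x. Re (a (cpair x)))" "continuous_on UNIV (\<lambda>x. Re (b (cpair x)))"
    by (intro continuous_intros continuous_on_compose2[OF ca] continuous_on_compose2[OF cb] continuous_on_cpair; simp)+
  obtain \<alpha> \<kappa> where \<alpha>: "\<kappa> \<noteq> 0" "\<alpha> 0 = x" "\<forall>\<^sub>F s in nhds 0. Re (g (cpair (\<alpha> s))) = 0"
    "(\<alpha> has_derivative (\<lambda>s. (s * (\<kappa> * ?B), - s * (\<kappa> * ?A)))) (at 0)"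
    using level_curve_tangent[OF has_partials_Re_cpair[OF g] c, of x] K(3)[OF x] \<open>?A \<noteq> 0 \<or> ?B \<noteq> 0\<close> by auto
  \<comment> \<open>Relative openness of \<open>K\<close> keeps the level curve
    \<open>\<alpha>\<close> in \<open>K\<close> for small parameters, where the maximum applies to
    it.\<close>
  obtain r' where r': "r' > 0" "\<And>y. y \<in> ball x r' \<Longrightarrow> g (cpair y) = 0 \<Longrightarrow> y \<in> K" using Kopen[OF x] by blast
  have "isCont \<alpha> 0" using has_derivative_continuous[OF \<alpha>(4)] .
  then have "(\<alpha> \<longlongrightarrow> \<alpha> 0) (nhds 0)" by (simp add: isCont_def tendsto_nhds_iff)
  then have "(\<alpha> \<longlongrightarrow> x) (nhds 0)" unfolding \<alpha>(2) .
  then have "\<forall>\<^sub>F s in nhds 0. dist (\<alpha> s) x < min r r'" using r(1) r'(1) by (intro tendstoD) auto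
  with \<alpha>(3) have "\<forall>\<^sub>F s in nhds 0. \<alpha> s \<in> K \<and> dist (\<alpha> s) x < r"
  proof eventually_elim
    case (elim s)
    then have "g (cpair (\<alpha> s)) = 0" using real(1) by (simp add: complex_eq_iff complex_is_Real_iff)
    then show ?case using elim r'(2)[of "\<alpha> s"] by (simp add: dist_commute)
  qed
  then obtain \<epsilon> where \<epsilon>: "\<epsilon> > 0" "\<And>s. dist s 0 < \<epsilon> \<Longrightarrow> \<alpha> s \<in> K \<and> dist (\<alpha> s) x < r"
    unfolding eventually_nhds_metric by blast
  define B where "B = ball (0::real) \<epsilon>"
  have \<alpha>B: "\<alpha> s \<in> K" "dist (\<alpha> s) x < r" if "s \<in> B" for s
    using that \<epsilon>(2)[of s] unfolding B_def by (auto simp: dist_commute)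
  have "((\<lambda>s. cpair (\<alpha> s)) has_derivative (\<lambda>s. cpair (s * (\<kappa> * ?B), - s * (\<kappa> * ?A)))) (at 0 within B)"
    by (rule has_derivative_at_withinI[OF has_derivative_compose[OF \<alpha>(4) cpair_has_derivative]])
  moreover have "(\<lambda>s. cpair (\<alpha> s)) ` B \<subseteq> {z. g z = 0}"
    by (rule image_subsetI) (simp add: K(3)[OF \<alpha>B(1)])
  then have "(\<Phi> x n has_derivative (\<lambda>v. b (cpair x) * fst v - a (cpair x) * snd v))
      (at (cpair (\<alpha> 0)) within (\<lambda>s. cpair (\<alpha> s)) ` B)"
    unfolding \<alpha>(2) by (rule has_derivative_subset[OF \<Phi>_deriv[OF x]])
  ultimately have "((\<lambda>s. \<Phi> x n (cpair (\<alpha> s))) has_derivative (\<lambda>s. b (cpair x) * fst (cpair (s * (\<kappa> * ?B), - s * (\<kappa> * ?A)))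
        - a (cpair x) * snd (cpair (s * (\<kappa> * ?B), - s * (\<kappa> * ?A))))) (at 0 within B)"
    by (rule has_derivative_in_compose)
  from bounded_linear.has_derivative[OF bounded_linear_Re this]
  have "((\<lambda>s. Re (\<Phi> x n (cpair (\<alpha> s)))) has_derivative (\<lambda>s. Re (b (cpair x) * fst (cpair (s * (\<kappa> * ?B), - s * (\<kappa> * ?A)))
        - a (cpair x) * snd (cpair (s * (\<kappa> * ?B), - s * (\<kappa> * ?A)))))) (at 0 within B)" .
  moreover have "Re (b (cpair x) * fst (cpair (s * (\<kappa> * ?B), - s * (\<kappa> * ?A)))
        - a (cpair x) * snd (cpair (s * (\<kappa> * ?B), - s * (\<kappa> * ?A)))) = \<kappa> * (?A\<^sup>2 + ?B\<^sup>2) * s" for s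
    by (simp add: cpair_def power2_eq_square algebra_simps)
  ultimately have "((\<lambda>s. Re (\<Phi> x n (cpair (\<alpha> s)))) has_derivative (\<lambda>s. \<kappa> * (?A\<^sup>2 + ?B\<^sup>2) * s)) (at 0 within B)"
    by simp
  moreover have "at 0 within B = at 0" using \<epsilon>(1) unfolding B_def by (intro at_within_open) auto
  ultimately have "DERIV (\<lambda>s. Re (\<Phi> x n (cpair (\<alpha> s)))) 0 :> \<kappa> * (?A\<^sup>2 + ?B\<^sup>2)"
    unfolding has_field_derivative_def by simp
  then have "\<kappa> * (?A\<^sup>2 + ?B\<^sup>2) = 0"
  proof (rule DERIV_local_max[OF _ \<epsilon>(1)])
    show "\<forall>s. \<bar>0 - s\<bar> < \<epsilon> \<longrightarrow> Re (\<Phi> x n (cpair (\<alpha> s))) \<le> Re (\<Phi> x n (cpair (\<alpha> 0)))"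
    proof (intro allI impI)
      fix s assume "\<bar>0 - s\<bar> < \<epsilon>"
      then have s: "s \<in> B" unfolding B_def by (simp add: dist_real_def)
      have "Re (H (\<alpha> s)) - Re (H x) = Re (\<Phi> x n (cpair (\<alpha> s))) - Re (\<Phi> x n (cpair x))"
        using arg_cong[OF r(2)[OF \<alpha>B[OF s]], of Re] by simp
      then show "Re (\<Phi> x n (cpair (\<alpha> s))) \<le> Re (\<Phi> x n (cpair (\<alpha> 0)))"
        using max[OF \<alpha>B(1)[OF s]] \<alpha>(2) by simp
    qed
  qed
  then show False using pos \<alpha>(1) by simp
qed

section \<open>Linear contractibility of cones over compact submanifolds\<close>

lemma inner_dist_le_of_lipschitz_path:
  assumes "path \<gamma>" "path_image \<gamma> \<subseteq> Z" "pathstart \<gamma> = x" "pathfinish \<gamma> = y"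
    and L: "0 \<le> L" "\<And>s t. s \<in> {0..1} \<Longrightarrow> t \<in> {0..1} \<Longrightarrow> d (\<gamma> s) (\<gamma> t) \<le> L * \<bar>s - t\<bar>"
  shows "inner_dist d Z x y \<le> ennreal L"
proof -
  have "curve_length d \<gamma> \<le> ennreal L"
    unfolding curve_length_def
  proof (rule SUP_least)
    fix nt :: "nat \<times> (nat \<Rightarrow> real)"
    assume nt: "nt \<in> {(n, t). t 0 = 0 \<and> t n = 1 \<and> mono_on {..n} t}"
    obtain n t where eq: "nt = (n, t)" by (cases nt)
    with nt have t: "t 0 = 0" "t n = 1" "mono_on {..n} t" by auto
    have mono: "t i \<le> t j" if "i \<le> j" "j \<le> n" for i j using t(3) that by (auto simp: mono_on_def)
    have t01: "t i \<in> {0..1}" if "i \<le> n" for i using mono[of 0 i] mono[of i n] that t by auto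
    have "(\<Sum>i<n. d (\<gamma> (t i)) (\<gamma> (t (Suc i)))) \<le> (\<Sum>i<n. L * (t (Suc i) - t i))"
    proof (rule sum_mono)
      fix i assume "i \<in> {..<n}"
      then have i: "i \<le> n" "Suc i \<le> n" by auto
      have "d (\<gamma> (t i)) (\<gamma> (t (Suc i))) \<le> L * \<bar>t i - t (Suc i)\<bar>" by (rule L(2)[OF t01[OF i(1)] t01[OF i(2)]])
      then show "d (\<gamma> (t i)) (\<gamma> (t (Suc i))) \<le> L * (t (Suc i) - t i)" using mono[of i "Suc i"] i by simp
    qed
    also have "\<dots> = L" using t by (simp add: sum_distrib_left[symmetric] sum_lessThan_telescope)
    finally show "(case nt of (n, t) \<Rightarrow> ennreal (\<Sum>i<n. d (\<gamma> (t i)) (\<gamma> (t (Suc i))))) \<le> ennreal L"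
      unfolding eq by (simp add: ennreal_leI)
  qed
  moreover from this have "curve_length d \<gamma> < \<infinity>" by (simp add: le_less_trans)
  ultimately show ?thesis
    unfolding inner_dist_def using assms(1-4) by (intro INF_lower2[of \<gamma>]) auto
qed

lemma dist_le_inner_dist: "ennreal (d x y) \<le> inner_dist d Z x y"
  unfolding inner_dist_def
proof (rule INF_greatest)
  fix \<gamma> assume "\<gamma> \<in> {\<gamma>. path \<gamma> \<and> path_image \<gamma> \<subseteq> Z \<and> pathstart \<gamma> = x \<and> pathfinish \<gamma> = y \<and> curve_length d \<gamma> < \<infinity>}"
  then have \<gamma>: "\<gamma> 0 = x" "\<gamma> 1 = y" by (auto simp: pathstart_def pathfinish_def)
  \<comment> \<open>The partition with the single interval from 0 to 1, enumerated by
    \<open>real\<close>.\<close>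
  have "mono_on {..1} real" by (auto simp: mono_on_def)
  then show "ennreal (d x y) \<le> curve_length d \<gamma>"
    unfolding curve_length_def using \<gamma> by (intro SUP_upper2[of "(1, real)"]) auto
qed

lemma euclid_dist_nonneg [simp]: "0 \<le> euclid_dist m x y"
  by (simp add: euclid_dist_def)

lemma euclid_dist_same [simp]: "euclid_dist m x x = 0"
  by (simp add: euclid_dist_def L2_set_def)

lemma euclid_dist_commute: "euclid_dist m x y = euclid_dist m y x"
  by (simp add: euclid_dist_def L2_set_def power2_commute)

lemma euclid_dist_triangle: "euclid_dist m x z \<le> euclid_dist m x y + euclid_dist m y z"
  using L2_set_triangle_ineq[of "\<lambda>i. x i - y i" "\<lambda>i. y i - z i" "{..<m}"] by (simp add: euclid_dist_def)

lemma coord_le_euclid_dist: "i < m \<Longrightarrow> \<bar>x i - y i\<bar> \<le> euclid_dist m x y"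
proof -
  assume i: "i < m"
  have "\<bar>x i - y i\<bar> = sqrt ((x i - y i)\<^sup>2)" by simp
  also have "\<dots> \<le> euclid_dist m x y"
    unfolding euclid_dist_def L2_set_def using i
    by (intro real_sqrt_le_mono member_le_sum) auto
  finally show ?thesis .
qed

lemma euclid_dist_le_sum: "euclid_dist m x y \<le> (\<Sum>i<m. \<bar>x i - y i\<bar>)"
  unfolding euclid_dist_def by (rule L2_set_le_sum_abs)

lemma euclid_dist_scale: "euclid_dist m (\<lambda>i. s * x i) (\<lambda>i. s * y i) = \<bar>s\<bar> * euclid_dist m x y"
  unfolding euclid_dist_def
  using L2_set_right_distrib[of "\<bar>s\<bar>" "\<lambda>i. x i - y i" "{..<m}"]
  by (simp add: right_diff_distrib[symmetric] L2_set_def power_mult_distrib)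

lemma euclid_dist_scale_diff: "euclid_dist m (\<lambda>i. s * x i) (\<lambda>i. t * x i) = \<bar>s - t\<bar> * euclid_dist m x (\<lambda>i. 0)"
  using L2_set_right_distrib[of "\<bar>s - t\<bar>" x "{..<m}"]
  by (simp add: euclid_dist_def left_diff_distrib[symmetric] L2_set_def power_mult_distrib)

lemma euclid_dist_convex:
  assumes "0 \<le> t" "t \<le> 1"
  shows "euclid_dist m q (\<lambda>i. (1 - t) * x i + t * y i) \<le> (1 - t) * euclid_dist m q x + t * euclid_dist m q y"
proof -
  have "euclid_dist m q (\<lambda>i. (1 - t) * x i + t * y i) =
      L2_set (\<lambda>i. (1 - t) * (q i - x i) + t * (q i - y i)) {..<m}"
    unfolding euclid_dist_def by (rule arg_cong2[where f=L2_set]) (auto simp: algebra_simps)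
  also have "\<dots> \<le> L2_set (\<lambda>i. (1 - t) * (q i - x i)) {..<m} + L2_set (\<lambda>i. t * (q i - y i)) {..<m}"
    by (rule L2_set_triangle_ineq)
  also have "\<dots> = (1 - t) * euclid_dist m q x + t * euclid_dist m q y"
    unfolding euclid_dist_def using assms by (simp add: L2_set_right_distrib)
  finally show ?thesis .
qed

lemma euclid_dist_segment:
  "euclid_dist m (\<lambda>i. (1 - s) * x i + s * y i) (\<lambda>i. (1 - t) * x i + t * y i) = \<bar>s - t\<bar> * euclid_dist m x y"
proof -
  have "euclid_dist m (\<lambda>i. (1 - s) * x i + s * y i) (\<lambda>i. (1 - t) * x i + t * y i) =
      L2_set (\<lambda>i. (t - s) * (x i - y i)) {..<m}"
    unfolding euclid_dist_def by (rule arg_cong2[where f=L2_set]) (auto simp: algebra_simps)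
  also have "\<dots> = \<bar>s - t\<bar> * euclid_dist m x y"
    using L2_set_right_distrib[of "\<bar>s - t\<bar>" "\<lambda>i. x i - y i" "{..<m}"]
    by (simp add: euclid_dist_def L2_set_def power_mult_distrib power2_commute)
  finally show ?thesis .
qed

lemma continuous_on_euclid_dist:
  assumes "continuous_on A f" "continuous_on A g"
  shows "continuous_on A (\<lambda>p. euclid_dist m (f p) (g p))"
  unfolding euclid_dist_def L2_set_def
  using continuous_on_product_then_coordinatewise[OF assms(1)] continuous_on_product_then_coordinatewise[OF assms(2)]
  by (intro continuous_on_real_sqrt continuous_on_sum continuous_on_power continuous_on_diff)

lemma openin_Euclidean_space_contains_ball:
  assumes "openin (Euclidean_space m) U" "p \<in> U"
  shows "\<exists>r>0. \<forall>x\<in>Rn m. euclid_dist m p x < r \<longrightarrow> x \<in> U"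
proof -
  interpret M: Metric_space "Rn m" "euclid_dist m" by (rule Metric_space_euclid_dist)
  have "openin M.mtopology U" using assms(1) by (simp only: mtopology_euclid_dist)
  then obtain r where "r > 0" "M.mball p r \<subseteq> U" "p \<in> Rn m"
    using assms(2) unfolding M.openin_mtopology by blast
  then have "\<forall>x\<in>Rn m. euclid_dist m p x < r \<longrightarrow> x \<in> U" unfolding M.mball_def by blast
  then show ?thesis using \<open>r > 0\<close> by blast
qed

section \<open>Local Lipschitz estimates for smooth maps\<close>

text \<open>\<open>C_k\<close> speaks only of partial derivatives, so \<open>x\<close> is changed
  into \<open>y\<close> one coordinate at a time and the mean value inequality is applied to each
  move.\<close>

lemma C_1_locally_lipschitz:
  assumes U: "openin (Euclidean_space m) U" "p \<in> U" and g: "C_k m 1 U g"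
  shows "\<exists>r>0. \<exists>L\<ge>0. \<forall>x\<in>Rn m. \<forall>y\<in>Rn m. euclid_dist m p x < r \<longrightarrow> euclid_dist m p y < r \<longrightarrow>
    \<bar>g x - g y\<bar> \<le> L * euclid_dist m x y"
proof -
  have "\<forall>i<m. \<exists>g'. (\<forall>x\<in>U. ((\<lambda>t. g (x(i := t))) has_real_derivative g' x) (at (x i))) \<and> continuous_on U g'"
    using g by (simp add: eval_nat_numeral)
  then obtain g' where g': "\<And>i x. i < m \<Longrightarrow> x \<in> U \<Longrightarrow> ((\<lambda>t. g (x(i := t))) has_real_derivative g' i x) (at (x i))"
    and cont: "\<And>i. i < m \<Longrightarrow> continuous_on U (g' i)" by metis
  have pR: "p \<in> Rn m" using openin_subset[OF U(1)] U(2) by auto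
  \<comment> \<open>Where \<open>G < 1\<close>, each partial derivative is within 1 of its value at
    \<open>p\<close> and hence bounded by the constant \<open>B\<close> below.\<close>
  define G where "G = (\<lambda>x. \<Sum>i<m. \<bar>g' i x - g' i p\<bar>)"
  have "continuous_on U G"
    unfolding G_def using cont by (intro continuous_on_sum continuous_on_rabs continuous_on_diff continuous_on_const) auto
  then have "openin (top_of_set U) (U \<inter> G -` {..<1})"
    by (rule continuous_openin_preimage_gen) simp
  moreover have "openin (top_of_set (Rn m)) U" using U(1) Euclidean_space_eq_top_of_set[of m] by metis
  ultimately have "openin (top_of_set (Rn m)) (U \<inter> G -` {..<1})" by (rule openin_trans)
  then have "openin (Euclidean_space m) (U \<inter> G -` {..<1})" using Euclidean_space_eq_top_of_set[of m] by metis
  moreover have "p \<in> U \<inter> G -` {..<1}" using U(2) by (simp add: G_def)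
  ultimately obtain r where "r > 0" and *: "\<forall>x\<in>Rn m. euclid_dist m p x < r \<longrightarrow> x \<in> U \<inter> G -` {..<1}"
    using openin_Euclidean_space_contains_ball by blast
  then have r: "r > 0" "\<And>x. x \<in> Rn m \<Longrightarrow> euclid_dist m p x < r \<Longrightarrow> x \<in> U \<and> G x < 1" by blast+
  define B where "B = (\<Sum>i<m. \<bar>g' i p\<bar>) + 1"
  have B: "B \<ge> 0" unfolding B_def by (simp add: sum_nonneg add_nonneg_nonneg)
  have g'B: "\<bar>g' i x\<bar> \<le> B" if "i < m" "G x < 1" for i x
  proof -
    have "\<bar>g' i x - g' i p\<bar> \<le> G x" unfolding G_def using that(1)
      by (intro member_le_sum[of i _ "\<lambda>i. \<bar>g' i x - g' i p\<bar>"]) auto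
    moreover have "\<bar>g' i p\<bar> \<le> (\<Sum>i<m. \<bar>g' i p\<bar>)" using that(1)
      by (intro member_le_sum[of i _ "\<lambda>i. \<bar>g' i p\<bar>"]) auto
    ultimately show ?thesis using that(2) unfolding B_def by linarith
  qed
  have "\<bar>g x - g y\<bar> \<le> (B * real m) * euclid_dist m x y"
    if xy: "x \<in> Rn m" "y \<in> Rn m" "euclid_dist m p x < r / 2" "euclid_dist m p y < r / 2" for x y
  proof -
    \<comment> \<open>The first \<open>k\<close> coordinates are already those of \<open>y\<close>.
      Each point on the way deviates from \<open>p\<close> by no more than the deviations of
      \<open>x\<close> and \<open>y\<close> together, which explains the radius
      \<open>r / 2\<close>.\<close>
    define z where "z = (\<lambda>k j. if j < k then y j else x j)"
    have near: "w \<in> U \<and> G w < 1" if w: "\<And>j. \<bar>p j - w j\<bar> \<le> \<bar>p j - x j\<bar> + \<bar>p j - y j\<bar>" for w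
    proof (rule r(2))
      have "w j = 0" if "j \<ge> m" for j
        using w[of j] that xy(1,2) pR by (simp add: topspace_Euclidean_space)
      then show "w \<in> Rn m" by (simp add: topspace_Euclidean_space)
      have "euclid_dist m p w = L2_set (\<lambda>j. \<bar>p j - w j\<bar>) {..<m}" by (simp add: euclid_dist_def L2_set_def)
      also have "\<dots> \<le> L2_set (\<lambda>j. \<bar>p j - x j\<bar> + \<bar>p j - y j\<bar>) {..<m}" using w by (intro L2_set_mono) auto
      also have "\<dots> \<le> L2_set (\<lambda>j. \<bar>p j - x j\<bar>) {..<m} + L2_set (\<lambda>j. \<bar>p j - y j\<bar>) {..<m}"
        by (rule L2_set_triangle_ineq)
      also have "\<dots> = euclid_dist m p x + euclid_dist m p y" by (simp add: euclid_dist_def L2_set_def)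
      finally show "euclid_dist m p w < r" using xy by linarith
    qed
    have step: "\<bar>g (z (Suc k)) - g (z k)\<bar> \<le> B * \<bar>y k - x k\<bar>" if k: "k < m" for k
    proof -
      define \<phi> where "\<phi> = (\<lambda>t. g ((z k)(k := t)))"
      have w: "(z k)(k := t) \<in> U \<and> G ((z k)(k := t)) < 1" if t: "t \<in> closed_segment (x k) (y k)" for t
      proof (rule near)
        have "\<bar>p k - t\<bar> \<le> \<bar>p k - x k\<bar> + \<bar>p k - y k\<bar>"
          using t unfolding closed_segment_eq_real_ivl by (auto split: if_splits)
        then show "\<bar>p j - ((z k)(k := t)) j\<bar> \<le> \<bar>p j - x j\<bar> + \<bar>p j - y j\<bar>" for j
          by (simp add: z_def)
      qed
      have "norm (\<phi> (y k) - \<phi> (x k)) \<le> B * norm (y k - x k)"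
      proof (rule field_differentiable_bound)
        show "convex (closed_segment (x k) (y k))" by simp
        fix t assume t: "t \<in> closed_segment (x k) (y k)"
        have "(\<phi> has_real_derivative g' k ((z k)(k := t))) (at t)"
          using g'[OF k, of "(z k)(k := t)"] w[OF t] unfolding \<phi>_def by simp
        then show "(\<phi> has_real_derivative g' k ((z k)(k := t))) (at t within closed_segment (x k) (y k))"
          by (rule has_field_derivative_at_within)
        show "norm (g' k ((z k)(k := t))) \<le> B" using g'B[OF k] w[OF t] by simp
      qed auto
      moreover have "(z k)(k := y k) = z (Suc k)" "(z k)(k := x k) = z k"
        by (auto simp: z_def fun_eq_iff less_Suc_eq)
      ultimately show ?thesis unfolding \<phi>_def by simp
    qed
    have "\<bar>g (z k) - g (z 0)\<bar> \<le> (\<Sum>j<k. B * \<bar>y j - x j\<bar>)" if "k \<le> m" for k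
      using that
    proof (induction k)
      case (Suc k)
      then show ?case using step[of k] by simp
    qed simp
    from this[of m] have "\<bar>g (z m) - g (z 0)\<bar> \<le> (\<Sum>j<m. B * \<bar>y j - x j\<bar>)" by simp
    also have "\<dots> \<le> (\<Sum>j<m. B * euclid_dist m x y)"
      using coord_le_euclid_dist[of _ m x y] B by (intro sum_mono mult_left_mono) (auto simp: abs_minus_commute)
    finally have "\<bar>g (z m) - g (z 0)\<bar> \<le> (B * real m) * euclid_dist m x y" by (simp add: mult_ac)
    moreover have "z 0 = x" "z m = y"
      using xy(1,2) by (auto simp: z_def fun_eq_iff topspace_Euclidean_space)
    ultimately show ?thesis by (simp add: abs_minus_commute)
  qed
  moreover have "r / 2 > 0" "B * real m \<ge> 0" using r(1) B by auto
  ultimately show ?thesis by blast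
qed

lemma smooth_map_locally_lipschitz:
  assumes U: "openin (Euclidean_space m) U" "p \<in> U" and F: "smooth_map m U F"
  shows "\<exists>r>0. \<exists>L\<ge>0. \<forall>x\<in>Rn m. \<forall>y\<in>Rn m. euclid_dist m p x < r \<longrightarrow> euclid_dist m p y < r \<longrightarrow>
    x \<in> U \<and> euclid_dist m (F x) (F y) \<le> L * euclid_dist m x y"
proof -
  obtain r0 where r0: "r0 > 0" "\<And>x. x \<in> Rn m \<Longrightarrow> euclid_dist m p x < r0 \<Longrightarrow> x \<in> U"
    using openin_Euclidean_space_contains_ball[OF U] by blast
  have "\<forall>j<m. \<exists>r L. r > 0 \<and> L \<ge> 0 \<and> (\<forall>x\<in>Rn m. \<forall>y\<in>Rn m. euclid_dist m p x < r \<longrightarrow> euclid_dist m p y < r \<longrightarrow>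
    \<bar>F x j - F y j\<bar> \<le> L * euclid_dist m x y)"
    using C_1_locally_lipschitz[OF U] F unfolding smooth_map_def by meson
  then obtain r L where rL: "\<And>j. j < m \<Longrightarrow> r j > 0" "\<And>j. j < m \<Longrightarrow> L j \<ge> 0"
    "\<And>j x y. j < m \<Longrightarrow> x \<in> Rn m \<Longrightarrow> y \<in> Rn m \<Longrightarrow> euclid_dist m p x < r j \<Longrightarrow> euclid_dist m p y < r j \<Longrightarrow>
      \<bar>F x j - F y j\<bar> \<le> L j * euclid_dist m x y" by metis
  define R where "R = Min (insert r0 (r ` {..<m}))"
  have R: "R > 0" "R \<le> r0" "\<And>j. j < m \<Longrightarrow> R \<le> r j" unfolding R_def using r0(1) rL(1) by auto
  have "euclid_dist m (F x) (F y) \<le> (\<Sum>j<m. L j) * euclid_dist m x y"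
    if xy: "x \<in> Rn m" "y \<in> Rn m" "euclid_dist m p x < R" "euclid_dist m p y < R" for x y
  proof -
    have "euclid_dist m (F x) (F y) \<le> (\<Sum>j<m. \<bar>F x j - F y j\<bar>)" by (rule euclid_dist_le_sum)
    also have "\<dots> \<le> (\<Sum>j<m. L j * euclid_dist m x y)"
    proof (rule sum_mono)
      fix j assume "j \<in> {..<m}"
      then have "j < m" by simp
      then show "\<bar>F x j - F y j\<bar> \<le> L j * euclid_dist m x y"
        using rL(3)[OF _ xy(1,2)] R(3) xy(3,4) by (meson less_le_trans)
    qed
    finally show ?thesis by (simp add: sum_distrib_right)
  qed
  moreover have "(\<Sum>j<m. L j) \<ge> 0" by (rule sum_nonneg) (simp add: rL(2))
  moreover have "x \<in> U" if "x \<in> Rn m" "euclid_dist m p x < R" for x using r0(2) R(2) that by simp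
  ultimately show ?thesis using R(1) by blast
qed

section \<open>Contractions with linearly controlled tracks\<close>

text \<open>The speed of each track is bounded by a multiple of the distance of its endpoints. This
  bound is invariant under scaling, so it survives at every distance from the apex of a
  cone.\<close>

definition contracts_to ::
  "nat \<Rightarrow> (nat \<Rightarrow> real) set \<Rightarrow> real \<Rightarrow> (nat \<Rightarrow> real) set \<Rightarrow> (nat \<Rightarrow> real) \<Rightarrow>
   ((nat \<Rightarrow> real) \<times> real \<Rightarrow> nat \<Rightarrow> real) \<Rightarrow> bool" where
  "contracts_to m N L A p \<Gamma> \<longleftrightarrow> continuous_on (A \<times> {0..1}) \<Gamma> \<and>
     (\<forall>y\<in>A. \<Gamma> (y, 0) = p \<and> \<Gamma> (y, 1) = y \<and> (\<forall>t\<in>{0..1}. \<Gamma> (y, t) \<in> N) \<and>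
        (\<forall>s\<in>{0..1}. \<forall>t\<in>{0..1}. euclid_dist m (\<Gamma> (y, s)) (\<Gamma> (y, t)) \<le> L * euclid_dist m p y * \<bar>s - t\<bar>))"

lemma contracts_to_mono:
  assumes "contracts_to m N L A p \<Gamma>" "B \<subseteq> A" "L \<le> L'"
  shows "contracts_to m N L' B p \<Gamma>"
  unfolding contracts_to_def
proof (intro conjI ballI)
  show "continuous_on (B \<times> {0..1}) \<Gamma>"
    using assms(1,2) unfolding contracts_to_def by (blast intro: continuous_on_subset Sigma_mono)
next
  fix y :: "nat \<Rightarrow> real" and s t :: real
  assume *: "y \<in> B" "s \<in> {0..1}" "t \<in> {0..1}"
  then have "euclid_dist m (\<Gamma> (y, s)) (\<Gamma> (y, t)) \<le> L * euclid_dist m p y * \<bar>s - t\<bar>"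
    using assms(1,2) unfolding contracts_to_def by blast
  also have "\<dots> \<le> L' * euclid_dist m p y * \<bar>s - t\<bar>" using assms(3) by (intro mult_right_mono) auto
  finally show "euclid_dist m (\<Gamma> (y, s)) (\<Gamma> (y, t)) \<le> L' * euclid_dist m p y * \<bar>s - t\<bar>" .
qed (use assms in \<open>auto simp: contracts_to_def subset_iff\<close>)

text \<open>In a slice chart \<open>N\<close> is a piece of \<open>Rn k\<close>, where straight
  segments do the contraction; both chart maps are Lipschitz, which gives the constant
  \<open>L1 * L2\<close>.\<close>

lemma smooth_submanifold_local_contraction:
  assumes N: "smooth_submanifold m k N" and p0: "p0 \<in> N"
  shows "\<exists>s>0. \<exists>L\<ge>0. \<forall>p\<in>N. euclid_dist m p0 p < s \<longrightarrow>
    (\<exists>\<Gamma>. contracts_to m N L {y\<in>N. euclid_dist m p0 y < s} p \<Gamma>)"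
proof -
  have km: "k \<le> m" and NR: "N \<subseteq> Rn m" using N unfolding smooth_submanifold_def by auto
  obtain U V \<phi> \<psi> where U: "openin (Euclidean_space m) U" "p0 \<in> U" and V: "openin (Euclidean_space m) V"
    and hom: "homeomorphism U V \<phi> \<psi>" and sm: "smooth_map m U \<phi>" "smooth_map m V \<psi>"
    and slice: "\<phi> ` (N \<inter> U) = V \<inter> Rn k"
    using N p0 unfolding smooth_submanifold_def by blast
  have "\<phi> p0 \<in> V" using hom U(2) unfolding homeomorphism_def by blast
  obtain r1 L1 where r1: "r1 > 0" "L1 \<ge> 0" "\<And>x y. x \<in> Rn m \<Longrightarrow> y \<in> Rn m \<Longrightarrow> euclid_dist m (\<phi> p0) x < r1 \<Longrightarrow>
      euclid_dist m (\<phi> p0) y < r1 \<Longrightarrow> x \<in> V \<and> euclid_dist m (\<psi> x) (\<psi> y) \<le> L1 * euclid_dist m x y"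
    using smooth_map_locally_lipschitz[OF V \<open>\<phi> p0 \<in> V\<close> sm(2)] by blast
  obtain r2 L2 where r2: "r2 > 0" "L2 \<ge> 0" "\<And>x y. x \<in> Rn m \<Longrightarrow> y \<in> Rn m \<Longrightarrow> euclid_dist m p0 x < r2 \<Longrightarrow>
      euclid_dist m p0 y < r2 \<Longrightarrow> x \<in> U \<and> euclid_dist m (\<phi> x) (\<phi> y) \<le> L2 * euclid_dist m x y"
    using smooth_map_locally_lipschitz[OF U sm(1)] by blast
  \<comment> \<open>Forces the images under \<open>\<phi>\<close> into the ball on which
    \<open>\<psi>\<close> is Lipschitz; the added 1 covers \<open>L2 = 0\<close>.\<close>
  define s where "s = min r2 (r1 / (L2 + 1))"
  have s: "s > 0" unfolding s_def using r1 r2 by simp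
  define A where "A = {y\<in>N. euclid_dist m p0 y < s}"
  have A: "y \<in> Rn m" "y \<in> U" "\<phi> y \<in> V" "\<phi> y \<in> Rn k" "\<phi> y \<in> Rn m" "\<psi> (\<phi> y) = y"
    "euclid_dist m (\<phi> p0) (\<phi> y) < r1" if y: "y \<in> A" for y
  proof -
    show yR: "y \<in> Rn m" using y NR unfolding A_def by blast
    have p0R: "p0 \<in> Rn m" using p0 NR by blast
    have d: "euclid_dist m p0 y < r2" "euclid_dist m p0 y < r1 / (L2 + 1)" using y unfolding A_def s_def by auto
    have *: "y \<in> U \<and> euclid_dist m (\<phi> p0) (\<phi> y) \<le> L2 * euclid_dist m p0 y"
      using r2(3)[OF yR yR d(1) d(1)] r2(3)[OF p0R yR _ d(1)] r2(1) by simp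
    then show yU: "y \<in> U" by simp
    then have "\<phi> y \<in> V \<inter> Rn k" using slice y unfolding A_def by blast
    then show "\<phi> y \<in> V" "\<phi> y \<in> Rn k" by auto
    then show "\<phi> y \<in> Rn m" using openin_subset[OF V] by auto
    show "\<psi> (\<phi> y) = y" using hom yU unfolding homeomorphism_def by blast
    have "L2 * euclid_dist m p0 y \<le> (L2 + 1) * euclid_dist m p0 y" by (simp add: mult_right_mono)
    also have "\<dots> < r1" using d(2) r2(2) by (simp add: less_divide_eq mult.commute)
    finally show "euclid_dist m (\<phi> p0) (\<phi> y) < r1" using * by linarith
  qed
  have "\<exists>\<Gamma>. contracts_to m N (L1 * L2) A p \<Gamma>" if "p \<in> N" "euclid_dist m p0 p < s" for p
  proof -
    have p: "p \<in> A" using that unfolding A_def by simp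
    define \<sigma> where "\<sigma> = (\<lambda>(y, t). (\<lambda>i. (1 - t) * \<phi> p i + t * \<phi> y i))"
    have \<sigma>: "\<sigma> (y, t) \<in> V \<inter> Rn k" "\<sigma> (y, t) \<in> Rn m" "euclid_dist m (\<phi> p0) (\<sigma> (y, t)) < r1"
      if y: "y \<in> A" and t: "t \<in> {0..1}" for y t
    proof -
      have "euclid_dist m (\<phi> p0) (\<sigma> (y, t)) \<le> (1 - t) * euclid_dist m (\<phi> p0) (\<phi> p) + t * euclid_dist m (\<phi> p0) (\<phi> y)"
        unfolding \<sigma>_def using t by (simp add: euclid_dist_convex)
      also have "\<dots> < r1" using A(7)[OF p] A(7)[OF y] t by (intro convex_bound_lt) auto
      finally show d: "euclid_dist m (\<phi> p0) (\<sigma> (y, t)) < r1" .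
      show R: "\<sigma> (y, t) \<in> Rn m"
        using A(5)[OF p] A(5)[OF y] unfolding \<sigma>_def by (simp add: topspace_Euclidean_space)
      have "\<sigma> (y, t) \<in> Rn k"
        using A(4)[OF p] A(4)[OF y] unfolding \<sigma>_def by (simp add: topspace_Euclidean_space)
      then show "\<sigma> (y, t) \<in> V \<inter> Rn k" using r1(3)[OF R R d d] by blast
    qed
    have "continuous_on (A \<times> {0..1}) (\<lambda>q. \<phi> (fst q))"
      using hom A(2) unfolding homeomorphism_def
      by (auto intro!: continuous_on_compose2[of U \<phi>] continuous_on_fst continuous_on_id)
    from continuous_on_product_then_coordinatewise[OF this]
    have "continuous_on (A \<times> {0..1}) \<sigma>"
      unfolding \<sigma>_def case_prod_beta by (intro continuous_on_coordinatewise_then_product continuous_intros)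
    then have \<Gamma>1: "continuous_on (A \<times> {0..1}) (\<lambda>q. \<psi> (\<sigma> q))"
      using hom \<sigma>(1) unfolding homeomorphism_def by (auto intro!: continuous_on_compose2[of V \<psi>])
    have \<Gamma>2: "\<psi> (\<sigma> (y, 0)) = p" "\<psi> (\<sigma> (y, 1)) = y" if "y \<in> A" for y
      using A(6)[OF p] A(6)[OF that] by (simp_all add: \<sigma>_def)
    have \<Gamma>3: "\<psi> (\<sigma> (y, t)) \<in> N" if y: "y \<in> A" "t \<in> {0..1}" for y t
    proof -
      obtain x where "x \<in> N \<inter> U" "\<sigma> (y, t) = \<phi> x" using \<sigma>(1)[OF y] slice by blast
      then show ?thesis using hom unfolding homeomorphism_def by auto
    qed
    have \<Gamma>4: "euclid_dist m (\<psi> (\<sigma> (y, s))) (\<psi> (\<sigma> (y, t))) \<le> L1 * L2 * euclid_dist m p y * \<bar>s - t\<bar>"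
      if y: "y \<in> A" and st: "s \<in> {0..1}" "t \<in> {0..1}" for y s t
    proof -
      have "euclid_dist m (\<psi> (\<sigma> (y, s))) (\<psi> (\<sigma> (y, t))) \<le> L1 * euclid_dist m (\<sigma> (y, s)) (\<sigma> (y, t))"
        using r1(3) \<sigma>[OF y st(1)] \<sigma>[OF y st(2)] by blast
      also have "euclid_dist m (\<sigma> (y, s)) (\<sigma> (y, t)) = \<bar>s - t\<bar> * euclid_dist m (\<phi> p) (\<phi> y)"
        unfolding \<sigma>_def by (simp add: euclid_dist_segment)
      also have "L1 * (\<bar>s - t\<bar> * euclid_dist m (\<phi> p) (\<phi> y)) \<le> L1 * (\<bar>s - t\<bar> * (L2 * euclid_dist m p y))"
        using r2(3)[of p y] p y A(1) r1(2) unfolding A_def s_def by (intro mult_left_mono) auto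
      finally show ?thesis by (simp add: mult_ac)
    qed
    have "contracts_to m N (L1 * L2) A p (\<lambda>q. \<psi> (\<sigma> q))"
      unfolding contracts_to_def by (intro conjI ballI \<Gamma>1 \<Gamma>2 \<Gamma>3 \<Gamma>4)
    then show ?thesis by blast
  qed
  then have "\<forall>p\<in>N. euclid_dist m p0 p < s \<longrightarrow> (\<exists>\<Gamma>. contracts_to m N (L1 * L2) {y\<in>N. euclid_dist m p0 y < s} p \<Gamma>)"
    unfolding A_def by (intro ballI impI)
  moreover have "L1 * L2 \<ge> 0" using r1(2) r2(2) by simp
  ultimately show ?thesis using s by (intro exI[of _ s] exI[of _ "L1 * L2"] conjI)
qed

text \<open>A Lebesgue number argument: local radii are halved so that the
  \<open>\<eta>\<close>-ball about any point of \<open>N\<close> fits into one of finitely many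
  local sets. The sum of the local constants serves as a common bound.\<close>

lemma compact_submanifold_uniform_contraction:
  assumes N: "smooth_submanifold m k N" "compact N"
  shows "\<exists>\<eta>>0. \<exists>L\<ge>0. \<forall>p\<in>N. \<exists>\<Gamma>. contracts_to m N L {y\<in>N. euclid_dist m p y < \<eta>} p \<Gamma>"
proof -
  define P where "P = (\<lambda>q s L. s > 0 \<and> L \<ge> 0 \<and> (\<forall>p\<in>N. euclid_dist m q p < s \<longrightarrow>
    (\<exists>\<Gamma>. contracts_to m N L {y\<in>N. euclid_dist m q y < s} p \<Gamma>)))"
  have "\<exists>s L. P q s L" if "q \<in> N" for q
    using smooth_submanifold_local_contraction[OF N(1) that] unfolding P_def by blast
  then obtain s L where P: "\<And>q. q \<in> N \<Longrightarrow> P q (s q) (L q)" by metis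
  have sL: "s q > 0" "L q \<ge> 0" "\<And>p. p \<in> N \<Longrightarrow> euclid_dist m q p < s q \<Longrightarrow>
      \<exists>\<Gamma>. contracts_to m N (L q) {y\<in>N. euclid_dist m q y < s q} p \<Gamma>" if "q \<in> N" for q
    using P[OF that] unfolding P_def by blast+
  define W where "W = (\<lambda>q. {x. euclid_dist m q x < s q / 2})"
  have "open (W q)" for q
    unfolding W_def
    by (intro open_Collect_less continuous_on_euclid_dist continuous_on_const continuous_on_id)
  moreover have "N \<subseteq> (\<Union>q\<in>N. W q)"
  proof
    fix q assume "q \<in> N"
    then show "q \<in> (\<Union>q\<in>N. W q)" using sL(1)[of q] by (intro UN_I[of q]) (simp_all add: W_def)
  qed
  ultimately obtain Q where Q: "Q \<subseteq> N" "finite Q" "N \<subseteq> (\<Union>q\<in>Q. W q)"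
    using compactE_image[OF N(2)] by metis
  \<comment> \<open>The inserted 1 gives \<open>Min\<close> a value also when \<open>Q\<close> is
    empty.\<close>
  define \<eta> where "\<eta> = Min (insert 1 ((\<lambda>q. s q / 2) ` Q))"
  have \<eta>1: "\<eta> > 0" unfolding \<eta>_def using Q(1,2) sL(1) by (auto simp: subset_iff)
  have \<eta>2: "\<eta> \<le> s q / 2" if "q \<in> Q" for q
    unfolding \<eta>_def using Q(2) that by (intro Min_le) auto
  note \<eta> = \<eta>1 \<eta>2
  have LQ: "0 \<le> L q" if "q \<in> Q" for q using that Q(1) sL(2) by blast
  have "\<exists>\<Gamma>. contracts_to m N (\<Sum>q\<in>Q. L q) {y\<in>N. euclid_dist m p y < \<eta>} p \<Gamma>" if p: "p \<in> N" for p
  proof -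
    obtain q where q: "q \<in> Q" "euclid_dist m q p < s q / 2" using Q(3) p unfolding W_def by auto
    have qN: "q \<in> N" using q(1) Q(1) by blast
    have "euclid_dist m q p < s q" using q(2) sL(1)[OF qN] by linarith
    then obtain \<Gamma> where \<Gamma>: "contracts_to m N (L q) {y\<in>N. euclid_dist m q y < s q} p \<Gamma>"
      using sL(3)[OF qN p] by blast
    have "{y\<in>N. euclid_dist m p y < \<eta>} \<subseteq> {y\<in>N. euclid_dist m q y < s q}"
    proof clarify
      fix y assume "euclid_dist m p y < \<eta>"
      then show "euclid_dist m q y < s q"
        using euclid_dist_triangle[of m q y p] q(2) \<eta>(2)[OF q(1)] by linarith
    qed
    moreover have "L q \<le> (\<Sum>q\<in>Q. L q)" using q(1) Q(2) LQ by (intro member_le_sum) auto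
    ultimately show ?thesis using contracts_to_mono[OF \<Gamma>] by blast
  qed
  moreover have "(\<Sum>q\<in>Q. L q) \<ge> 0" using LQ by (rule sum_nonneg)
  ultimately show ?thesis using \<eta>(1) by blast
qed

section \<open>Cones over subsets of the unit sphere\<close>

lemma norm_cone_over:
  assumes "N \<subseteq> unit_sphere m" "y \<in> N" "0 \<le> s"
  shows "euclid_dist m (\<lambda>i. s * y i) (\<lambda>i. 0) = s"
  using euclid_dist_scale_diff[of m s y 0] assms by (auto simp: unit_sphere_def)

lemma cone_over_cases:
  assumes N: "N \<subseteq> unit_sphere m" and z: "z \<in> cone_over N" and pos: "euclid_dist m z (\<lambda>i. 0) > 0"
  shows "euclid_dist m z (\<lambda>i. 0) \<le> 1" "(\<lambda>i. 1 / euclid_dist m z (\<lambda>i. 0) * z i) \<in> N"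
proof -
  obtain s y where sy: "z = (\<lambda>i. s * y i)" "0 \<le> s" "s \<le> 1" "y \<in> N"
    using z unfolding cone_over_def by auto
  have s: "euclid_dist m z (\<lambda>i. 0) = s" unfolding sy(1) by (rule norm_cone_over[OF N sy(4,2)])
  then show "euclid_dist m z (\<lambda>i. 0) \<le> 1" using sy(3) by simp
  have "(\<lambda>i. 1 / s * z i) = y" using s pos unfolding sy(1) by (simp add: fun_eq_iff)
  then show "(\<lambda>i. 1 / euclid_dist m z (\<lambda>i. 0) * z i) \<in> N" using s sy(4) by simp
qed

text \<open>The base is cut out of the cone by the closed condition of having norm 1. Compactness of
  the cone itself will come from the homeomorphism with a compact piece of \<open>X\<close>.\<close>

lemma compact_cone_base:
  assumes N: "N \<subseteq> unit_sphere m" and cpt: "compact (cone_over N)"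
  shows "compact N"
proof -
  have "N = cone_over N \<inter> {x. euclid_dist m x (\<lambda>i. 0) = 1}"
  proof
    show "N \<subseteq> cone_over N \<inter> {x. euclid_dist m x (\<lambda>i. 0) = 1}"
      using N by (force simp: cone_over_def unit_sphere_def intro: exI[of _ 1])
    show "cone_over N \<inter> {x. euclid_dist m x (\<lambda>i. 0) = 1} \<subseteq> N"
      using cone_over_cases(2)[OF N] by force
  qed
  moreover have "closed {x. euclid_dist m x (\<lambda>i. 0) = 1}"
    by (intro closed_Collect_eq continuous_on_euclid_dist continuous_on_const continuous_on_id)
  ultimately show ?thesis using cpt compact_Int_closed by metis
qed

text \<open>In polar coordinates the radius is interpolated linearly and the direction is moved by a
  contraction in \<open>N\<close>. Points within \<open>\<delta>\<close> of \<open>z\<close> have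
  directions within \<open>2 * \<delta> / \<rho>\<close> of that of \<open>z\<close>, and at radius
  comparable to \<open>\<rho>\<close> such an angular motion costs only a multiple of
  \<open>\<delta>\<close>.\<close>

lemma cone_linear_contraction:
  assumes N: "smooth_submanifold m k N" "compact N" "N \<subseteq> unit_sphere m"
  shows "\<exists>c>0. \<exists>C\<ge>0. \<forall>z\<in>cone_over N. \<forall>\<delta>>0. \<delta> \<le> c * euclid_dist m z (\<lambda>i. 0) \<longrightarrow>
    (\<exists>\<Theta>. continuous_on ({v\<in>cone_over N. euclid_dist m z v \<le> \<delta>} \<times> {0..1::real}) \<Theta> \<and>
      (\<forall>v\<in>cone_over N. euclid_dist m z v \<le> \<delta> \<longrightarrow> \<Theta> (v, 0) = z \<and> \<Theta> (v, 1) = v \<and>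
        (\<forall>t\<in>{0..1}. \<Theta> (v, t) \<in> cone_over N \<and>
           inner_dist (euclid_dist m) (cone_over N) z (\<Theta> (v, t)) \<le> ennreal (C * \<delta>))))"
proof -
  obtain \<eta> L where \<eta>: "\<eta> > 0" and L: "L \<ge> 0"
    and contr: "\<And>p. p \<in> N \<Longrightarrow> \<exists>\<Gamma>. contracts_to m N L {y\<in>N. euclid_dist m p y < \<eta>} p \<Gamma>"
    using compact_submanifold_uniform_contraction[OF N(1,2)] by blast
  let ?n = "\<lambda>x. euclid_dist m x (\<lambda>i. 0)"
  \<comment> \<open>The bound 1/2 keeps the \<open>\<delta>\<close>-neighbourhood of
    \<open>z\<close> off the apex; \<open>\<eta> / 4\<close> makes
    \<open>2 * \<delta> / \<rho>\<close> smaller than \<open>\<eta>\<close>.\<close>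
  define c where "c = min (1/2) (\<eta> / 4)"
  have c: "c > 0" "c \<le> 1 / 2" "c \<le> \<eta> / 4" unfolding c_def using \<eta> by auto
  \<comment> \<open>The 1 pays for the radial motion, \<open>4 * L\<close> for the angular one:
    radius at most \<open>2 * \<rho>\<close> times direction change at most
    \<open>2 * \<delta> / \<rho>\<close>.\<close>
  define C where "C = 1 + 4 * L"
  have main: "\<exists>\<Theta>. continuous_on ({v\<in>cone_over N. euclid_dist m z v \<le> \<delta>} \<times> {0..1::real}) \<Theta> \<and>
      (\<forall>v\<in>cone_over N. euclid_dist m z v \<le> \<delta> \<longrightarrow> \<Theta> (v, 0) = z \<and> \<Theta> (v, 1) = v \<and>
        (\<forall>t\<in>{0..1}. \<Theta> (v, t) \<in> cone_over N \<and>
           inner_dist (euclid_dist m) (cone_over N) z (\<Theta> (v, t)) \<le> ennreal (C * \<delta>)))"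
    if z: "z \<in> cone_over N" and \<delta>: "\<delta> > 0" "\<delta> \<le> c * ?n z" for z \<delta>
  proof -
    define \<rho> where "\<rho> = ?n z"
    have \<rho>: "\<rho> > 0" using \<delta> c(1) unfolding \<rho>_def by (meson less_le_trans zero_less_mult_pos)
    have "c * \<rho> \<le> 1 / 2 * \<rho>" "c * \<rho> \<le> \<eta> / 4 * \<rho>"
      using c(2,3) \<rho> by (intro mult_right_mono; simp)+
    moreover have "\<delta> \<le> c * \<rho>" using \<delta>(2) unfolding \<rho>_def .
    ultimately have \<delta>\<rho>: "\<delta> \<le> \<rho> / 2" "\<delta> \<le> \<eta> / 4 * \<rho>" by linarith+
    define p where "p = (\<lambda>i. 1 / \<rho> * z i)"
    have p: "p \<in> N" and \<rho>1: "\<rho> \<le> 1"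
      using cone_over_cases[OF N(3) z] \<rho> unfolding p_def \<rho>_def by auto
    obtain \<Gamma> where \<Gamma>: "contracts_to m N L {y\<in>N. euclid_dist m p y < \<eta>} p \<Gamma>" using contr[OF p] by blast
    define B where "B = {v\<in>cone_over N. euclid_dist m z v \<le> \<delta>}"
    define u where "u = (\<lambda>v i. 1 / ?n v * v i)"
    define r where "r = (\<lambda>v t. (1 - t) * \<rho> + t * ?n v)"
    define \<Theta> where "\<Theta> = (\<lambda>(v, t). (\<lambda>i. r v t * \<Gamma> (u v, t) i))"
    have B: "\<bar>?n v - \<rho>\<bar> \<le> \<delta>" "?n v > 0" "?n v \<le> 1" "u v \<in> N" "euclid_dist m p (u v) \<le> 2 * \<delta> / \<rho>"
      "euclid_dist m p (u v) < \<eta>" if v: "v \<in> B" for v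
    proof -
      have d: "v \<in> cone_over N" "euclid_dist m z v \<le> \<delta>" using v unfolding B_def by auto
      show 1: "\<bar>?n v - \<rho>\<bar> \<le> \<delta>"
        using euclid_dist_triangle[of m v "\<lambda>i. 0" z] euclid_dist_triangle[of m z "\<lambda>i. 0" v] d(2)
          euclid_dist_commute[of m v z] unfolding \<rho>_def by linarith
      then show 2: "?n v > 0" using \<delta>\<rho>(1) \<rho> by linarith
      show "?n v \<le> 1" "u v \<in> N" using cone_over_cases[OF N(3) d(1) 2] unfolding u_def by auto
      have "euclid_dist m p (u v) \<le> euclid_dist m p (\<lambda>i. 1 / \<rho> * v i) + euclid_dist m (\<lambda>i. 1 / \<rho> * v i) (u v)"
        by (rule euclid_dist_triangle)
      also have "euclid_dist m p (\<lambda>i. 1 / \<rho> * v i) = 1 / \<rho> * euclid_dist m z v"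
        unfolding p_def using \<rho> by (subst euclid_dist_scale) simp
      also have "euclid_dist m (\<lambda>i. 1 / \<rho> * v i) (u v) = \<bar>1 / \<rho> - 1 / ?n v\<bar> * ?n v"
        unfolding u_def by (rule euclid_dist_scale_diff)
      also have "\<dots> = \<bar>(1 / \<rho> - 1 / ?n v) * ?n v\<bar>" using 2 by (simp add: abs_mult)
      also have "(1 / \<rho> - 1 / ?n v) * ?n v = (?n v - \<rho>) / \<rho>" using 2 \<rho> by (simp add: field_simps)
      also have "1 / \<rho> * euclid_dist m z v + \<bar>(?n v - \<rho>) / \<rho>\<bar> \<le> 1 / \<rho> * \<delta> + \<delta> / \<rho>"
        using 1 d(2) \<rho> by (intro add_mono mult_left_mono) (auto simp: abs_divide divide_right_mono)
      also have "\<dots> = 2 * \<delta> / \<rho>" by simp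
      finally show 3: "euclid_dist m p (u v) \<le> 2 * \<delta> / \<rho>" .
      also have "2 * \<delta> / \<rho> \<le> \<eta> / 2" using \<delta>\<rho>(2) \<rho> by (simp add: field_simps)
      finally show "euclid_dist m p (u v) < \<eta>" using \<eta> by linarith
    qed
    have \<Gamma>': "\<Gamma> (u v, 0) = p" "\<Gamma> (u v, 1) = u v" "\<And>t. t \<in> {0..1} \<Longrightarrow> \<Gamma> (u v, t) \<in> N"
      "\<And>s t. s \<in> {0..1} \<Longrightarrow> t \<in> {0..1} \<Longrightarrow> euclid_dist m (\<Gamma> (u v, s)) (\<Gamma> (u v, t)) \<le> L * euclid_dist m p (u v) * \<bar>s - t\<bar>"
      if "v \<in> B" for v
      using \<Gamma> B(4,6)[OF that] unfolding contracts_to_def by blast+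
    have cn: "continuous_on B ?n"
      by (intro continuous_on_euclid_dist continuous_on_const continuous_on_id)
    have cu: "continuous_on B u"
      unfolding u_def
    proof (intro continuous_on_coordinatewise_then_product continuous_on_mult continuous_on_divide
        continuous_on_const cn ballI)
      show "continuous_on B (\<lambda>v. v i)" for i
        by (rule continuous_on_subset[OF continuous_on_product_coordinates]) simp
      show "?n v \<noteq> 0" if "v \<in> B" for v using B(2)[OF that] by simp
    qed
    have cr: "continuous_on (B \<times> {0..1}) (\<lambda>q. r (fst q) (snd q))"
      unfolding r_def by (intro continuous_intros continuous_on_compose2[OF cn continuous_on_fst]) auto
    have "continuous_on (B \<times> {0..1}) (\<lambda>q. \<Gamma> (u (fst q), snd q))"
    proof (rule continuous_on_compose2)
      show "continuous_on ({y\<in>N. euclid_dist m p y < \<eta>} \<times> {0..1}) \<Gamma>" using \<Gamma> unfolding contracts_to_def by blast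
      show "continuous_on (B \<times> {0..1}) (\<lambda>q. (u (fst q), snd q :: real))"
        by (intro continuous_on_Pair continuous_on_compose2[OF cu continuous_on_fst] continuous_on_snd continuous_on_id) auto
      show "(\<lambda>q. (u (fst q), snd q)) ` (B \<times> {0..1}) \<subseteq> {y\<in>N. euclid_dist m p y < \<eta>} \<times> {0..1}"
        using B(4,6) by auto
    qed
    from continuous_on_product_then_coordinatewise[OF this]
    have cont: "continuous_on (B \<times> {0..1}) \<Theta>"
      unfolding \<Theta>_def case_prod_beta by (intro continuous_on_coordinatewise_then_product continuous_on_mult cr)
    have r01: "0 \<le> r v t" "r v t \<le> 1" "r v t \<le> 2 * \<rho>" if v: "v \<in> B" and t: "t \<in> {0..1}" for v t
    proof -
      show "0 \<le> r v t" unfolding r_def using t \<rho> by simp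
      show "r v t \<le> 1" unfolding r_def using t \<rho>1 B(3)[OF v] by (intro convex_bound_le) auto
      have "?n v \<le> 2 * \<rho>" using B(1)[OF v] \<delta>\<rho>(1) \<rho> by linarith
      then show "r v t \<le> 2 * \<rho>" unfolding r_def using t \<rho> by (intro convex_bound_le) auto
    qed
    have in_cone: "\<Theta> (v, t) \<in> cone_over N" if "v \<in> B" "t \<in> {0..1}" for v t
      unfolding cone_over_def \<Theta>_def using r01[OF that] \<Gamma>'(3)[OF that] by auto
    have ends: "\<Theta> (v, 0) = z" "\<Theta> (v, 1) = v" if v: "v \<in> B" for v
      using \<Gamma>'(1,2)[OF v] \<rho> B(2)[OF v] unfolding \<Theta>_def r_def p_def u_def by (auto simp: fun_eq_iff)
    have lip: "euclid_dist m (\<Theta> (v, s)) (\<Theta> (v, t)) \<le> C * \<delta> * \<bar>s - t\<bar>"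
      if v: "v \<in> B" and s: "s \<in> {0..1}" and t: "t \<in> {0..1}" for v s t
    proof -
      have "euclid_dist m (\<Theta> (v, s)) (\<Theta> (v, t)) \<le>
          euclid_dist m (\<lambda>i. r v s * \<Gamma> (u v, s) i) (\<lambda>i. r v t * \<Gamma> (u v, s) i) +
          euclid_dist m (\<lambda>i. r v t * \<Gamma> (u v, s) i) (\<lambda>i. r v t * \<Gamma> (u v, t) i)"
        unfolding \<Theta>_def by (simp add: euclid_dist_triangle)
      also have "euclid_dist m (\<lambda>i. r v s * \<Gamma> (u v, s) i) (\<lambda>i. r v t * \<Gamma> (u v, s) i) = \<bar>r v s - r v t\<bar>"
        using \<Gamma>'(3)[OF v s] N(3) by (subst euclid_dist_scale_diff) (auto simp: unit_sphere_def)
      also have "r v s - r v t = (s - t) * (?n v - \<rho>)" unfolding r_def by (simp add: algebra_simps)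
      also have "\<bar>(s - t) * (?n v - \<rho>)\<bar> \<le> \<bar>s - t\<bar> * \<delta>"
        unfolding abs_mult using B(1)[OF v] by (intro mult_left_mono) auto
      also have "euclid_dist m (\<lambda>i. r v t * \<Gamma> (u v, s) i) (\<lambda>i. r v t * \<Gamma> (u v, t) i) =
          r v t * euclid_dist m (\<Gamma> (u v, s)) (\<Gamma> (u v, t))"
        using r01(1)[OF v t] by (subst euclid_dist_scale) simp
      also have "\<dots> \<le> (2 * \<rho>) * (L * (2 * \<delta> / \<rho>) * \<bar>s - t\<bar>)"
      proof (rule mult_mono)
        show "euclid_dist m (\<Gamma> (u v, s)) (\<Gamma> (u v, t)) \<le> L * (2 * \<delta> / \<rho>) * \<bar>s - t\<bar>"
          using \<Gamma>'(4)[OF v s t] B(5)[OF v] L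
          by (meson abs_ge_zero mult_left_mono mult_right_mono order_trans)
      qed (use r01[OF v t] \<rho> in auto)
      also have "\<dots> = 4 * L * \<delta> * \<bar>s - t\<bar>" using \<rho> by simp
      finally show ?thesis unfolding C_def by (simp add: algebra_simps)
    qed
    have "inner_dist (euclid_dist m) (cone_over N) z (\<Theta> (v, t)) \<le> ennreal (C * \<delta>)"
      if v: "v \<in> B" and t: "t \<in> {0..1}" for v t
    \<comment> \<open>The part of the track up to time \<open>t\<close>, rescaled to the unit
      interval, joins \<open>z\<close> to \<open>\<Theta> (v, t)\<close>.\<close>
    proof (rule inner_dist_le_of_lipschitz_path[where \<gamma>="\<lambda>s. \<Theta> (v, s * t)"])
      have st: "s * t \<in> {0..1}" if "s \<in> {0..1}" for s using that t by (auto simp: mult_le_one)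
      show "path (\<lambda>s. \<Theta> (v, s * t))"
        unfolding path_def
        by (rule continuous_on_compose2[OF cont]) (use v st in \<open>auto intro!: continuous_intros\<close>)
      show "path_image (\<lambda>s. \<Theta> (v, s * t)) \<subseteq> cone_over N"
        unfolding path_image_def using in_cone[OF v st] by blast
      show "pathstart (\<lambda>s. \<Theta> (v, s * t)) = z" "pathfinish (\<lambda>s. \<Theta> (v, s * t)) = \<Theta> (v, t)"
        using ends[OF v] by (simp_all add: pathstart_def pathfinish_def)
      show "0 \<le> C * \<delta>" unfolding C_def using L \<delta> by simp
      fix s s' :: real assume s: "s \<in> {0..1}" "s' \<in> {0..1}"
      have "euclid_dist m (\<Theta> (v, s * t)) (\<Theta> (v, s' * t)) \<le> C * \<delta> * \<bar>s * t - s' * t\<bar>"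
        by (rule lip[OF v st[OF s(1)] st[OF s(2)]])
      also have "\<bar>s * t - s' * t\<bar> = \<bar>s - s'\<bar> * t" using t by (simp add: left_diff_distrib[symmetric] abs_mult)
      also have "C * \<delta> * (\<bar>s - s'\<bar> * t) \<le> C * \<delta> * (\<bar>s - s'\<bar> * 1)"
        using t L \<delta> unfolding C_def by (intro mult_left_mono) auto
      finally show "euclid_dist m (\<Theta> (v, s * t)) (\<Theta> (v, s' * t)) \<le> C * \<delta> * \<bar>s - s'\<bar>" by simp
    qed
    then show ?thesis using cont ends in_cone unfolding B_def by blast
  qed
  moreover have "C \<ge> 0" unfolding C_def using L by simp
  ultimately show ?thesis using c(1) by blast
qed

section \<open>Slices of weighted homogeneous surfaces\<close>

definition peval :: "(3, 'a::comm_semiring_1) mpoly \<Rightarrow> 'a \<Rightarrow> 'a \<Rightarrow> 'a \<Rightarrow> 'a" where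
  "peval p a b c = (\<Sum>e\<in>Poly_Mapping.keys p. Poly_Mapping.lookup p e *
     (a ^ Poly_Mapping.lookup e 1 * b ^ Poly_Mapping.lookup e 2 * c ^ Poly_Mapping.lookup e 3))"

lemma mpoly_eval_eq_peval: "mpoly_eval p x = peval p (x 1) (x 2) (x 3)"
  unfolding mpoly_eval_def peval_def
proof (rule sum.cong)
  fix e :: "3 \<Rightarrow>\<^sub>0 nat"
  have "(\<Prod>i\<in>Poly_Mapping.keys e. x i ^ Poly_Mapping.lookup e i) =
      (\<Prod>i\<in>UNIV. x i ^ Poly_Mapping.lookup e i)"
    by (rule prod.mono_neutral_left) (auto simp: in_keys_iff)
  also have "\<dots> = x 1 ^ Poly_Mapping.lookup e 1 * x 2 ^ Poly_Mapping.lookup e 2 * x 3 ^ Poly_Mapping.lookup e 3"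
    unfolding UNIV_3 by (simp add: mult.assoc)
  finally show "Poly_Mapping.lookup p e * (\<Prod>i\<in>Poly_Mapping.keys e. x i ^ Poly_Mapping.lookup e i) =
      Poly_Mapping.lookup p e *
      (x 1 ^ Poly_Mapping.lookup e 1 * x 2 ^ Poly_Mapping.lookup e 2 * x 3 ^ Poly_Mapping.lookup e 3)"
    by simp
qed simp

lemma lookup_complexify: "Poly_Mapping.lookup (complexify f) e = of_real (Poly_Mapping.lookup f e)"
  unfolding complexify_def by (simp add: Poly_Mapping.map.rep_eq when_def)

lemma keys_complexify: "Poly_Mapping.keys (complexify f) = Poly_Mapping.keys f"
  by (auto simp: in_keys_iff lookup_complexify)

lemma peval_complexify: "peval (complexify f) (of_real a) (of_real b) (of_real c) = of_real (peval f a b c)"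
  by (simp add: peval_def keys_complexify lookup_complexify)

text \<open>The third exponent is dropped on purpose: the power of the fixed value of
  \<open>x3\<close> goes into \<open>\<alpha> e\<close>, together with any rescaling of the other
  two variables.\<close>

definition slice_poly :: "(3 \<Rightarrow>\<^sub>0 nat) set \<Rightarrow> ((3 \<Rightarrow>\<^sub>0 nat) \<Rightarrow> real) \<Rightarrow> real poly poly" where
  "slice_poly S \<alpha> = (\<Sum>e\<in>S. monom (monom (\<alpha> e) (Poly_Mapping.lookup e 1)) (Poly_Mapping.lookup e 2))"

lemma eval2_slice_poly:
  "eval2 (slice_poly S \<alpha>) x y =
     (\<Sum>e\<in>S. of_real (\<alpha> e) * x ^ Poly_Mapping.lookup e 1 * y ^ Poly_Mapping.lookup e 2)"
  by (simp add: slice_poly_def eval2_sum eval2_monom)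

lemma eval1_cnj: "eval1 p (cnj x) = cnj (eval1 p x)"
  by (induction p) simp_all

lemma eval2_cnj: "eval2 P (cnj x) (cnj y) = cnj (eval2 P x y)"
  by (induction P) (simp_all add: eval1_cnj)

lemma exists_slice: "\<exists>F. \<forall>x y. eval2 F x y = peval (complexify f) x y (of_real c)"
proof (intro exI allI)
  fix x y
  show "eval2 (slice_poly (Poly_Mapping.keys f) (\<lambda>e. Poly_Mapping.lookup f e * c ^ Poly_Mapping.lookup e 3)) x y =
      peval (complexify f) x y (of_real c)"
    unfolding eval2_slice_poly peval_def keys_complexify lookup_complexify
    by (intro sum.cong) (simp_all add: mult_ac)
qed

text \<open>The Zariski tangent space tests complex polynomials, while the reduced slice equation is
  real; splitting the coefficients into real and imaginary parts mediates. The scalings come from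
  acting by a positive real number.\<close>

lemma exists_scaled_slice:
  fixes p :: "(3, complex) mpoly"
  shows "\<exists>Q1 Q2. \<forall>x y. eval2 Q1 x y + \<i> * eval2 Q2 x y = peval p (of_real a * x) (of_real b * y) (of_real c)"
proof (intro exI allI)
  fix x y
  let ?m = "\<lambda>e. a ^ Poly_Mapping.lookup e 1 * b ^ Poly_Mapping.lookup e 2 * c ^ Poly_Mapping.lookup e 3"
  let ?Q = "\<lambda>h. slice_poly (Poly_Mapping.keys p) (\<lambda>e. h (Poly_Mapping.lookup p e) * ?m e)"
  have split: "of_real (Re z * r) * u + \<i> * (of_real (Im z * r) * u) = z * (of_real r * u)" for z r u
  proof -
    have "of_real (Re z * r) * u + \<i> * (of_real (Im z * r) * u) = (of_real (Re z) + \<i> * of_real (Im z)) * (of_real r * u)"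
      by (simp add: algebra_simps)
    then show ?thesis by (simp add: complex_eq[symmetric])
  qed
  show "eval2 (?Q Re) x y + \<i> * eval2 (?Q Im) x y = peval p (of_real a * x) (of_real b * y) (of_real c)"
    unfolding eval2_slice_poly peval_def sum_distrib_left sum.distrib[symmetric]
  proof (rule sum.cong[OF refl])
    fix e
    show "of_real (Re (Poly_Mapping.lookup p e) * ?m e) * x ^ Poly_Mapping.lookup e 1 * y ^ Poly_Mapping.lookup e 2 +
        \<i> * (of_real (Im (Poly_Mapping.lookup p e) * ?m e) * x ^ Poly_Mapping.lookup e 1 * y ^ Poly_Mapping.lookup e 2) =
        Poly_Mapping.lookup p e * ((of_real a * x) ^ Poly_Mapping.lookup e 1 *
          (of_real b * y) ^ Poly_Mapping.lookup e 2 * of_real c ^ Poly_Mapping.lookup e 3)"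
      using split[of "Poly_Mapping.lookup p e" "?m e" "x ^ Poly_Mapping.lookup e 1 * y ^ Poly_Mapping.lookup e 2"]
      by (simp add: power_mult_distrib mult_ac)
  qed
qed

section \<open>Regularity of the slice\<close>

definition partially_differentiable ::
  "(complex \<times> complex \<times> complex \<Rightarrow> complex) \<Rightarrow> complex \<times> complex \<times> complex \<Rightarrow> bool" where
  "partially_differentiable P z \<longleftrightarrow> (\<exists>D1 D2 D3.
     (P has_derivative (\<lambda>h. D1 * fst h + D2 * fst (snd h) + D3 * snd (snd h))) (at z))"

lemma partially_differentiable_const: "partially_differentiable (\<lambda>z. k) z"
  unfolding partially_differentiable_def by (intro exI[of _ 0]) simp

lemma partially_differentiable_coords:
  "partially_differentiable fst z" "partially_differentiable (\<lambda>z. fst (snd z)) z"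
  "partially_differentiable (\<lambda>z. snd (snd z)) z"
proof -
  show "partially_differentiable fst z"
    unfolding partially_differentiable_def
    by (rule exI[of _ 1], rule exI[of _ 0], rule exI[of _ 0]) (auto intro!: derivative_eq_intros)
  show "partially_differentiable (\<lambda>z. fst (snd z)) z"
    unfolding partially_differentiable_def
    by (rule exI[of _ 0], rule exI[of _ 1], rule exI[of _ 0]) (auto intro!: derivative_eq_intros)
  show "partially_differentiable (\<lambda>z. snd (snd z)) z"
    unfolding partially_differentiable_def
    by (rule exI[of _ 0], rule exI[of _ 0], rule exI[of _ 1]) (auto intro!: derivative_eq_intros)
qed

lemma partially_differentiable_add:
  assumes "partially_differentiable P z" "partially_differentiable Q z"
  shows "partially_differentiable (\<lambda>z. P z + Q z) z"
proof -
  obtain D1 D2 D3 E1 E2 E3 where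
    "(P has_derivative (\<lambda>h. D1 * fst h + D2 * fst (snd h) + D3 * snd (snd h))) (at z)"
    "(Q has_derivative (\<lambda>h. E1 * fst h + E2 * fst (snd h) + E3 * snd (snd h))) (at z)"
    using assms unfolding partially_differentiable_def by blast
  from has_derivative_add[OF this] show ?thesis
    unfolding partially_differentiable_def
    by (intro exI[of _ "D1 + E1"] exI[of _ "D2 + E2"] exI[of _ "D3 + E3"])
      (erule has_derivative_eq_rhs, simp add: fun_eq_iff algebra_simps)
qed

lemma partially_differentiable_mult:
  assumes "partially_differentiable P z" "partially_differentiable Q z"
  shows "partially_differentiable (\<lambda>z. P z * Q z) z"
proof -
  obtain D1 D2 D3 E1 E2 E3 where
    "(P has_derivative (\<lambda>h. D1 * fst h + D2 * fst (snd h) + D3 * snd (snd h))) (at z)"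
    "(Q has_derivative (\<lambda>h. E1 * fst h + E2 * fst (snd h) + E3 * snd (snd h))) (at z)"
    using assms unfolding partially_differentiable_def by blast
  from has_derivative_mult[OF this] show ?thesis
    unfolding partially_differentiable_def
    by (intro exI[of _ "P z * E1 + D1 * Q z"] exI[of _ "P z * E2 + D2 * Q z"] exI[of _ "P z * E3 + D3 * Q z"])
      (erule has_derivative_eq_rhs, simp add: fun_eq_iff algebra_simps)
qed

lemma partially_differentiable_power:
  "partially_differentiable P z \<Longrightarrow> partially_differentiable (\<lambda>z. P z ^ n) z"
  by (induction n) (simp_all add: partially_differentiable_const partially_differentiable_mult)

lemma partially_differentiable_sum:
  "(\<And>i. i \<in> I \<Longrightarrow> partially_differentiable (P i) z) \<Longrightarrow> partially_differentiable (\<lambda>z. \<Sum>i\<in>I. P i z) z"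
  by (induction I rule: infinite_finite_induct)
    (simp_all add: partially_differentiable_const partially_differentiable_add)

lemma partially_differentiable_peval: "partially_differentiable (\<lambda>z. peval p (fst z) (fst (snd z)) (snd (snd z))) z"
  unfolding peval_def
  by (intro partially_differentiable_sum partially_differentiable_mult partially_differentiable_power
      partially_differentiable_const partially_differentiable_coords)

lemma complex_zeros_eq: "complex_zeros f = {z. peval (complexify f) (z $ 1) (z $ 2) (z $ 3) = 0}"
  by (simp add: complex_zeros_def mpoly_eval_eq_peval)

lemma real_zeros_eq: "real_zeros f = {x. peval f (x $ 1) (x $ 2) (x $ 3) = 0}"
  by (simp add: real_zeros_def mpoly_eval_eq_peval)

lemma weighted_action_in_complex_zeros:
  assumes "weighted_homogeneous w f" "t \<noteq> 0"
  shows "weighted_action w t z \<in> complex_zeros f \<longleftrightarrow> z \<in> complex_zeros f"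
  using assms unfolding weighted_homogeneous_def complex_zeros_def by auto

text \<open>The Euler relation removes the third partial derivative: an equation of \<open>X\<close> that is regular at a
  point with third coordinate \<open>c \<noteq> 0\<close> stays regular after restriction to the slice \<open>z $ 3 = c\<close>.\<close>

lemma exists_regular_slice_equation:
  assumes w: "\<forall>i. 0 < w $ i" and hom: "weighted_homogeneous w f" and c: "c \<noteq> 0"
    and iso: "0 isolated_in surface_singular_locus (complex_zeros f)"
    and xy: "peval (complexify f) x y (of_real c) = 0"
  shows "\<exists>Q. (\<forall>x' y'. peval (complexify f) x' y' (of_real c) = 0 \<longrightarrow> eval2 Q x' y' = 0) \<and>
    \<not> ((\<lambda>z. eval2 Q (fst z) (snd z)) has_derivative (\<lambda>_. 0)) (at (x, y))"
proof (rule ccontr)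
  assume neg: "\<not> ?thesis"
  define X where "X = complex_zeros f"
  have Xaction: "weighted_action w t z \<in> X \<longleftrightarrow> z \<in> X" if "t \<noteq> 0" for t z
    using weighted_action_in_complex_zeros[OF hom that] unfolding X_def .
  define z0 :: "complex^3" where "z0 = vector [x, y, of_real c]"
  have z0: "z0 \<in> X" using xy unfolding X_def complex_zeros_eq z0_def by simp
  \<comment> \<open>In this neighbourhood 0 is the only singular point. A small positive
    \<open>t\<close> moves \<open>z0\<close> into it, so the tangent space at the image
    \<open>u\<close> has dimension 2.\<close>
  obtain T where T: "open T" "T \<inter> surface_singular_locus X = {0}"
    using iso unfolding isolated_in_def X_def by blast
  then have "0 \<in> T" by blast
  have "((\<lambda>t. weighted_action w (of_real t) z0) \<longlongrightarrow> weighted_action w (of_real 0) z0) (at_right 0)"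
    unfolding weighted_action_def by (intro tendsto_vec_lambda tendsto_intros)
  moreover have "weighted_action w (of_real 0) z0 = 0"
    unfolding weighted_action_def using w by (simp add: vec_eq_iff zero_power)
  ultimately have "\<forall>\<^sub>F t in at_right 0. weighted_action w (of_real t) z0 \<in> T"
    using topological_tendstoD[OF _ T(1)] \<open>0 \<in> T\<close> by fastforce
  then obtain b where b: "b > 0" "\<And>t. t > 0 \<Longrightarrow> t < b \<Longrightarrow> weighted_action w (of_real t) z0 \<in> T"
    unfolding eventually_at_right_field by blast
  have "weighted_action w (of_real (b / 2)) z0 \<in> T" by (rule b(2)) (use b(1) in auto)
  moreover have "b / 2 > 0" using b(1) by simp
  ultimately obtain t where t: "t > 0" "weighted_action w (of_real t) z0 \<in> T" by blast
  define u where "u = weighted_action w (of_real t) z0"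
  have u: "u $ 1 = of_real (t ^ (w $ 1)) * x" "u $ 2 = of_real (t ^ (w $ 2)) * y" "u $ 3 = of_real (t ^ (w $ 3) * c)"
    unfolding u_def z0_def weighted_action_def by simp_all
  have "u $ 3 \<noteq> 0" using t c unfolding u by simp
  then have "u \<noteq> 0" by auto
  have uX: "u \<in> X" unfolding u_def using Xaction z0 t by simp
  have "vec.dim (zariski_tangent_space X u) = 2"
    using T(2) t(2) \<open>u \<noteq> 0\<close> uX unfolding u_def[symmetric] surface_singular_locus_def by blast
  \<comment> \<open>A proper subspace excludes some vector, which produces a polynomial vanishing on
    \<open>X\<close> with nonzero differential at \<open>u\<close>.\<close>
  then have "zariski_tangent_space X u \<noteq> UNIV"
    using vec_dim_card[where 'n=3 and 'a=complex] by auto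
  then obtain v where "v \<notin> zariski_tangent_space X u" by blast
  then obtain p where p: "\<And>z. z \<in> X \<Longrightarrow> mpoly_eval p (($) z) = 0"
    and pv: "(\<Sum>i\<in>UNIV. deriv (\<lambda>t. mpoly_eval p ((($) u)(i := t))) (u $ i) * v $ i) \<noteq> 0"
    unfolding zariski_tangent_space_def by blast
  let ?u = "(u $ 1, u $ 2, u $ 3)"
  define P where "P = (\<lambda>z. peval p (fst z) (fst (snd z)) (snd (snd z)))"
  obtain D1 D2 D3 where D: "(P has_derivative (\<lambda>h. D1 * fst h + D2 * fst (snd h) + D3 * snd (snd h))) (at ?u)"
    using partially_differentiable_peval[of p ?u] unfolding partially_differentiable_def P_def by blast
  have comp: "((\<lambda>s. P (\<gamma> s)) has_derivative (\<lambda>h. D1 * fst (\<gamma>' h) + D2 * fst (snd (\<gamma>' h)) + D3 * snd (snd (\<gamma>' h)))) (at s)"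
    if "\<gamma> s = ?u" "(\<gamma> has_derivative \<gamma>') (at s)" for \<gamma> \<gamma>' and s :: "'b::real_normed_vector"
    by (rule has_derivative_compose[OF that(2)]) (simp add: that(1) D)
  have d1: "deriv (\<lambda>t. mpoly_eval p ((($) u)(1 := t))) (u $ 1) = D1"
    using comp[of "\<lambda>s. (s, u $ 2, u $ 3)" "u $ 1" "\<lambda>h. (h, 0, 0)"]
    by (intro DERIV_imp_deriv) (simp add: has_field_derivative_def mpoly_eval_eq_peval P_def
        has_derivative_Pair has_derivative_ident has_derivative_const)
  have d2: "deriv (\<lambda>t. mpoly_eval p ((($) u)(2 := t))) (u $ 2) = D2"
    using comp[of "\<lambda>s. (u $ 1, s, u $ 3)" "u $ 2" "\<lambda>h. (0, h, 0)"]
    by (intro DERIV_imp_deriv) (simp add: has_field_derivative_def mpoly_eval_eq_peval P_def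
        has_derivative_Pair has_derivative_ident has_derivative_const)
  have d3: "deriv (\<lambda>t. mpoly_eval p ((($) u)(3 := t))) (u $ 3) = D3"
    using comp[of "\<lambda>s. (u $ 1, u $ 2, s)" "u $ 3" "\<lambda>h. (0, 0, h)"]
    by (intro DERIV_imp_deriv) (simp add: has_field_derivative_def mpoly_eval_eq_peval P_def
        has_derivative_Pair has_derivative_ident has_derivative_const)
  have PX: "P (z $ 1, z $ 2, z $ 3) = 0" if "z \<in> X" for z
    using p[OF that] by (simp add: P_def mpoly_eval_eq_peval)
  \<comment> \<open>Composing \<open>p\<close> with the action by \<open>t\<close> yields a
    polynomial on the original slice \<open>x3 = c\<close>; its real and imaginary parts are the
    candidates for \<open>Q\<close>.\<close>
  obtain Q1 Q2 where Q: "\<And>x y. eval2 Q1 x y + \<i> * eval2 Q2 x y =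
      peval p (of_real (t ^ (w $ 1)) * x) (of_real (t ^ (w $ 2)) * y) (of_real (t ^ (w $ 3) * c))"
    using exists_scaled_slice by blast
  have Qvanish: "eval2 Q1 x' y' = 0 \<and> eval2 Q2 x' y' = 0" if "peval (complexify f) x' y' (of_real c) = 0" for x' y'
  proof -
    have vanish: "eval2 Q1 a b + \<i> * eval2 Q2 a b = 0" if ab: "peval (complexify f) a b (of_real c) = 0" for a b
    proof -
      have "vector [a, b, of_real c] \<in> X" using ab unfolding X_def complex_zeros_eq by simp
      then have "weighted_action w (of_real t) (vector [a, b, of_real c]) \<in> X" using Xaction t by simp
      from PX[OF this] show ?thesis unfolding Q by (simp add: P_def weighted_action_def)
    qed
    \<comment> \<open>\<open>f\<close> is real, so the slice is stable under conjugation. Vanishing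
      at the conjugate point shows that \<open>Q1 - \<i> * Q2\<close> vanishes too, which separates
      the two parts.\<close>
    obtain F where F: "\<And>x y. eval2 F x y = peval (complexify f) x y (of_real c)" using exists_slice by blast
    have "peval (complexify f) (cnj x') (cnj y') (of_real c) = 0"
      using that eval2_cnj[of F x' y'] unfolding F by simp
    from vanish[OF this] have "cnj (eval2 Q1 x' y' - \<i> * eval2 Q2 x' y') = 0"
      unfolding eval2_cnj by simp
    then have "eval2 Q1 x' y' - \<i> * eval2 Q2 x' y' = 0" by (simp only: complex_cnj_zero_iff)
    with vanish[OF that] show ?thesis by (auto simp: complex_eq_iff)
  qed
  have dQ: "((\<lambda>z. eval2 Q1 (fst z) (snd z)) has_derivative (\<lambda>_. 0)) (at (x, y))"
    "((\<lambda>z. eval2 Q2 (fst z) (snd z)) has_derivative (\<lambda>_. 0)) (at (x, y))"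
    using neg Qvanish by blast+
  have "((\<lambda>z. eval2 Q1 (fst z) (snd z) + \<i> * eval2 Q2 (fst z) (snd z)) has_derivative (\<lambda>_. 0 + \<i> * 0)) (at (x, y))"
    by (intro has_derivative_add has_derivative_mult_right dQ)
  moreover have "(\<lambda>z. eval2 Q1 (fst z) (snd z) + \<i> * eval2 Q2 (fst z) (snd z)) =
      (\<lambda>z. P (of_real (t ^ (w $ 1)) * fst z, of_real (t ^ (w $ 2)) * snd z, of_real (t ^ (w $ 3) * c)))"
    unfolding Q P_def by simp
  ultimately have "((\<lambda>z. P (of_real (t ^ (w $ 1)) * fst z, of_real (t ^ (w $ 2)) * snd z, of_real (t ^ (w $ 3) * c)))
      has_derivative (\<lambda>_. 0)) (at (x, y))" by simp
  moreover have "((\<lambda>z. P (of_real (t ^ (w $ 1)) * fst z, of_real (t ^ (w $ 2)) * snd z, of_real (t ^ (w $ 3) * c)))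
      has_derivative (\<lambda>h. D1 * (of_real (t ^ (w $ 1)) * fst h) + D2 * (of_real (t ^ (w $ 2)) * snd h) + D3 * 0)) (at (x, y))"
    using comp[of "\<lambda>z. (of_real (t ^ (w $ 1)) * fst z, of_real (t ^ (w $ 2)) * snd z, of_real (t ^ (w $ 3) * c))" "(x, y)"
        "\<lambda>h. (of_real (t ^ (w $ 1)) * fst h, of_real (t ^ (w $ 2)) * snd h, 0)"]
    unfolding u fst_conv snd_conv
    by (simp add: has_derivative_Pair has_derivative_mult_right has_derivative_fst has_derivative_snd
        has_derivative_ident has_derivative_const)
  ultimately have eq: "(\<lambda>_. 0) = (\<lambda>h. D1 * (of_real (t ^ (w $ 1)) * fst h) + D2 * (of_real (t ^ (w $ 2)) * snd h) + D3 * 0)"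
    by (rule has_derivative_unique)
  have D12: "D1 = 0" "D2 = 0"
    using fun_cong[OF eq, of "(1, 0)"] fun_cong[OF eq, of "(0, 1)"] t(1) by auto
  \<comment> \<open>The orbit of \<open>u\<close> lies in \<open>X\<close>. Differentiating
    \<open>P\<close> along it at \<open>s = 1\<close> gives the Euler relation, in which only the
    term with \<open>D3\<close> is left.\<close>
  define \<gamma> where "\<gamma> = (\<lambda>s::complex. (s ^ (w $ 1) * u $ 1, s ^ (w $ 2) * u $ 2, s ^ (w $ 3) * u $ 3))"
  have "((\<lambda>s. s ^ n * k) has_derivative (\<lambda>h. of_nat n * k * h)) (at 1)" for n :: nat and k :: complex
    by (auto intro!: derivative_eq_intros)
  then have "(\<gamma> has_derivative (\<lambda>h. (of_nat (w $ 1) * u $ 1 * h, of_nat (w $ 2) * u $ 2 * h, of_nat (w $ 3) * u $ 3 * h))) (at 1)"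
    unfolding \<gamma>_def by (intro has_derivative_Pair)
  from comp[OF _ this]
  have "((\<lambda>s. P (\<gamma> s)) has_derivative (\<lambda>h. D3 * (of_nat (w $ 3) * u $ 3 * h))) (at 1)"
    using D12 by (simp add: \<gamma>_def)
  moreover have "((\<lambda>s. P (\<gamma> s)) has_derivative (\<lambda>_. 0)) (at 1)"
  proof (rule has_derivative_transform_within_open[of "\<lambda>_. 0" _ _ _ "- {0}"])
    show "0 = P (\<gamma> s)" if "s \<in> - {0}" for s
      using PX[of "weighted_action w s u"] Xaction[of s u] uX that by (simp add: weighted_action_def \<gamma>_def)
  qed auto
  ultimately have eq3: "(\<lambda>h. D3 * (of_nat (w $ 3) * u $ 3 * h)) = (\<lambda>_. 0)" by (rule has_derivative_unique)
  have "w $ 3 \<noteq> 0" using w by (metis less_numeral_extra(3))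
  then have "D3 = 0" using fun_cong[OF eq3, of 1] \<open>u $ 3 \<noteq> 0\<close> by simp
  then show False using pv D12 unfolding sum_3 d1 d2 d3 by simp
qed

text \<open>Every real polynomial vanishing on the slice is a multiple of \<open>G\<close>, so at a
  critical zero of \<open>G\<close> all of them would be critical, against the existence of a
  regular one.\<close>

lemma exists_reduced_slice:
  assumes w: "\<forall>i. 0 < w $ i" and hom: "weighted_homogeneous w f" and c: "c \<noteq> 0"
    and iso: "0 isolated_in surface_singular_locus (complex_zeros f)"
    and ne: "peval (complexify f) x0 y0 (of_real c) = 0"
  shows "\<exists>G. (\<forall>x y. eval2 G x y = 0 \<longleftrightarrow> peval (complexify f) x y (of_real c) = 0) \<and>
    (\<forall>x y::complex. eval2 G x y = 0 \<longrightarrow> \<not> ((\<lambda>z. eval2 G (fst z) (snd z)) has_derivative (\<lambda>_. 0)) (at (x, y)))"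
proof -
  obtain F where F: "\<And>x y. eval2 F x y = peval (complexify f) x y (of_real c)" using exists_slice by blast
  \<comment> \<open>If the slice were the whole plane, the regular equation would vanish identically
    and have zero derivative.\<close>
  have "F \<noteq> 0"
  proof
    assume "F = 0"
    then have all: "peval (complexify f) x y (of_real c) = 0" for x y using F[of x y] by simp
    obtain Q where "\<And>x' y'. peval (complexify f) x' y' (of_real c) = 0 \<Longrightarrow> eval2 Q x' y' = 0"
      "\<not> ((\<lambda>z. eval2 Q (fst z) (snd z)) has_derivative (\<lambda>_. 0)) (at (x0, y0))"
      using exists_regular_slice_equation[OF w hom c iso ne] by blast
    then show False using all by simp
  qed
  then obtain G where G: "\<And>x y::complex. eval2 G x y = 0 \<longleftrightarrow> eval2 F x y = 0"
    "\<And>Q. (\<forall>x y::complex. eval2 F x y = 0 \<longrightarrow> eval2 Q x y = 0) \<Longrightarrow> G dvd Q"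
    using exists_reduced_poly by blast
  have "\<not> ((\<lambda>z. eval2 G (fst z) (snd z)) has_derivative (\<lambda>_. 0)) (at (x, y))" if xy: "eval2 G x y = 0" for x y :: complex
  proof
    assume dG: "((\<lambda>z. eval2 G (fst z) (snd z)) has_derivative (\<lambda>_. 0)) (at (x, y))"
    have "peval (complexify f) x y (of_real c) = 0" using xy G(1) F by simp
    then obtain Q where Q: "\<forall>x' y'. peval (complexify f) x' y' (of_real c) = 0 \<longrightarrow> eval2 Q x' y' = 0"
      "\<not> ((\<lambda>z. eval2 Q (fst z) (snd z)) has_derivative (\<lambda>_. 0)) (at (x, y))"
      using exists_regular_slice_equation[OF w hom c iso] by blast
    then have "G dvd Q" using G(2) unfolding F by blast
    then obtain A where A: "Q = G * A" by auto
    obtain A1 A2 where "\<And>z::complex \<times> complex. ((\<lambda>z. eval2 A (fst z) (snd z)) has_derivative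
       (\<lambda>v. eval2 A1 (fst z) (snd z) * fst v + eval2 A2 (fst z) (snd z) * snd v)) (at z)"
      using eval2_partial_derivatives[where 'a=complex] by blast
    from has_derivative_mult[OF dG this[of "(x, y)"]]
    have "((\<lambda>z. eval2 Q (fst z) (snd z)) has_derivative (\<lambda>_. 0)) (at (x, y))"
      unfolding A using xy by simp
    then show False using Q(2) by blast
  qed
  then show ?thesis using G(1) F by (intro exI[of _ G]) simp
qed

section \<open>Points joined by Lipschitz arcs\<close>

definition lipschitz_joined :: "'a::metric_space set \<Rightarrow> real \<Rightarrow> 'a \<Rightarrow> 'a \<Rightarrow> bool" where
  "lipschitz_joined K L x y \<longleftrightarrow>
     (\<exists>\<gamma>. L-lipschitz_on {0..1::real} \<gamma> \<and> \<gamma> 0 = x \<and> \<gamma> 1 = y \<and> \<gamma> ` {0..1} \<subseteq> K)"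

lemma lipschitz_joined_sym:
  assumes "lipschitz_joined K L x y"
  shows "lipschitz_joined K L y x"
proof -
  obtain \<gamma> where \<gamma>: "L-lipschitz_on {0..1::real} \<gamma>" "\<gamma> 0 = x" "\<gamma> 1 = y" "\<gamma> ` {0..1} \<subseteq> K"
    using assms unfolding lipschitz_joined_def by blast
  have "L-lipschitz_on {0..1} (\<lambda>t. \<gamma> (1 - t))"
  proof (rule lipschitz_onI)
    fix s t :: real assume "s \<in> {0..1}" "t \<in> {0..1}"
    then have "dist (\<gamma> (1 - s)) (\<gamma> (1 - t)) \<le> L * dist (1 - s) (1 - t)"
      by (intro lipschitz_onD[OF \<gamma>(1)]) auto
    then show "dist (\<gamma> (1 - s)) (\<gamma> (1 - t)) \<le> L * dist s t"
      by (simp add: dist_real_def abs_minus_commute)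
  qed (rule lipschitz_on_nonneg[OF \<gamma>(1)])
  moreover have "(\<lambda>t. \<gamma> (1 - t)) ` {0..1} \<subseteq> K" using \<gamma>(4) by force
  ultimately show ?thesis using \<gamma>(2,3) unfolding lipschitz_joined_def by (intro exI[of _ "\<lambda>t. \<gamma> (1 - t)"]) simp
qed

lemma lipschitz_joined_mono: "lipschitz_joined K L x y \<Longrightarrow> L \<le> L' \<Longrightarrow> lipschitz_joined K L' x y"
  unfolding lipschitz_joined_def using lipschitz_on_le by blast

text \<open>Each arc is run at double speed on one half of the interval, whence the factor
  2.\<close>

lemma lipschitz_joined_trans:
  assumes "lipschitz_joined K L x y" "lipschitz_joined K M y z"
  shows "lipschitz_joined K (2 * (L + M)) x z"
proof -
  obtain \<gamma> where \<gamma>: "L-lipschitz_on {0..1::real} \<gamma>" "\<gamma> 0 = x" "\<gamma> 1 = y" "\<gamma> ` {0..1} \<subseteq> K"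
    using assms(1) unfolding lipschitz_joined_def by blast
  obtain \<beta> where \<beta>: "M-lipschitz_on {0..1::real} \<beta>" "\<beta> 0 = y" "\<beta> 1 = z" "\<beta> ` {0..1} \<subseteq> K"
    using assms(2) unfolding lipschitz_joined_def by blast
  have L: "0 \<le> L" and M: "0 \<le> M" using lipschitz_on_nonneg \<gamma>(1) \<beta>(1) by blast+
  have "(2 * (L + M))-lipschitz_on {0..1/2} (\<lambda>t. \<gamma> (2 * t))"
  proof (rule lipschitz_onI)
    fix s t :: real assume "s \<in> {0..1/2}" "t \<in> {0..1/2}"
    then have "dist (\<gamma> (2 * s)) (\<gamma> (2 * t)) \<le> L * dist (2 * s) (2 * t)"
      by (intro lipschitz_onD[OF \<gamma>(1)]) auto
    also have "dist (2 * s) (2 * t) = 2 * dist s t"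
      using abs_mult[of 2 "s - t"] by (simp add: dist_real_def right_diff_distrib)
    also have "L * (2 * dist s t) \<le> (L + M) * (2 * dist s t)" using M by (intro mult_right_mono) auto
    finally show "dist (\<gamma> (2 * s)) (\<gamma> (2 * t)) \<le> 2 * (L + M) * dist s t" by (simp add: algebra_simps)
  qed (use L M in simp)
  moreover have "(2 * (L + M))-lipschitz_on {1/2..1} (\<lambda>t. \<beta> (2 * t - 1))"
  proof (rule lipschitz_onI)
    fix s t :: real assume "s \<in> {1/2..1}" "t \<in> {1/2..1}"
    then have "dist (\<beta> (2 * s - 1)) (\<beta> (2 * t - 1)) \<le> M * dist (2 * s - 1) (2 * t - 1)"
      by (intro lipschitz_onD[OF \<beta>(1)]) auto
    also have "dist (2 * s - 1) (2 * t - 1) = 2 * dist s t"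
      using abs_mult[of 2 "s - t"] by (simp add: dist_real_def right_diff_distrib)
    also have "M * (2 * dist s t) \<le> (L + M) * (2 * dist s t)" using L by (intro mult_right_mono) auto
    finally show "dist (\<beta> (2 * s - 1)) (\<beta> (2 * t - 1)) \<le> 2 * (L + M) * dist s t" by (simp add: algebra_simps)
  qed (use L M in simp)
  moreover have "\<gamma> (2 * (1/2)) = \<beta> (2 * (1/2) - 1)" using \<gamma>(3) \<beta>(2) by simp
  ultimately have "(2 * (L + M))-lipschitz_on {0..1} (\<lambda>t. if t \<le> 1/2 then \<gamma> (2 * t) else \<beta> (2 * t - 1))"
    by (rule lipschitz_on_concat)
  moreover have "(\<lambda>t. if t \<le> 1/2 then \<gamma> (2 * t) else \<beta> (2 * t - 1)) ` {0..1} \<subseteq> K"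
    using \<gamma>(4) \<beta>(4) by (auto simp: image_subset_iff)
  ultimately show ?thesis unfolding lipschitz_joined_def using \<gamma>(2) \<beta>(3)
    by (intro exI[of _ "\<lambda>t. if t \<le> 1/2 then \<gamma> (2 * t) else \<beta> (2 * t - 1)"]) simp
qed

text \<open>Being joined to \<open>x0\<close> by some Lipschitz arc is an open and closed condition
  in \<open>K\<close>. A finite cover of the resulting compact set then makes the Lipschitz constant
  uniform.\<close>

lemma exists_lipschitz_component:
  fixes K :: "'a::metric_space set"
  assumes K: "compact K" "x0 \<in> K"
    and arcs: "\<And>x. x \<in> K \<Longrightarrow> \<exists>r>0. \<exists>L. \<forall>y\<in>ball x r. y \<in> K \<longrightarrow> lipschitz_joined K L x y"
  shows "\<exists>K0 L. x0 \<in> K0 \<and> K0 \<subseteq> K \<and> compact K0 \<and> (\<forall>x\<in>K0. \<exists>r>0. \<forall>y\<in>ball x r. y \<in> K \<longrightarrow> y \<in> K0) \<and>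
    (\<forall>y\<in>K0. lipschitz_joined K L x0 y)"
proof -
  obtain r L where rL: "\<And>x. x \<in> K \<Longrightarrow> r x > 0"
    "\<And>x y. x \<in> K \<Longrightarrow> y \<in> ball x (r x) \<Longrightarrow> y \<in> K \<Longrightarrow> lipschitz_joined K (L x) x y"
    using arcs by metis
  define K0 where "K0 = {y\<in>K. \<exists>M. lipschitz_joined K M x0 y}"
  have refl: "lipschitz_joined K (L x) x x" if "x \<in> K" for x using rL[OF that] that by simp
  have x0: "x0 \<in> K0" unfolding K0_def using K(2) refl by blast
  have op: "y \<in> K0" if "x \<in> K0" "y \<in> ball x (r x)" "y \<in> K" for x y
    using that rL(2)[of x y] lipschitz_joined_trans unfolding K0_def by blast
  have "closed K0"
    unfolding closed_limpt
  proof (intro allI impI)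
    fix y assume y: "y islimpt K0"
    then have "y islimpt K" unfolding K0_def by (rule islimpt_subset) auto
    then have yK: "y \<in> K" using compact_imp_closed[OF K(1)] closed_limpt by blast
    \<comment> \<open>The arcs issuing from the limit point \<open>y\<close> itself reach a point of
      \<open>K0\<close>; reversing one of them joins \<open>x0\<close> to \<open>y\<close>.\<close>
    obtain y' where "y' \<in> K0" "dist y' y < r y" using y rL(1)[OF yK] unfolding islimpt_approachable by blast
    then show "y \<in> K0"
      using rL(2)[OF yK, of y'] yK lipschitz_joined_sym lipschitz_joined_trans unfolding K0_def
      by (auto simp: dist_commute) blast
  qed
  moreover have "K0 = K \<inter> K0" unfolding K0_def by blast
  ultimately have cpt: "compact K0" using compact_Int_closed[OF K(1)] by metis
  have "K0 \<subseteq> (\<Union>x\<in>K0. ball x (r x))" using rL(1) unfolding K0_def by force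
  then obtain Q where Q: "Q \<subseteq> K0" "finite Q" "K0 \<subseteq> (\<Union>x\<in>Q. ball x (r x))"
    using compactE_image[OF cpt, of K0 "\<lambda>x. ball x (r x)"] by (metis open_ball)
  have "\<forall>q\<in>K0. \<exists>M. lipschitz_joined K M x0 q" unfolding K0_def by blast
  then obtain M where M: "\<And>q. q \<in> K0 \<Longrightarrow> lipschitz_joined K (M q) x0 q" by metis
  define B where "B = Max (insert 0 ((\<lambda>q. 2 * (M q + L q)) ` Q))"
  have "lipschitz_joined K B x0 y" if y: "y \<in> K0" for y
  proof -
    obtain q where q: "q \<in> Q" "y \<in> ball q (r q)" using Q(3) y by blast
    then have "lipschitz_joined K (L q) q y" using rL(2)[of q y] Q(1) y unfolding K0_def by blast
    with M[of q] have "lipschitz_joined K (2 * (M q + L q)) x0 y" using q(1) Q(1) lipschitz_joined_trans by blast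
    moreover have "2 * (M q + L q) \<le> B" unfolding B_def using Q(2) q(1) by (intro Max_ge) auto
    ultimately show ?thesis by (rule lipschitz_joined_mono)
  qed
  moreover have "\<exists>\<rho>>0. \<forall>y\<in>ball x \<rho>. y \<in> K \<longrightarrow> y \<in> K0" if "x \<in> K0" for x
  proof (intro exI[of _ "r x"] conjI)
    show "r x > 0" using rL(1) that unfolding K0_def by blast
  qed (use op that in blast)
  moreover have "K0 \<subseteq> K" unfolding K0_def by blast
  ultimately show ?thesis using x0 cpt by (intro exI[of _ K0] exI[of _ B]) blast
qed

section \<open>Real slices and transport by the action\<close>

lemma peval_weighted_zero:
  assumes "weighted_homogeneous w f" "t \<noteq> 0" "peval f a b c = 0"
  shows "peval f (t ^ (w $ 1) * a) (t ^ (w $ 2) * b) (t ^ (w $ 3) * c) = 0"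
proof -
  define z :: "complex^3" where "z = vector [of_real a, of_real b, of_real c]"
  have "z \<in> complex_zeros f"
    unfolding complex_zeros_eq z_def using assms(3) by (simp add: peval_complexify)
  then have "weighted_action w (of_real t) z \<in> complex_zeros f"
    using weighted_action_in_complex_zeros[OF assms(1), of "of_real t"] assms(2) by simp
  then have "peval (complexify f) (of_real (t ^ (w $ 1) * a)) (of_real (t ^ (w $ 2) * b)) (of_real (t ^ (w $ 3) * c)) = 0"
    unfolding complex_zeros_eq weighted_action_def z_def by simp
  then show ?thesis unfolding peval_complexify by simp
qed

lemma continuous_on_peval:
  fixes p :: "(3, 'a::real_normed_field) mpoly"
  assumes "continuous_on S a" "continuous_on S b" "continuous_on S c"
  shows "continuous_on S (\<lambda>x. peval p (a x) (b x) (c x))"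
  unfolding peval_def using assms by (intro continuous_intros)

text \<open>On the weighted unit cube the third coordinate of a nonzero real zero is bounded away from \<open>0\<close>;
  the weighted action spreads this to the whole slice.\<close>

lemma bounded_real_slice:
  assumes w: "\<forall>i. 0 < w $ i" and hom: "weighted_homogeneous w f" and c: "c \<noteq> 0"
    and axes: "\<And>a b. peval f a b 0 = 0 \<Longrightarrow> a = 0 \<and> b = 0"
  shows "bounded {x. peval f (fst x) (snd x) c = 0}"
proof -
  \<comment> \<open>The maximum norm. Real zeros of norm 1 form a compact set \<open>S\<close>, on
    which \<open>axes\<close> prevents the third coordinate from vanishing.\<close>
  define M where "M = (\<lambda>u::real \<times> real \<times> real. max \<bar>fst u\<bar> (max \<bar>fst (snd u)\<bar> \<bar>snd (snd u)\<bar>))"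
  define S where "S = {u. peval f (fst u) (fst (snd u)) (snd (snd u)) = 0} \<inter> {u. M u = 1}"
  have contM: "continuous_on A M" for A unfolding M_def by (intro continuous_intros)
  have "closed S"
    unfolding S_def using contM
    by (intro closed_Int closed_Collect_eq continuous_on_peval continuous_intros)
  moreover have "S \<subseteq> {-1..1} \<times> {-1..1} \<times> {-1..1}"
  proof
    fix u assume "u \<in> S"
    then have "\<bar>fst u\<bar> \<le> 1" "\<bar>fst (snd u)\<bar> \<le> 1" "\<bar>snd (snd u)\<bar> \<le> 1" unfolding S_def M_def by auto
    then show "u \<in> {-1..1} \<times> {-1..1} \<times> {-1..1}" by (simp add: mem_Times_iff abs_le_iff)
  qed
  ultimately have "compact S"
    using compact_Int_closed[of "{-1..1} \<times> {-1..1} \<times> {-1..1::real}" S] by (simp add: compact_Times inf.absorb2)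
  have "\<exists>\<beta>>0. \<forall>u\<in>S. \<beta> \<le> \<bar>snd (snd u)\<bar>"
  proof (cases "S = {}")
    case False
    have "continuous_on S (\<lambda>u. \<bar>snd (snd u)\<bar>)" by (intro continuous_intros)
    then obtain u where u: "u \<in> S" "\<And>v. v \<in> S \<Longrightarrow> \<bar>snd (snd u)\<bar> \<le> \<bar>snd (snd v)\<bar>"
      using continuous_attains_inf[OF \<open>compact S\<close> False] by blast
    have "snd (snd u) \<noteq> 0"
    proof
      assume "snd (snd u) = 0"
      with u(1) axes[of "fst u" "fst (snd u)"] show False unfolding S_def M_def by auto
    qed
    then show ?thesis using u(2) by (intro exI[of _ "\<bar>snd (snd u)\<bar>"]) simp
  qed (auto intro: exI[of _ 1])
  then obtain \<beta> where \<beta>: "\<beta> > 0" "\<And>u. u \<in> S \<Longrightarrow> \<beta> \<le> \<bar>snd (snd u)\<bar>" by blast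
  define \<tau> where "\<tau> = \<beta> / \<bar>c\<bar>"
  have \<tau>: "\<tau> > 0" unfolding \<tau>_def using \<beta>(1) c by simp
  have "norm x \<le> 2 + 1 / \<tau> ^ (w $ 1) + 1 / \<tau> ^ (w $ 2)" if x: "peval f (fst x) (snd x) c = 0" for x
  proof -
    \<comment> \<open>A point of norm above 1 is contracted by the action until the norm is 1. Its
      third coordinate is then \<open>t ^ (w $ 3) * c\<close>, of modulus at least
      \<open>\<beta>\<close>; so \<open>t\<close> is bounded below, and the original point cannot be
      far out.\<close>
    define m where "m = (\<lambda>t. M (t ^ (w $ 1) * fst x, t ^ (w $ 2) * snd x, t ^ (w $ 3) * c))"
    have pos: "1 / \<tau> ^ (w $ 1) > 0" "1 / \<tau> ^ (w $ 2) > 0" using \<tau> by auto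
    have "\<bar>fst x\<bar> \<le> 1 + 1 / \<tau> ^ (w $ 1) \<and> \<bar>snd x\<bar> \<le> 1 + 1 / \<tau> ^ (w $ 2)"
    proof (cases "m 1 \<le> 1")
      case True
      then have "\<bar>fst x\<bar> \<le> 1" "\<bar>snd x\<bar> \<le> 1" unfolding m_def M_def by auto
      then show ?thesis using pos by linarith
    next
      case False
      have "m 0 = 0" unfolding m_def M_def using w by (simp add: zero_power)
      moreover have "continuous_on {0..1} m"
        unfolding m_def by (intro continuous_on_compose2[OF contM[of UNIV]] continuous_intros) auto
      ultimately obtain t where t: "0 \<le> t" "t \<le> 1" "m t = 1"
        using IVT'[of m 0 1 1] False by auto
      then have t0: "t > 0" using \<open>m 0 = 0\<close> by (cases "t = 0") auto
      have "(t ^ (w $ 1) * fst x, t ^ (w $ 2) * snd x, t ^ (w $ 3) * c) \<in> S"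
        using t(3) peval_weighted_zero[OF hom _ x] t0 unfolding S_def m_def by simp
      from \<beta>(2)[OF this] have "\<beta> \<le> t ^ (w $ 3) * \<bar>c\<bar>" using t0 by (simp add: abs_mult)
      then have "\<tau> \<le> t ^ (w $ 3)" unfolding \<tau>_def using c by (simp add: divide_le_eq)
      also have "\<dots> \<le> t ^ 1" using t w by (intro power_decreasing) (auto simp: Suc_leI)
      finally have \<tau>t: "\<tau> \<le> t" by simp
      have *: "\<bar>a\<bar> \<le> 1 / \<tau> ^ n" if "\<bar>t ^ n * a\<bar> \<le> 1" for a n
      proof -
        have "\<tau> ^ n * \<bar>a\<bar> \<le> t ^ n * \<bar>a\<bar>" using \<tau> \<tau>t by (intro mult_right_mono power_mono) auto
        also have "\<dots> \<le> 1" using that t0 by (simp add: abs_mult)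
        finally show ?thesis using \<tau> by (simp add: le_divide_eq mult.commute)
      qed
      have "\<bar>t ^ (w $ 1) * fst x\<bar> \<le> 1" "\<bar>t ^ (w $ 2) * snd x\<bar> \<le> 1"
        using t(3) unfolding m_def M_def by auto
      then show ?thesis using *[of "w $ 1" "fst x"] *[of "w $ 2" "snd x"] by linarith
    qed
    moreover have "norm x \<le> \<bar>fst x\<bar> + \<bar>snd x\<bar>"
      by (metis norm_Pair prod.collapse real_norm_def sqrt_sum_squares_le_sum_abs real_sqrt_abs power2_abs)
    ultimately show ?thesis by linarith
  qed
  then show ?thesis unfolding bounded_iff by blast
qed

definition slice_lift :: "nat^3 \<Rightarrow> real \<Rightarrow> real \<Rightarrow> real \<times> real \<Rightarrow> complex^3" where
  "slice_lift w c t x = vector [of_real (t ^ (w $ 1) * fst x), of_real (t ^ (w $ 2) * snd x), of_real (t ^ (w $ 3) * c)]"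

text \<open>\<open>\<tau>\<close> is the principal root of order \<open>w $ 3\<close> of
  \<open>y $ 3 / c\<close>. Acting by its inverse brings the third coordinate to \<open>c\<close>,
  and that coordinate is then dropped.\<close>

definition slice_retraction :: "nat^3 \<Rightarrow> real \<Rightarrow> complex^3 \<Rightarrow> complex \<times> complex" where
  "slice_retraction w c y = (let \<tau> = exp (Ln (y $ 3 / of_real c) / of_nat (w $ 3)) in
     (y $ 1 / \<tau> ^ (w $ 1), y $ 2 / \<tau> ^ (w $ 2)))"

lemma slice_lift_eq_action: "slice_lift w c t x = weighted_action w (of_real t) (vector [of_real (fst x), of_real (snd x), of_real c])"
  unfolding slice_lift_def weighted_action_def vec_eq_iff forall_3 by simp

lemma slice_lift_in_complex_zeros:
  assumes "weighted_homogeneous w f" "t \<noteq> 0" "peval f (fst x) (snd x) c = 0"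
  shows "slice_lift w c t x \<in> complex_zeros f"
  unfolding slice_lift_eq_action using assms
  by (simp add: weighted_action_in_complex_zeros) (simp add: complex_zeros_eq peval_complexify)

lemma norm_complex3: "norm (z :: complex^3) = sqrt ((norm (z $ 1))\<^sup>2 + (norm (z $ 2))\<^sup>2 + (norm (z $ 3))\<^sup>2)"
  by (simp add: norm_vec_def L2_set_def sum_3)

text \<open>The third coordinate is common to both points, so only the weights \<open>w $ 1\<close>
  and \<open>w $ 2\<close> enter. This is the source of the fast shrinking.\<close>

lemma dist_slice_lift_le:
  assumes t: "0 \<le> t" "t \<le> 1" and q: "q \<le> w $ 1" "q \<le> w $ 2"
  shows "dist (slice_lift w c t x) (slice_lift w c t y) \<le> t ^ q * dist x y"
proof -
  have pw: "t ^ (w $ 1) \<le> t ^ q" "t ^ (w $ 2) \<le> t ^ q" using t q by (auto intro: power_decreasing)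
  have sq: "(t ^ k * a)\<^sup>2 \<le> (t ^ q)\<^sup>2 * a\<^sup>2" if "t ^ k \<le> t ^ q" for k a
    unfolding power_mult_distrib using that t by (intro mult_right_mono power_mono) auto
  have "dist (slice_lift w c t x) (slice_lift w c t y) =
      sqrt ((t ^ (w $ 1) * (fst x - fst y))\<^sup>2 + (t ^ (w $ 2) * (snd x - snd y))\<^sup>2)"
    unfolding dist_norm norm_complex3 slice_lift_def
    by (simp flip: of_real_mult of_real_diff of_real_power right_diff_distrib)
  also have "\<dots> \<le> sqrt ((t ^ q)\<^sup>2 * (fst x - fst y)\<^sup>2 + (t ^ q)\<^sup>2 * (snd x - snd y)\<^sup>2)"
    by (intro real_sqrt_le_mono add_mono sq pw)
  also have "\<dots> = sqrt ((t ^ q)\<^sup>2 * ((fst x - fst y)\<^sup>2 + (snd x - snd y)\<^sup>2))" by (simp add: algebra_simps)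
  also have "\<dots> = t ^ q * dist x y"
    unfolding real_sqrt_mult using t by (simp add: dist_prod_def dist_real_def)
  finally show ?thesis .
qed

lemma norm_slice_lift_le:
  assumes w: "\<forall>i. 0 < w $ i" and t: "0 \<le> t" "t \<le> 1"
  shows "norm (slice_lift w c t x) \<le> t * (\<bar>fst x\<bar> + \<bar>snd x\<bar> + \<bar>c\<bar>)"
proof -
  have "norm (slice_lift w c t x) \<le> (\<Sum>i\<in>UNIV. norm (slice_lift w c t x $ i))"
    unfolding norm_vec_def by (rule L2_set_le_sum) simp
  also have "\<dots> = t ^ (w $ 1) * \<bar>fst x\<bar> + t ^ (w $ 2) * \<bar>snd x\<bar> + t ^ (w $ 3) * \<bar>c\<bar>"
    unfolding sum_3 slice_lift_def using t by (simp add: norm_mult norm_power)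
  also have "\<dots> \<le> t ^ 1 * \<bar>fst x\<bar> + t ^ 1 * \<bar>snd x\<bar> + t ^ 1 * \<bar>c\<bar>"
    using t w by (intro add_mono mult_right_mono power_decreasing) (auto simp: Suc_leI)
  finally show ?thesis by (simp add: algebra_simps)
qed

lemma norm_slice_lift_ge:
  assumes "0 \<le> t"
  shows "t ^ (w $ 3) * \<bar>c\<bar> \<le> norm (slice_lift w c t x)"
proof -
  have "norm (slice_lift w c t x $ 3) = t ^ (w $ 3) * \<bar>c\<bar>"
    unfolding slice_lift_def using assms by (simp add: norm_mult norm_power)
  then show ?thesis using Finite_Cartesian_Product.norm_nth_le[of "slice_lift w c t x" 3] by simp
qed

text \<open>On the positive real number \<open>t ^ (w $ 3)\<close> the principal root returns
  \<open>t\<close> itself, so the retraction undoes the action exactly.\<close>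

lemma slice_retraction_slice_lift:
  assumes w: "0 < w $ 3" and t: "0 < t" and c: "c \<noteq> 0"
  shows "slice_retraction w c (slice_lift w c t x) = cpair x"
proof -
  have "slice_lift w c t x $ 3 / of_real c = of_real (t ^ (w $ 3))"
    unfolding slice_lift_def using c by simp
  then have "Ln (slice_lift w c t x $ 3 / of_real c) / of_nat (w $ 3) = of_real (ln t)"
    using t w by (simp add: Ln_of_real ln_realpow del: of_real_power)
  then have "exp (Ln (slice_lift w c t x $ 3 / of_real c) / of_nat (w $ 3)) = of_real t"
    using t by (simp add: exp_of_real)
  then show ?thesis
    unfolding slice_retraction_def slice_lift_def cpair_def Let_def using t by simp
qed

lemma slice_retraction_in_slice:
  assumes w: "0 < w $ 3" and c: "c \<noteq> 0" and hom: "weighted_homogeneous w f"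
    and y: "y \<in> complex_zeros f" "y $ 3 \<noteq> 0"
  shows "peval (complexify f) (fst (slice_retraction w c y)) (snd (slice_retraction w c y)) (of_real c) = 0"
proof -
  define \<tau> where "\<tau> = exp (Ln (y $ 3 / of_real c) / of_nat (w $ 3))"
  have "\<tau> ^ (w $ 3) = y $ 3 / of_real c"
    unfolding \<tau>_def using w c y(2) by (simp flip: exp_of_nat_mult)
  then have "y $ 3 / \<tau> ^ (w $ 3) = of_real c" using c y(2) by simp
  moreover have "weighted_action w (1 / \<tau>) y \<in> complex_zeros f"
    using weighted_action_in_complex_zeros[OF hom, of "1 / \<tau>"] y(1) by (simp add: \<tau>_def)
  ultimately show ?thesis
    unfolding complex_zeros_eq weighted_action_def slice_retraction_def Let_def \<tau>_def[symmetric]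
    by (simp add: power_one_over)
qed

text \<open>The domain avoids the branch cut of \<open>Ln\<close>. For weight 0 the exponent is the
  constant 0, since division by 0 yields 0.\<close>

lemma continuous_on_slice_retraction:
  "c \<noteq> 0 \<Longrightarrow> continuous_on {y. y $ 3 / of_real c \<notin> \<real>\<^sub>\<le>\<^sub>0} (slice_retraction w c)"
  unfolding slice_retraction_def Let_def
  by (cases "w $ 3 = 0") (auto intro!: continuous_intros)

lemma closed_complex_zeros: "closed (complex_zeros f)"
  unfolding complex_zeros_eq
  by (intro closed_Collect_eq continuous_on_peval continuous_on_const continuous_intros)

lemma inner_dist_apex_le:
  assumes N: "N \<subseteq> unit_sphere m" and z: "z \<in> cone_over N"
  shows "inner_dist (euclid_dist m) (cone_over N) (\<lambda>i. 0) z \<le> ennreal (euclid_dist m z (\<lambda>i. 0))"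
proof (rule inner_dist_le_of_lipschitz_path[where \<gamma>="\<lambda>s i. s * z i"])
  show "path (\<lambda>s i. s * z i)"
    unfolding path_def by (intro continuous_on_coordinatewise_then_product continuous_intros)
  obtain r y where ry: "z = (\<lambda>i. r * y i)" "0 \<le> r" "r \<le> 1" "y \<in> N" using z unfolding cone_over_def by auto
  show "path_image (\<lambda>s i. s * z i) \<subseteq> cone_over N"
  proof
    fix v assume "v \<in> path_image (\<lambda>s i. s * z i)"
    then obtain s where s: "s \<in> {0..1}" "v = (\<lambda>i. s * z i)" unfolding path_image_def by blast
    then have "v = (\<lambda>i. (s * r) * y i)" "0 \<le> s * r" "s * r \<le> 1"
      using ry by (auto simp: mult_le_one)
    then show "v \<in> cone_over N" unfolding cone_over_def using ry(4) by blast
  qed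
  show "euclid_dist m (\<lambda>i. s * z i) (\<lambda>i. t * z i) \<le> euclid_dist m z (\<lambda>i. 0) * \<bar>s - t\<bar>" for s t
    by (simp add: euclid_dist_scale_diff)
qed (simp_all add: pathstart_def pathfinish_def)

section \<open>Fast loops\<close>

lemma fast_loops_not_metrically_conic:
  fixes w :: "nat^3" and f :: "(3, real) mpoly"
  assumes w: "\<forall>i. 0 < w $ i" and hom: "weighted_homogeneous w f"
    and iso: "0 isolated_in surface_singular_locus (complex_zeros f)"
    and w3: "w $ 3 < w $ 1" "w $ 3 < w $ 2"
    and axes: "\<And>a b. peval f a b 0 = 0 \<Longrightarrow> a = 0 \<and> b = 0"
    and zero: "peval f a b c = 0" "c \<noteq> 0"
    and conic: "metrically_conic (complex_zeros f) 0"
  shows False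
proof -
  define X where "X = complex_zeros f"
  define q where "q = min (w $ 1) (w $ 2)"
  have q: "q \<le> w $ 1" "q \<le> w $ 2" "w $ 3 < q" unfolding q_def using w3 by auto
  have "peval (complexify f) (of_real a) (of_real b) (of_real c) = 0"
    using zero(1) by (simp add: peval_complexify)
  then obtain G where G: "\<And>x y::complex. eval2 G x y = 0 \<longleftrightarrow> peval (complexify f) x y (of_real c) = 0"
    "\<And>x y::complex. eval2 G x y = 0 \<Longrightarrow> \<not> ((\<lambda>z. eval2 G (fst z) (snd z)) has_derivative (\<lambda>_. 0)) (at (x, y))"
    using exists_reduced_slice[OF w hom zero(2) iso] by blast
  define ev where "ev = (\<lambda>P (z::complex \<times> complex). eval2 P (fst z) (snd z))"
  have parts: "\<exists>P1 P2. has_partials (ev P) (ev P1) (ev P2)" for P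
    using eval2_partial_derivatives[where 'a=complex, of P] unfolding has_partials_def ev_def by simp
  obtain A B where gAB: "has_partials (ev G) (ev A) (ev B)" using parts by blast
  obtain A1 A2 where pA: "has_partials (ev A) (ev A1) (ev A2)" using parts by blast
  obtain B1 B2 where pB: "has_partials (ev B) (ev B1) (ev B2)" using parts by blast
  have smooth: "ev A z \<noteq> 0 \<or> ev B z \<noteq> 0" if "ev G z = 0" for z
  proof (rule ccontr)
    assume "\<not> ?thesis"
    then have "(ev G has_derivative (\<lambda>_. 0)) (at z)" using has_partialsD[OF gAB, of z UNIV] by simp
    then show False using G(2)[of "fst z" "snd z"] that unfolding ev_def by simp
  qed
  have ev_cpair: "ev P (cpair x) = of_real (eval2 P (fst x) (snd x))" for P x
    unfolding ev_def cpair_def by (simp add: eval2_of_real)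
  have evG: "ev G z = 0 \<longleftrightarrow> peval (complexify f) (fst z) (snd z) (of_real c) = 0" for z
    unfolding ev_def by (rule G(1))
  have evG_cpair: "ev G (cpair x) = 0 \<longleftrightarrow> peval f (fst x) (snd x) c = 0" for x
    unfolding evG cpair_def by (simp add: peval_complexify)

  define K where "K = {x. peval f (fst x) (snd x) c = 0}"
  have "closed K"
    unfolding K_def by (intro closed_Collect_eq continuous_on_peval continuous_intros)
  moreover have bK: "bounded K" unfolding K_def by (rule bounded_real_slice[OF w hom zero(2) axes])
  ultimately have "compact K" by (simp add: compact_eq_bounded_closed)
  have KG: "K = {x. Re (ev G (cpair x)) = 0}"
    unfolding K_def evG_cpair[symmetric] by (simp add: ev_cpair)
  have cont: "continuous_on UNIV (\<lambda>x. Re (ev P (cpair x)))" if "has_partials (ev P) p1 p2" for P p1 p2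
    by (intro continuous_on_Re continuous_on_compose2[OF has_partials_imp_continuous_on[OF that, of UNIV]]
        continuous_on_cpair) simp
  have arcs: "\<exists>r>0. \<exists>L. \<forall>y\<in>ball x r. y \<in> K \<longrightarrow> lipschitz_joined K L x y" if x: "x \<in> K" for x
  proof -
    have "Re (ev G (cpair x)) = 0" using x KG by blast
    moreover have "Re (ev A (cpair x)) \<noteq> 0 \<or> Re (ev B (cpair x)) \<noteq> 0"
      using smooth[of "cpair x"] x unfolding K_def evG_cpair[symmetric] by (simp add: ev_cpair)
    ultimately show ?thesis
      using level_curve_lipschitz_arcs[OF has_partials_Re_cpair[OF gAB] cont[OF pA] cont[OF pB]]
      unfolding lipschitz_joined_def KG by simp
  qed
  have "(a, b) \<in> K" unfolding K_def using zero(1) by simp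
  \<comment> \<open>\<open>K0\<close> is open in the real slice, as the obstruction demands, and
    \<open>L\<close> bounds the arcs from \<open>(a, b)\<close> uniformly.\<close>
  then obtain K0 L where K0: "(a, b) \<in> K0" "K0 \<subseteq> K" "compact K0"
    "\<And>x. x \<in> K0 \<Longrightarrow> \<exists>r>0. \<forall>y\<in>ball x r. y \<in> K \<longrightarrow> y \<in> K0"
    and joined: "\<And>y. y \<in> K0 \<Longrightarrow> lipschitz_joined K L (a, b) y"
    using exists_lipschitz_component[OF \<open>compact K\<close> _ arcs] by metis
  define x1 where "x1 = (a, b)"
  have x1: "x1 \<in> K0" "x1 \<in> K" using K0 unfolding x1_def by auto
  have L: "0 \<le> L" using joined[OF K0(1)] lipschitz_on_nonneg unfolding lipschitz_joined_def by blast

  obtain R0 where R0: "\<And>x. x \<in> K \<Longrightarrow> norm x \<le> R0" using bK unfolding bounded_iff by blast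
  \<comment> \<open>Arranged so that \<open>S t x\<close> has norm at most \<open>t * R\<close> for
    all \<open>x\<close> in \<open>K\<close>.\<close>
  define R where "R = 2 * R0 + \<bar>c\<bar>"
  have R: "\<bar>fst x\<bar> + \<bar>snd x\<bar> + \<bar>c\<bar> \<le> R" if "x \<in> K" for x
    using R0[OF that] norm_fst_le[of "fst x" "snd x"] norm_snd_le[of "snd x" "fst x"] unfolding R_def by simp

  obtain \<epsilon>0 where \<epsilon>0: "\<epsilon>0 > 0" "\<And>\<epsilon>. 0 < \<epsilon> \<Longrightarrow> \<epsilon> < \<epsilon>0 \<Longrightarrow>
        (\<exists>m N h h'. nash_manifold m N \<and> N \<subseteq> unit_sphere m \<and>
           homeomorphism (cone_over N) (X \<inter> cball 0 \<epsilon>) h h' \<and>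
           bi_lipschitz_on (cone_over N)
             (inner_dist (euclid_dist m) (cone_over N)) (inner_dist dist (X \<inter> cball 0 \<epsilon>)) h)"
    using conic unfolding metrically_conic_def X_def by blast
  define \<epsilon> where "\<epsilon> = \<epsilon>0 / 2"
  have \<epsilon>: "0 < \<epsilon>" "\<epsilon> < \<epsilon>0" unfolding \<epsilon>_def using \<epsilon>0(1) by auto
  define Y where "Y = X \<inter> cball 0 \<epsilon>"
  obtain m N h h' where nash: "nash_manifold m N" and N: "N \<subseteq> unit_sphere m"
    and homeo: "homeomorphism (cone_over N) Y h h'"
    and bl: "bi_lipschitz_on (cone_over N) (inner_dist (euclid_dist m) (cone_over N)) (inner_dist dist Y) h"
    using \<epsilon>0(2)[OF \<epsilon>] unfolding Y_def by blast
  obtain k where sub: "smooth_submanifold m k N" using nash unfolding nash_manifold_def by blast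
  let ?dN = "inner_dist (euclid_dist m) (cone_over N)" and ?dY = "inner_dist dist Y"
  let ?n = "\<lambda>x. euclid_dist m x (\<lambda>i. 0)"
  obtain \<Lambda> where \<Lambda>: "\<Lambda> > 0" "\<And>u v. u \<in> cone_over N \<Longrightarrow> v \<in> cone_over N \<Longrightarrow> ?dY (h u) (h v) \<le> ennreal \<Lambda> * ?dN u v"
    "\<And>u v. u \<in> cone_over N \<Longrightarrow> v \<in> cone_over N \<Longrightarrow> ?dN u v \<le> ennreal \<Lambda> * ?dY (h u) (h v)"
    using bl unfolding bi_lipschitz_on_def by blast
  have h: "\<And>y. y \<in> Y \<Longrightarrow> h' y \<in> cone_over N" "\<And>y. y \<in> Y \<Longrightarrow> h (h' y) = y"
    "\<And>u. u \<in> cone_over N \<Longrightarrow> h u \<in> Y"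
    "continuous_on (cone_over N) h" "continuous_on Y h'" "h' ` Y = cone_over N"
    using homeo unfolding homeomorphism_def by blast+
  have "compact Y" unfolding Y_def X_def by (simp add: closed_complex_zeros closed_Int_compact)
  then have "compact (cone_over N)" using compact_continuous_image[OF h(5)] h(6) by simp
  then have "compact N" by (rule compact_cone_base[OF N])
  obtain c0 C where c0: "c0 > 0" and C: "C \<ge> 0"
    and contract: "\<And>z \<delta>. z \<in> cone_over N \<Longrightarrow> \<delta> > 0 \<Longrightarrow> \<delta> \<le> c0 * ?n z \<Longrightarrow>
    (\<exists>\<Theta>. continuous_on ({v\<in>cone_over N. euclid_dist m z v \<le> \<delta>} \<times> {0..1::real}) \<Theta> \<and>
      (\<forall>v\<in>cone_over N. euclid_dist m z v \<le> \<delta> \<longrightarrow> \<Theta> (v, 0) = z \<and> \<Theta> (v, 1) = v \<and>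
        (\<forall>t\<in>{0..1}. \<Theta> (v, t) \<in> cone_over N \<and> ?dN z (\<Theta> (v, t)) \<le> ennreal (C * \<delta>))))"
    using cone_linear_contraction[OF sub \<open>compact N\<close> N] by blast

  define S where "S = slice_lift w c"
  have SY: "S t x \<in> Y" if "x \<in> K" "0 < t" "t \<le> 1" "t * R \<le> \<epsilon>" for t x
  proof -
    have "S t x \<in> X" unfolding S_def X_def
      using that(1,2) by (intro slice_lift_in_complex_zeros[OF hom]) (auto simp: K_def)
    moreover have "norm (S t x) \<le> t * (\<bar>fst x\<bar> + \<bar>snd x\<bar> + \<bar>c\<bar>)"
      unfolding S_def using that by (intro norm_slice_lift_le[OF w]) auto
    then have "norm (S t x) \<le> \<epsilon>" using mult_left_mono[OF R[OF that(1)], of t] that by linarith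
    ultimately show ?thesis unfolding Y_def by simp
  qed
  \<comment> \<open>The action moves an arc of \<open>K\<close> from \<open>x1\<close> to
    \<open>x\<close> into \<open>Y\<close> and scales its speed by at most
    \<open>t ^ q\<close>.\<close>
  have short: "?dY (S t x1) (S t x) \<le> ennreal (t ^ q * L)"
    if x: "x \<in> K0" and t: "0 < t" "t \<le> 1" "t * R \<le> \<epsilon>" for t x
  proof -
    obtain \<gamma> where \<gamma>: "L-lipschitz_on {0..1::real} \<gamma>" "\<gamma> 0 = x1" "\<gamma> 1 = x" "\<gamma> ` {0..1} \<subseteq> K"
      using joined[OF x] unfolding lipschitz_joined_def x1_def by blast
    have lip: "dist (S t (\<gamma> s)) (S t (\<gamma> s')) \<le> t ^ q * L * \<bar>s - s'\<bar>" if "s \<in> {0..1}" "s' \<in> {0..1}" for s s'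
    proof -
      have "dist (S t (\<gamma> s)) (S t (\<gamma> s')) \<le> t ^ q * dist (\<gamma> s) (\<gamma> s')"
        unfolding S_def using t q by (intro dist_slice_lift_le) auto
      also have "\<dots> \<le> t ^ q * (L * dist s s')"
        using lipschitz_onD[OF \<gamma>(1) that] t by (intro mult_left_mono) auto
      finally show ?thesis by (simp add: dist_real_def mult.assoc)
    qed
    have "(t ^ q * L)-lipschitz_on {0..1} (\<lambda>s. S t (\<gamma> s))"
      using lip L t by (intro lipschitz_onI) (auto simp: dist_real_def)
    then have "path (\<lambda>s. S t (\<gamma> s))" unfolding path_def by (rule lipschitz_on_continuous_on)
    moreover have "S t (\<gamma> s) \<in> Y" if "s \<in> {0..1}" for s
      using \<gamma>(4) that by (intro SY[OF _ t]) blast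
    ultimately show ?thesis
      using lip L t \<gamma>(2,3)
      by (intro inner_dist_le_of_lipschitz_path[where \<gamma>="\<lambda>s. S t (\<gamma> s)"])
        (auto simp: path_image_def pathstart_def pathfinish_def)
  qed
  define z where "z = (\<lambda>t. h' (S t x1))"
  have X0: "0 \<in> Y"
  proof -
    have "((\<lambda>t. S t x1) \<longlongrightarrow> S 0 x1) (at_right 0)"
      unfolding S_def slice_lift_eq_action weighted_action_def by (intro tendsto_vec_lambda tendsto_intros)
    moreover have "S 0 x1 = 0"
      using norm_slice_lift_le[OF w, of 0 c x1] unfolding S_def by simp
    moreover have "\<forall>\<^sub>F t in at_right 0. S t x1 \<in> X"
      using eventually_at_right_less[of "0::real"]
    proof eventually_elim
      case (elim t)
      then show ?case unfolding S_def X_def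
        using x1(2) by (intro slice_lift_in_complex_zeros[OF hom]) (auto simp: K_def)
    qed
    ultimately have "0 \<in> X"
      using Lim_in_closed_set[OF closed_complex_zeros[of f], of "\<lambda>t. S t x1" "at_right 0" 0]
      unfolding X_def by simp
    then show ?thesis unfolding Y_def using \<epsilon> by simp
  qed
  have ev_small: "\<forall>\<^sub>F t in at_right 0. 0 < t \<and> t \<le> 1 \<and> t * R \<le> \<epsilon> \<and> t * r < s"
    if "s > 0" for r s :: real
  proof -
    have "((\<lambda>t. t * R) \<longlongrightarrow> 0 * R) (at_right 0)" "((\<lambda>t. t * r) \<longlongrightarrow> 0 * r) (at_right 0)"
      by (intro tendsto_intros)+
    then have "\<forall>\<^sub>F t in at_right 0. t * R < \<epsilon>" "\<forall>\<^sub>F t in at_right 0. t * r < s"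
      using \<epsilon>(1) that by (simp_all add: order_tendsto_iff)
    moreover have "\<forall>\<^sub>F t in at_right (0::real). t \<in> {0<..<1}"
      by (rule eventually_at_right_real) simp
    ultimately show ?thesis by eventually_elim auto
  qed
  \<comment> \<open>Integrality gives \<open>q \<ge> w $ 3 + 1\<close>; the spare factor
    \<open>t\<close> will absorb all constants.\<close>
  have pow: "t ^ q \<le> t ^ (w $ 3) * t" if "0 < t" "t \<le> 1" for t :: real
    using power_decreasing[of "Suc (w $ 3)" q t] q(3) that by (simp add: mult.commute)

  \<comment> \<open>The cone contraction requires its scale to be small against the distance of
    \<open>z t\<close> from the apex. Since \<open>h\<close> may send a point other than the apex to
    0, the position of \<open>h' 0\<close> is distinguished.\<close>
  have thick: "\<forall>\<^sub>F t in at_right 0. \<Lambda> * (t ^ q * (L + 1)) \<le> c0 * ?n (z t)"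
  proof (cases "?n (h' 0) = 0")
    case True
    have apex: "h' 0 = (\<lambda>i. 0)"
    proof -
      obtain r y where ry: "h' 0 = (\<lambda>i. r * y i)" "0 \<le> r" "y \<in> N"
        using h(1)[OF X0] unfolding cone_over_def by auto
      then have "r = 0" using norm_cone_over[OF N ry(3,2)] True by simp
      then show ?thesis using ry(1) by simp
    qed
    \<comment> \<open>The condition on \<open>t\<close> is the desired estimate divided by
      \<open>t ^ (w $ 3)\<close>. One \<open>\<Lambda>\<close> belongs to the scale, the other
      compares the distance from the apex with the distance from 0.\<close>
    have "\<forall>\<^sub>F t in at_right 0. 0 < t \<and> t \<le> 1 \<and> t * R \<le> \<epsilon> \<and> t * (\<Lambda> * \<Lambda> * (L + 1)) < c0 * \<bar>c\<bar>"
      using c0 zero(2) by (intro ev_small) simp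
    then show ?thesis
    proof eventually_elim
      case (elim t)
      then have SYt: "S t x1 \<in> Y" using SY[OF x1(2)] by blast
      have zt: "z t \<in> cone_over N" unfolding z_def by (rule h(1)[OF SYt])
      have "ennreal (dist 0 (S t x1)) \<le> ?dY (h (h' 0)) (h (z t))"
        unfolding z_def h(2)[OF X0] h(2)[OF SYt] by (rule dist_le_inner_dist)
      also have "\<dots> \<le> ennreal \<Lambda> * ?dN (h' 0) (z t)" by (rule \<Lambda>(2)[OF h(1)[OF X0] zt])
      also have "\<dots> \<le> ennreal \<Lambda> * ennreal (?n (z t))"
        unfolding apex by (intro mult_left_mono inner_dist_apex_le[OF N zt]) simp
      also have "\<dots> = ennreal (\<Lambda> * ?n (z t))" using \<Lambda>(1) by (simp add: ennreal_mult)
      finally have "norm (S t x1) \<le> \<Lambda> * ?n (z t)" using \<Lambda>(1) by (simp add: ennreal_le_iff)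
      moreover have "t ^ (w $ 3) * \<bar>c\<bar> \<le> norm (S t x1)" unfolding S_def using elim by (intro norm_slice_lift_ge) simp
      ultimately have low: "t ^ (w $ 3) * \<bar>c\<bar> \<le> \<Lambda> * ?n (z t)" by linarith
      have "\<Lambda> * (\<Lambda> * (t ^ q * (L + 1))) \<le> \<Lambda> * (\<Lambda> * ((t ^ (w $ 3) * t) * (L + 1)))"
        using pow[of t] elim \<Lambda>(1) L by (intro mult_left_mono mult_right_mono) auto
      also have "\<dots> = t ^ (w $ 3) * (t * (\<Lambda> * \<Lambda> * (L + 1)))" by (simp add: mult_ac)
      also have "\<dots> \<le> t ^ (w $ 3) * (c0 * \<bar>c\<bar>)" using elim by (intro mult_left_mono) auto
      also have "\<dots> = c0 * (t ^ (w $ 3) * \<bar>c\<bar>)" by simp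
      also have "\<dots> \<le> c0 * (\<Lambda> * ?n (z t))" using low c0 by (intro mult_left_mono) auto
      also have "\<dots> = \<Lambda> * (c0 * ?n (z t))" by simp
      finally show ?case using \<Lambda>(1) by simp
    qed
  next
    case False
    \<comment> \<open>Now \<open>z t\<close> tends to a point off the apex, so its norm stays above
      a positive constant while the scale tends to 0.\<close>
    then have pos: "?n (h' 0) > 0" using euclid_dist_nonneg[of m "h' 0" "\<lambda>i. 0"] by linarith
    have "((\<lambda>t. S t x1) \<longlongrightarrow> S 0 x1) (at_right 0)"
      unfolding S_def slice_lift_eq_action weighted_action_def by (intro tendsto_vec_lambda tendsto_intros)
    moreover have "S 0 x1 = 0"
      using norm_slice_lift_le[OF w, of 0 c x1] unfolding S_def by simp
    ultimately have lim: "((\<lambda>t. S t x1) \<longlongrightarrow> 0) (at_right 0)" by simp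
    have "\<forall>\<^sub>F t in at_right 0. 0 < t \<and> t \<le> 1 \<and> t * R \<le> \<epsilon> \<and> t * 0 < (1::real)"
      by (rule ev_small) simp
    then have inY: "\<forall>\<^sub>F t in at_right 0. S t x1 \<in> Y"
      by eventually_elim (use SY[OF x1(2)] in blast)
    have "continuous_on Y (\<lambda>y. ?n (h' y))"
      by (intro continuous_on_euclid_dist h(5) continuous_on_const)
    from continuous_on_tendsto_compose[OF this lim X0 inY]
    have "((\<lambda>t. ?n (z t)) \<longlongrightarrow> ?n (h' 0)) (at_right 0)" unfolding z_def .
    then have "\<forall>\<^sub>F t in at_right 0. ?n (h' 0) / 2 < ?n (z t)"
      by (rule order_tendstoD) (use pos in simp)
    moreover have "\<forall>\<^sub>F t in at_right 0. 0 < t \<and> t \<le> 1 \<and> t * R \<le> \<epsilon> \<and> t * (\<Lambda> * (L + 1)) < c0 * (?n (h' 0) / 2)"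
      using c0 pos by (intro ev_small) simp
    ultimately show ?thesis
    proof eventually_elim
      case (elim t)
      have "t ^ q \<le> t ^ 1" using elim q(3) by (intro power_decreasing) auto
      then have "\<Lambda> * (t ^ q * (L + 1)) \<le> \<Lambda> * (t * (L + 1))"
        using \<Lambda>(1) L by (intro mult_left_mono mult_right_mono) auto
      also have "\<dots> = t * (\<Lambda> * (L + 1))" by simp
      also have "\<dots> \<le> c0 * (?n (h' 0) / 2)" using elim by simp
      also have "\<dots> \<le> c0 * ?n (z t)" using elim c0 by (intro mult_left_mono) auto
      finally show ?case .
    qed
  qed
  \<comment> \<open>Keeps the contraction within \<open>t ^ (w $ 3) * \<bar>c\<bar>\<close> of
    \<open>S t x1\<close>: \<open>\<Lambda> * C\<close> comes from mapping the cone estimate to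
    \<open>X\<close>, and \<open>\<Lambda> * (L + 1)\<close> from the scale.\<close>
  have "\<forall>\<^sub>F t in at_right 0. 0 < t \<and> t \<le> 1 \<and> t * R \<le> \<epsilon> \<and> t * (\<Lambda> * C * \<Lambda> * (L + 1)) < \<bar>c\<bar>"
    using zero(2) by (intro ev_small) simp
  with thick have "\<forall>\<^sub>F t in at_right 0. (0 < t \<and> t \<le> 1 \<and> t * R \<le> \<epsilon> \<and> t * (\<Lambda> * C * \<Lambda> * (L + 1)) < \<bar>c\<bar>) \<and>
      \<Lambda> * (t ^ q * (L + 1)) \<le> c0 * ?n (z t)"
    by eventually_elim blast
  then obtain t where t: "0 < t" "t \<le> 1" "t * R \<le> \<epsilon>" "t * (\<Lambda> * C * \<Lambda> * (L + 1)) < \<bar>c\<bar>"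
    and \<delta>c: "\<Lambda> * (t ^ q * (L + 1)) \<le> c0 * ?n (z t)"
    using eventually_happens'[OF trivial_limit_at_right_real] by blast

  \<comment> \<open>\<open>L + 1\<close> rather than \<open>L\<close> keeps the scale positive when
    \<open>L = 0\<close>.\<close>
  define \<delta> where "\<delta> = \<Lambda> * (t ^ q * (L + 1))"
  have \<delta>: "\<delta> > 0" unfolding \<delta>_def using \<Lambda>(1) t(1) L by simp
  have SYt: "S t x \<in> Y" if "x \<in> K" for x using SY[OF that t(1-3)] .
  have zt: "z t \<in> cone_over N" "h (z t) = S t x1"
    unfolding z_def using h(1,2) SYt[OF x1(2)] by auto
  obtain \<Theta> where \<Theta>: "continuous_on ({v\<in>cone_over N. euclid_dist m (z t) v \<le> \<delta>} \<times> {0..1::real}) \<Theta>"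
    "\<And>v. v \<in> cone_over N \<Longrightarrow> euclid_dist m (z t) v \<le> \<delta> \<Longrightarrow> \<Theta> (v, 0) = z t \<and> \<Theta> (v, 1) = v \<and>
        (\<forall>s\<in>{0..1}. \<Theta> (v, s) \<in> cone_over N \<and> ?dN (z t) (\<Theta> (v, s)) \<le> ennreal (C * \<delta>))"
    using contract[OF zt(1) \<delta> \<delta>c[folded \<delta>_def]] by blast
  define v where "v = (\<lambda>x. h' (S t x))"
  have v: "v x \<in> cone_over N" "h (v x) = S t x" "euclid_dist m (z t) (v x) \<le> \<delta>" if x: "x \<in> K0" for x
  proof -
    have xK: "x \<in> K" using x K0(2) by blast
    show vx: "v x \<in> cone_over N" "h (v x) = S t x" unfolding v_def using h(1,2) SYt[OF xK] by auto
    have "ennreal (euclid_dist m (z t) (v x)) \<le> ?dN (z t) (v x)" by (rule dist_le_inner_dist)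
    also have "\<dots> \<le> ennreal \<Lambda> * ?dY (h (z t)) (h (v x))" by (rule \<Lambda>(3)[OF zt(1) vx(1)])
    also have "\<dots> \<le> ennreal \<Lambda> * ennreal (t ^ q * L)"
      unfolding zt(2) vx(2) by (intro mult_left_mono short[OF x t(1-3)]) simp
    also have "\<dots> = ennreal (\<Lambda> * (t ^ q * L))" using \<Lambda>(1) L t(1) by (simp add: ennreal_mult)
    finally have "euclid_dist m (z t) (v x) \<le> \<Lambda> * (t ^ q * L)" using \<Lambda>(1) L t(1) by (simp add: ennreal_le_iff)
    also have "\<dots> \<le> \<delta>" unfolding \<delta>_def using \<Lambda>(1) t(1) by (intro mult_left_mono) auto
    finally show "euclid_dist m (z t) (v x) \<le> \<delta>" .
  qed
  \<comment> \<open>After division by \<open>c\<close> the third coordinate lies in the open disc of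
    radius \<open>t ^ (w $ 3)\<close> about \<open>t ^ (w $ 3)\<close>, hence in the right half
    plane, away from the branch cut of the retraction.\<close>
  have near: "h (\<Theta> (v x, s)) \<in> X" "Re (h (\<Theta> (v x, s)) $ 3 / of_real c) > 0" if x: "x \<in> K0" and s: "s \<in> {0..1}" for x s
  proof -
    have \<Theta>s: "\<Theta> (v x, s) \<in> cone_over N" "?dN (z t) (\<Theta> (v x, s)) \<le> ennreal (C * \<delta>)"
      using \<Theta>(2)[OF v(1,3)[OF x]] s by auto
    show "h (\<Theta> (v x, s)) \<in> X" using h(3)[OF \<Theta>s(1)] unfolding Y_def by blast
    have "ennreal (dist (S t x1) (h (\<Theta> (v x, s)))) \<le> ?dY (h (z t)) (h (\<Theta> (v x, s)))"
      unfolding zt(2) by (rule dist_le_inner_dist)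
    also have "\<dots> \<le> ennreal \<Lambda> * ?dN (z t) (\<Theta> (v x, s))" by (rule \<Lambda>(2)[OF zt(1) \<Theta>s(1)])
    also have "\<dots> \<le> ennreal \<Lambda> * ennreal (C * \<delta>)" by (intro mult_left_mono \<Theta>s(2)) simp
    also have "\<dots> = ennreal (\<Lambda> * (C * \<delta>))" using \<Lambda>(1) C \<delta> by (simp add: ennreal_mult)
    finally have "dist (S t x1) (h (\<Theta> (v x, s))) \<le> \<Lambda> * (C * \<delta>)" using \<Lambda>(1) C \<delta> by (simp add: ennreal_le_iff)
    also have "\<dots> = (\<Lambda> * C * \<Lambda> * (L + 1)) * t ^ q" unfolding \<delta>_def by (simp add: mult_ac)
    also have "\<dots> \<le> (\<Lambda> * C * \<Lambda> * (L + 1)) * (t ^ (w $ 3) * t)"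
      using pow[OF t(1,2)] \<Lambda>(1) C L by (intro mult_left_mono) auto
    also have "\<dots> = t ^ (w $ 3) * (t * (\<Lambda> * C * \<Lambda> * (L + 1)))" by (simp add: mult_ac)
    also have "\<dots> < t ^ (w $ 3) * \<bar>c\<bar>" using t by (intro mult_strict_left_mono) auto
    finally have "norm (h (\<Theta> (v x, s)) - S t x1) < t ^ (w $ 3) * \<bar>c\<bar>" by (simp add: dist_norm norm_minus_commute)
    then have "norm ((h (\<Theta> (v x, s)) - S t x1) $ 3) < t ^ (w $ 3) * \<bar>c\<bar>"
      using Finite_Cartesian_Product.norm_nth_le[of "h (\<Theta> (v x, s)) - S t x1" 3] by linarith
    then have "norm ((h (\<Theta> (v x, s)) - S t x1) $ 3 / of_real c) < t ^ (w $ 3)"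
      using zero(2) by (simp add: norm_divide divide_less_eq)
    moreover have "(h (\<Theta> (v x, s)) - S t x1) $ 3 / of_real c = h (\<Theta> (v x, s)) $ 3 / of_real c - of_real (t ^ (w $ 3))"
      unfolding S_def slice_lift_def using zero(2) by (simp add: diff_divide_distrib)
    ultimately have "\<bar>Re (h (\<Theta> (v x, s)) $ 3 / of_real c - of_real (t ^ (w $ 3)))\<bar> < t ^ (w $ 3)"
      using abs_Re_le_cmod le_less_trans by metis
    then show "Re (h (\<Theta> (v x, s)) $ 3 / of_real c) > 0" by (simp only: minus_complex.sel Re_complex_of_real)
  qed
  \<comment> \<open>Contract in the cone, map to \<open>X\<close>, normalise the third coordinate:
    within the complex slice this leads from the constant \<open>cpair x1\<close> at time 0 to the
    inclusion of \<open>K0\<close> at time 1.\<close>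
  define U where "U = (\<lambda>p. slice_retraction w c (h (\<Theta> (v (fst p), snd p))))"
  have w30: "0 < w $ 3" using w by blast
  show False
  proof (rule level_curve_real_locus_not_contractible[OF gAB pA pB smooth, where K=K0 and U=U and p="cpair x1"])
    show "ev G (cpair x) \<in> \<real>" "ev A (cpair x) \<in> \<real>" "ev B (cpair x) \<in> \<real>" for x
      unfolding ev_cpair by simp_all
    show "compact K0" "K0 \<noteq> {}" using K0 by auto
    show "ev G (cpair x) = 0" if "x \<in> K0" for x using that K0(2) unfolding evG_cpair K_def by auto
    show "\<exists>r>0. \<forall>y\<in>ball x r. ev G (cpair y) = 0 \<longrightarrow> y \<in> K0" if "x \<in> K0" for x
      using K0(4)[OF that] unfolding evG_cpair K_def by simp
    have "continuous_on K0 (S t)"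
    proof (rule lipschitz_on_continuous_on, rule lipschitz_onI)
      show "dist (S t x) (S t y) \<le> t ^ q * dist x y" for x y
        unfolding S_def using t q by (intro dist_slice_lift_le) auto
    qed (use t in simp)
    then have cv: "continuous_on K0 v"
      unfolding v_def using SYt K0(2) by (intro continuous_on_compose2[OF h(5)]) auto
    have "continuous_on (K0 \<times> {0..1}) (\<lambda>p. (v (fst p), snd p))"
      by (intro continuous_on_Pair continuous_on_compose2[OF cv continuous_on_fst] continuous_on_snd
          continuous_on_id) auto
    then have "continuous_on (K0 \<times> {0..1}) (\<lambda>p. \<Theta> (v (fst p), snd p))"
      by (rule continuous_on_compose2[OF \<Theta>(1)]) (use v in auto)
    then have "continuous_on (K0 \<times> {0..1}) (\<lambda>p. h (\<Theta> (v (fst p), snd p)))"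
      by (rule continuous_on_compose2[OF h(4)]) (use \<Theta>(2)[OF v(1,3)] in auto)
    then show "continuous_on (K0 \<times> {0..1}) U"
      unfolding U_def
    proof (rule continuous_on_compose2[OF continuous_on_slice_retraction[OF zero(2)]])
      show "(\<lambda>p. h (\<Theta> (v (fst p), snd p))) ` (K0 \<times> {0..1}) \<subseteq> {y. y $ 3 / of_real c \<notin> \<real>\<^sub>\<le>\<^sub>0}"
        using near(2) by (force simp: complex_nonpos_Reals_iff)
    qed
    show "ev G (U (x, s)) = 0" if x: "x \<in> K0" and s: "s \<in> {0..1}" for x s
    proof -
      have "h (\<Theta> (v x, s)) $ 3 \<noteq> 0" using near(2)[OF x s] by auto
      then show ?thesis
        unfolding evG U_def using near(1)[OF x s]
        by (simp add: X_def slice_retraction_in_slice[OF w30 zero(2) hom])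
    qed
    show "U (x, 1) = cpair x" if x: "x \<in> K0" for x
      unfolding U_def using \<Theta>(2)[OF v(1,3)[OF x]] v(2)[OF x]
      by (simp add: S_def slice_retraction_slice_lift[OF w30 t(1) zero(2)])
    show "U (x, 0) = cpair x1" if x: "x \<in> K0" for x
      unfolding U_def using \<Theta>(2)[OF v(1,3)[OF x]] zt(2)
      by (simp add: S_def slice_retraction_slice_lift[OF w30 t(1) zero(2)])
  qed
qed

theorem theorem5p4:
  fixes w :: "nat^3" and f :: "(3, real) mpoly"
  assumes "\<forall>i. 0 < w $ i"
    and "gcd (w $ 1) (gcd (w $ 2) (w $ 3)) = 1"
    and "weighted_homogeneous w f"
    and "irreducible_algebraic_set (complex_zeros f)"
    and "0 isolated_in surface_singular_locus (complex_zeros f)"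
    and "w $ 3 < inf (w $ 1) (w $ 2)"
    and "\<exists>C D. C \<noteq> D \<and>
           {C, D} \<subseteq> connected_components_of
             (subtopology (orbit_space w (complex_zeros f - {0}))
               (weighted_orbit w ` complex_point ` (real_zeros f - {0})))"
    and "real_zeros f \<inter> {x. x $ 1 * x $ 2 * x $ 3 = 0} = {0}"
  shows "\<not> metrically_conic (complex_zeros f) 0"
proof
  assume conic: "metrically_conic (complex_zeros f) 0"
  \<comment> \<open>An empty orbit set would have no component at all.\<close>
  have "real_zeros f - {0} \<noteq> {}"
  proof
    assume empty: "real_zeros f - {0} = {}"
    have "connected_components_of (subtopology (orbit_space w (complex_zeros f - {0}))
               (weighted_orbit w ` complex_point ` (real_zeros f - {0}))) = {}"
      unfolding empty by (simp add: connected_components_of_eq_empty)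
    then show False using assms(7) by auto
  qed
  then obtain x where x: "x \<in> real_zeros f" "x \<noteq> 0" by blast
  then have "x $ 3 \<noteq> 0" using assms(8) by force
  moreover have "peval f (x $ 1) (x $ 2) (x $ 3) = 0" using x(1) unfolding real_zeros_eq by simp
  \<comment> \<open>The product of the coordinates vanishes on the plane \<open>x3 = 0\<close>, so
    the third hypothesis leaves only the origin there.\<close>
  moreover have "a = 0 \<and> b = 0" if "peval f a b 0 = 0" for a b
  proof -
    have "vector [a, b, 0] \<in> real_zeros f \<inter> {x. x $ 1 * x $ 2 * x $ 3 = 0}"
      using that unfolding real_zeros_eq by simp
    then have "(vector [a, b, 0] :: real^3) = 0" using assms(8) by blast
    then show ?thesis by (simp add: vec_eq_iff forall_3)
  qed
  moreover have "w $ 3 < w $ 1" "w $ 3 < w $ 2" using assms(6) by (auto simp: inf_nat_def)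
  ultimately show False
    using fast_loops_not_metrically_conic[OF assms(1,3,5)] conic by blast
qed

end
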